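(* Let $H$ be a finite simple graph with at least one edge, and let $m$ be a positive integer. Then, as $n\to\infty$ (with $H$ and $m$ fixed), $$\chi_H(\mathbb{R}^n;m)\ \geq\ \left(\Gamma_{\chi}\sqrt{\frac{m+1}{\Xi(H)}}+o(1)\right)^n .$$
   Context: **Coloring numbers.** Let $A\subset\mathbb{R}_{>0}$ be finite and let $H$ be a finite simple graph with at least one edge. A copy of $H$ with edge lengths in $A$ is an injective map $\phi:V(H)\to\mathbb{R}^n$ such that $\|\phi(u)-\phi(v)\|_2\in A$ for every edge $uv\in E(H)$ (no condition is imposed on nonedges). $\chi_H(\mathbb{R}^n;A)$ is the least number of colors needed to color $\mathbb{R}^n$ so that there is no monochromatic copy of $H$ with edge lengths in $A$. For a positive integer $m$, $\chi_H(\mathbb{R}^n;m)=\max_{A\subset\mathbb{R}_{>0},\,|A|=m}\chi_H(\mathbb{R}^n;A)$. **Constant.** $\Gamma_{\chi}=\sqrt{\frac{\pi}{2}}\,\max_{x>0}\frac{1-e^{-x}}{\sqrt{x}}$. **The statistic $\Xi$.** For a graph $G$ and a partition $\pi$ of $V(G)$ into nonempty blocks, the quotient graph $G/\pi$ is the simple graph whose vertices are the blocks of $\pi$, two different blocks being adjacent when at least one edge of $G$ has one endpoint in each block. Let $\delta(Q)$ denote the minimum degree of a graph $Q$. Put $$\lambda(G)=\max_{\pi\text{ a partition of }V(G),\ |\pi|\geq 2}\delta(G/\pi),\qquad \lambda(K_1)=0.$$ Let $C_1,\dots,C_s$ be the connected components of $H$. A connected envelope of $H$ is a finite connected (simple)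 graph $F$ that contains each $C_i$ as a subgraph; the embeddings of the different components into $F$ are not required to be disjoint. Put $\widehat{\lambda}(H)=\min_F\lambda(F)$, the minimum over all connected envelopes $F$ of $H$. Let $d_1(H)\geq d_2(H)\geq\cdots\geq d_h(H)$ be the vertex degrees of $H$ in nonincreasing order, where $h=|V(H)|$. Then $\Xi(H)=\min\{\widehat{\lambda}(H),d_2(H)\}$. *)

theory Defs
  imports
    Complex_Main
    "HOL-Analysis.L2_Norm"
    "HOL-Library.Disjoint_Sets"
    "HOL-Library.FuncSet"
    "HOL-Library.Landau_Symbols"
    "HOL-Library.Multiset"
    "Graph_Theory.Digraph_Component"
    "Graph_Theory.Pair_Digraph"
begin

text \<open>
  A finite simple graph is a \<^term>\<open>G :: 'a pair_pre_digraph\<close> with \<^term>\<open>pair_graph G\<close>: finite,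
  loopfree, without parallel arcs, and symmetric, each edge \<open>uv\<close> being represented by
  the two arcs \<open>(u, v)\<close> and \<open>(v, u)\<close>. Hence the degree of a vertex is its out-degree.
\<close>

subsection \<open>Coloring numbers\<close>

text \<open>
  Since the dimension varies, Euclidean \<open>n\<close>-space is given by an explicit carrier: functions on
  \<open>{..<n}\<close> (with the value \<^term>\<open>undefined\<close> elsewhere), and \<^const>\<open>L2_set\<close> is the Euclidean norm.
\<close>

definition Rn :: "nat \<Rightarrow> (nat \<Rightarrow> real) set" where
  "Rn n = {..<n} \<rightarrow>\<^sub>E UNIV"

definition edist :: "nat \<Rightarrow> (nat \<Rightarrow> real) \<Rightarrow> (nat \<Rightarrow> real) \<Rightarrow> real" where
  "edist n x y = L2_set (\<lambda>i. x i - y i) {..<n}"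

definition graph_copy ::
    "nat \<Rightarrow> real set \<Rightarrow> 'a pair_pre_digraph \<Rightarrow> ('a \<Rightarrow> nat \<Rightarrow> real) \<Rightarrow> bool" where
  "graph_copy n A H \<phi> \<longleftrightarrow>
     \<phi> \<in> pverts H \<rightarrow> Rn n \<and> inj_on \<phi> (pverts H) \<and>
     (\<forall>(u, v) \<in> parcs H. edist n (\<phi> u) (\<phi> v) \<in> A)"

definition good_coloring ::
    "nat \<Rightarrow> real set \<Rightarrow> 'a pair_pre_digraph \<Rightarrow> nat \<Rightarrow> ((nat \<Rightarrow> real) \<Rightarrow> nat) \<Rightarrow> bool" where
  "good_coloring n A H k c \<longleftrightarrow>
     c \<in> Rn n \<rightarrow> {..<k} \<and>
     \<not> (\<exists>\<phi>. graph_copy n A H \<phi> \<and> (\<exists>i. \<forall>v \<in> pverts H. c (\<phi> v) = i))"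

definition chi_dist :: "'a pair_pre_digraph \<Rightarrow> nat \<Rightarrow> real set \<Rightarrow> nat" where
  "chi_dist H n A = (LEAST k. \<exists>c. good_coloring n A H k c)"

definition chi_max :: "'a pair_pre_digraph \<Rightarrow> nat \<Rightarrow> nat \<Rightarrow> nat" where
  "chi_max H n m = Max {chi_dist H n A | A. A \<subseteq> {0<..} \<and> finite A \<and> card A = m}"

text \<open>
  The least number of colors exists and is bounded in terms of \<open>n\<close> and \<open>m\<close> alone, so that the
  maximum defining \<^const>\<open>chi_max\<close> is taken over a finite nonempty set.
\<close>

definition grid_color :: "nat \<Rightarrow> real \<Rightarrow> (nat \<Rightarrow> real) \<Rightarrow> nat \<Rightarrow> nat" where
  "grid_color n a x = (\<lambda>i\<in>{..<n}. nat (\<lfloor>x i * (real n + 1) / a\<rfloor> mod (int n + 2)))"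

lemma grid_color_dist:
  assumes "a > 0" and eq: "grid_color n a x = grid_color n a y"
  shows "edist n x y \<noteq> a"
proof -
  let ?s = "(real n + 1) / a"
  have s: "?s > 0" using assms by simp
  have cong: "\<lfloor>x i * ?s\<rfloor> mod (int n + 2) = \<lfloor>y i * ?s\<rfloor> mod (int n + 2)" if "i < n" for i
  proof -
    have "grid_color n a x i = grid_color n a y i" using eq by simp
    then show ?thesis using that
      by (simp add: grid_color_def nat_eq_iff pos_mod_sign)
  qed
  show ?thesis
  proof (cases "\<forall>i<n. \<lfloor>x i * ?s\<rfloor> = \<lfloor>y i * ?s\<rfloor>")
    case True
    have le: "\<bar>x i - y i\<bar> \<le> 1 / ?s" if "i < n" for i
    proof -
      have "\<lfloor>x i * ?s\<rfloor> = \<lfloor>y i * ?s\<rfloor>" using True that by blast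
      then have "\<bar>x i * ?s - y i * ?s\<bar> \<le> 1" by linarith
      then have "\<bar>x i - y i\<bar> * ?s \<le> 1"
        using s by (metis abs_mult abs_of_pos left_diff_distrib)
      then show ?thesis using s by (simp only: pos_le_divide_eq)
    qed
    have "edist n x y \<le> (\<Sum>i<n. \<bar>x i - y i\<bar>)"
      unfolding edist_def by (rule L2_set_le_sum_abs)
    also have "\<dots> \<le> (\<Sum>i<n. 1 / ?s)" by (rule sum_mono) (use le in auto)
    also have "\<dots> = real n * a / (real n + 1)" by simp
    also have "\<dots> < a" using \<open>a > 0\<close> by (simp add: field_simps)
    finally show ?thesis by simp
  next
    case False
    then obtain i where i: "i < n" and ne: "\<lfloor>x i * ?s\<rfloor> \<noteq> \<lfloor>y i * ?s\<rfloor>" by blast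
    have "(int n + 2) dvd (\<lfloor>x i * ?s\<rfloor> - \<lfloor>y i * ?s\<rfloor>)"
      using cong[OF i] by (simp only: mod_eq_dvd_iff)
    then have "\<bar>\<lfloor>x i * ?s\<rfloor> - \<lfloor>y i * ?s\<rfloor>\<bar> \<ge> int n + 2"
      using ne by (smt (verit) dvd_imp_le_int)
    then have "\<bar>x i * ?s - y i * ?s\<bar> > real n + 1" by linarith
    then have "\<bar>x i - y i\<bar> * ?s > real n + 1"
      using s by (metis abs_mult abs_of_pos left_diff_distrib)
    then have "a * (real n + 1) < \<bar>x i - y i\<bar> * (real n + 1)"
      using \<open>a > 0\<close> by (simp add: field_simps)
    then have "\<bar>x i - y i\<bar> > a" by (rule mult_right_less_imp_less) simp
    moreover have "\<bar>x i - y i\<bar> \<le> edist n x y"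
      unfolding edist_def
      using member_le_L2_set[of "{..<n}" i "\<lambda>i. \<bar>x i - y i\<bar>"] i by (simp add: L2_set_def)
    ultimately show ?thesis by simp
  qed
qed

lemma good_coloring_exists:
  assumes "pair_graph H" and "parcs H \<noteq> {}" and "A \<subseteq> {0<..}" and "finite A"
  shows "\<exists>c. good_coloring n A H (((n + 2) ^ n) ^ card A) c"
proof -
  let ?S = "A \<rightarrow>\<^sub>E ({..<n} \<rightarrow>\<^sub>E {..<n + 2})"
  have fin: "finite ?S" using assms by (intro finite_PiE) auto
  have card: "card ?S = ((n + 2) ^ n) ^ card A"
    using assms by (simp add: card_PiE)
  obtain h where h: "bij_betw h ?S {0..<card ?S}"
    using ex_bij_betw_finite_nat[OF fin] by blast
  define g where "g x = (\<lambda>a\<in>A. grid_color n a x)" for x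
  have gS: "g x \<in> ?S" for x
    by (auto simp: g_def grid_color_def PiE_iff nat_less_iff extensional_def
        intro!: order.strict_trans2[OF pos_mod_bound])
  have "good_coloring n A H (card ?S) (\<lambda>x. h (g x))"
    unfolding good_coloring_def
  proof (intro conjI notI)
    show "(\<lambda>x. h (g x)) \<in> Rn n \<rightarrow> {..<card ?S}"
      using bij_betwE[OF h] gS by (auto simp: atLeast0LessThan)
  next
    assume "\<exists>\<phi>. graph_copy n A H \<phi> \<and> (\<exists>i. \<forall>v \<in> pverts H. h (g (\<phi> v)) = i)"
    then obtain \<phi> i where cp: "graph_copy n A H \<phi>"
      and mono: "\<And>v. v \<in> pverts H \<Longrightarrow> h (g (\<phi> v)) = i" by blast
    obtain u v where uv: "(u, v) \<in> parcs H" using assms(2) by auto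
    interpret pair_graph H by fact
    have "u \<in> pverts H" "v \<in> pverts H" using uv by (auto dest: in_arcsD1 in_arcsD2)
    then have "h (g (\<phi> u)) = h (g (\<phi> v))" using mono by simp
    then have geq: "g (\<phi> u) = g (\<phi> v)"
      using bij_betw_imp_inj_on[OF h] gS by (meson inj_onD)
    let ?a = "edist n (\<phi> u) (\<phi> v)"
    have a: "?a \<in> A" using cp uv by (auto simp: graph_copy_def)
    then have "grid_color n ?a (\<phi> u) = grid_color n ?a (\<phi> v)"
      using fun_cong[OF geq, of ?a] by (simp add: g_def)
    moreover have "?a > 0" using a assms(3) by auto
    ultimately show False using grid_color_dist by blast
  qed
  then show ?thesis unfolding card by blast
qed

lemma chi_dist_good_coloring:
  assumes "pair_graph H" and "parcs H \<noteq> {}" and "A \<subseteq> {0<..}" and "finite A"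
  shows "\<exists>c. good_coloring n A H (chi_dist H n A) c"
  unfolding chi_dist_def by (rule LeastI, rule good_coloring_exists[OF assms])

lemma chi_max_set:
  assumes "pair_graph H" and "parcs H \<noteq> {}"
  shows "finite {chi_dist H n A | A. A \<subseteq> {0<..} \<and> finite A \<and> card A = m}"
    and "{chi_dist H n A | A. A \<subseteq> {0<..} \<and> finite A \<and> card A = m} \<noteq> {}"
proof -
  have "chi_dist H n A \<le> ((n + 2) ^ n) ^ m"
    if "A \<subseteq> {0<..}" "finite A" "card A = m" for A
    unfolding chi_dist_def
    using good_coloring_exists[OF assms that(1,2), of n] that(3) by (auto intro: Least_le)
  then show "finite {chi_dist H n A | A. A \<subseteq> {0<..} \<and> finite A \<and> card A = m}"
    by (intro finite_subset[OF _ finite_atMost[of "((n + 2) ^ n) ^ m"]]) auto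
  have "infinite {0::real<..}" by (rule infinite_Ioi)
  then obtain A :: "real set" where "A \<subseteq> {0<..}" "finite A" "card A = m"
    using infinite_arbitrarily_large by metis
  then show "{chi_dist H n A | A. A \<subseteq> {0<..} \<and> finite A \<and> card A = m} \<noteq> {}" by blast
qed


subsection \<open>The constant\<close>

definition Gamma_chi :: real where
  "Gamma_chi = sqrt (pi / 2) * (SUP x\<in>{0<..}. (1 - exp (- x)) / sqrt x)"

text \<open>The supremum is attained, that is, it is a maximum.\<close>

lemma Gamma_chi_attained:
  "\<exists>x\<^sub>0>0. (\<forall>x>0. (1 - exp (- x)) / sqrt x \<le> (1 - exp (- x\<^sub>0)) / sqrt x\<^sub>0) \<and>
     (SUP x\<in>{0<..}. (1 - exp (- x)) / sqrt x) = (1 - exp (- x\<^sub>0)) / sqrt (x\<^sub>0 :: real)"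
proof -
  define f :: "real \<Rightarrow> real" where "f x = (1 - exp (- x)) / sqrt x" for x
  have "continuous_on {1/16..16} f" unfolding f_def
    by (intro continuous_intros) auto
  then obtain x\<^sub>0 where x\<^sub>0: "x\<^sub>0 \<in> {1/16..16}" and le: "\<And>x. x \<in> {1/16..16} \<Longrightarrow> f x \<le> f x\<^sub>0"
    using continuous_attains_sup[of "{1/16..16::real}" f] by auto
  have e: "exp (- 1) \<le> (1/2 :: real)"
  proof -
    have "2 \<le> exp (1::real)" using exp_ge_add_one_self[of 1] by simp
    then show ?thesis by (simp add: exp_minus field_simps)
  qed
  have "1/2 \<le> f 1" using e by (simp add: f_def)
  also have "f 1 \<le> f x\<^sub>0" by (rule le) simp
  finally have f0: "1/2 \<le> f x\<^sub>0" .
  have "f x \<le> f x\<^sub>0" if "x > 0" for x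
  proof -
    consider "x < 1/16" | "x \<in> {1/16..16}" | "x > 16" by fastforce
    then show ?thesis
    proof cases
      case 1
      have "1 - exp (- x) \<le> x" using exp_ge_add_one_self[of "- x"] by simp
      then have "f x \<le> x / sqrt x" unfolding f_def using that by (intro divide_right_mono) auto
      also have "\<dots> = sqrt x" using that by (simp add: real_div_sqrt)
      also have "\<dots> \<le> sqrt ((1/2)\<^sup>2)" using 1 by (intro real_sqrt_le_mono) (simp add: power2_eq_square)
      finally show ?thesis using f0 by simp
    next
      case 3
      have "4 = sqrt (4\<^sup>2)" by simp
      also have "\<dots> \<le> sqrt x" using 3 by (intro real_sqrt_le_mono) simp
      finally have s: "4 \<le> sqrt x" .
      have "f x \<le> 1 / sqrt x" unfolding f_def using that by (intro divide_right_mono) auto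
      also have "\<dots> \<le> 1 / 4" using s that by (intro divide_left_mono) auto
      finally show ?thesis using f0 by simp
    qed (use le in auto)
  qed
  moreover from this have "(SUP x\<in>{0<..}. f x) = f x\<^sub>0"
    using x\<^sub>0 by (intro cSup_eq_maximum) auto
  ultimately show ?thesis using x\<^sub>0 by (intro exI[of _ x\<^sub>0]) (auto simp: f_def)
qed


subsection \<open>The graph statistic\<close>

definition quotient_graph :: "'a pair_pre_digraph \<Rightarrow> 'a set set \<Rightarrow> 'a set pair_pre_digraph" where
  "quotient_graph G P =
     \<lparr> pverts = P,
       parcs = {(B, C). B \<in> P \<and> C \<in> P \<and> B \<noteq> C \<and> (\<exists>u\<in>B. \<exists>v\<in>C. (u, v) \<in> parcs G)} \<rparr>"

definition min_degree :: "'a pair_pre_digraph \<Rightarrow> nat" where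
  "min_degree G = Min (out_degree G ` pverts G)"

definition lam :: "'a pair_pre_digraph \<Rightarrow> nat" where
  "lam G = (if card (pverts G) \<le> 1 then 0
            else Max {min_degree (quotient_graph G P) | P. partition_on (pverts G) P \<and> card P \<ge> 2})"

text \<open>
  The connected components of a symmetric digraph are its strongly connected components. A component
  is contained in \<open>F\<close> as a subgraph if it embeds into \<open>F\<close>; each component has its own embedding.
\<close>

definition embeds_in :: "('a, 'b) pre_digraph \<Rightarrow> ('c, 'd) pre_digraph \<Rightarrow> bool" where
  "embeds_in C F \<longleftrightarrow>
     (\<exists>f. f \<in> verts C \<rightarrow> verts F \<and> inj_on f (verts C) \<and>
          (\<forall>u v. u \<rightarrow>\<^bsub>C\<^esub> v \<longrightarrow> f u \<rightarrow>\<^bsub>F\<^esub> f v))"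

definition connected_envelope :: "'a pair_pre_digraph \<Rightarrow> 'b pair_pre_digraph \<Rightarrow> bool" where
  "connected_envelope H F \<longleftrightarrow>
     pair_graph F \<and> Digraph_Component.connected F \<and>
     (\<forall>C \<in> pre_digraph.sccs (with_proj H). embeds_in C F)"

text \<open>
  Up to isomorphism every finite graph has vertices in \<^typ>\<open>nat\<close>, so it suffices to let the
  envelopes range over graphs on natural numbers.
\<close>

definition lam_hat :: "'a pair_pre_digraph \<Rightarrow> nat" where
  "lam_hat H = (LEAST l. \<exists>F :: nat pair_pre_digraph. connected_envelope H F \<and> lam F = l)"

definition degree_sequence :: "'a pair_pre_digraph \<Rightarrow> nat list" where
  "degree_sequence H =
     rev (sorted_list_of_multiset (image_mset (out_degree H) (mset_set (pverts H))))"

text \<open>List indices start at \<open>0\<close>, so the second largest degree has index \<open>1\<close>.\<close>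

definition Xi :: "'a pair_pre_digraph \<Rightarrow> nat" where
  "Xi H = min (lam_hat H) (degree_sequence H ! 1)"

text \<open>The maximum in \<^const>\<open>lam\<close> and the minimum in \<^const>\<open>lam_hat\<close> exist.\<close>

lemma lam_set:
  assumes "pair_graph G" and "card (pverts G) > 1"
  shows "finite {min_degree (quotient_graph G P) | P. partition_on (pverts G) P \<and> card P \<ge> 2}"
    and "{min_degree (quotient_graph G P) | P. partition_on (pverts G) P \<and> card P \<ge> 2} \<noteq> {}"
proof -
  interpret pair_graph G by fact
  have "finite {P. partition_on (pverts G) P}"
    using finitely_many_partition_on pair_finite_verts by blast
  then have "finite ((\<lambda>P. min_degree (quotient_graph G P)) ` {P. partition_on (pverts G) P})"
    by simp
  then show "finite {min_degree (quotient_graph G P) | P.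
      partition_on (pverts G) P \<and> card P \<ge> 2}"
    by (rule rev_finite_subset) auto
  let ?P = "(\<lambda>v. {v}) ` pverts G"
  have "partition_on (pverts G) ?P" by (auto intro!: partition_onI simp: disjnt_def)
  moreover have "card ?P \<ge> 2" using assms(2) by (subst card_image) auto
  ultimately show "{min_degree (quotient_graph G P) | P.
      partition_on (pverts G) P \<and> card P \<ge> 2} \<noteq> {}" by blast
qed

lemma connected_envelope_exists:
  assumes "pair_graph H" and "pverts H \<noteq> {}"
  shows "\<exists>F :: nat pair_pre_digraph. connected_envelope H F"
proof -
  interpret H: pair_graph H by fact
  let ?h = "card (pverts H)"
  define F :: "nat pair_pre_digraph" where
    "F = \<lparr> pverts = {..<?h}, parcs = {(u, v). u < ?h \<and> v < ?h \<and> u \<noteq> v} \<rparr>"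
  have "finite {(u, v). u < ?h \<and> v < ?h \<and> u \<noteq> v}"
    by (rule finite_subset[of _ "{..<?h} \<times> {..<?h}"]) auto
  then interpret F: pair_graph F
    by unfold_locales (auto simp: F_def symmetric_def sym_def)
  have h: "?h > 0" using assms H.pair_finite_verts by (simp add: card_gt_0_iff)
  have "u \<rightarrow>\<^sup>*\<^bsub>with_proj F\<^esub> v" if "u \<in> pverts F" "v \<in> pverts F" for u v
  proof (cases "u = v")
    case True then show ?thesis using that by auto
  next
    case False
    then have "(u, v) \<in> parcs F" using that by (auto simp: F_def)
    then show ?thesis by auto
  qed
  then have "strongly_connected F"
    using h by (auto simp: strongly_connected_def F_def)
  moreover have "mk_symmetric F = F"
    unfolding F_def mk_symmetric_def by auto
  ultimately have "Digraph_Component.connected F"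
    by (simp add: Digraph_Component.connected_def)
  moreover have "embeds_in C F" if "C \<in> pre_digraph.sccs (with_proj H)" for C
  proof -
    have sub: "subgraph C H" using that by (auto simp: pre_digraph.sccs_def induced_subgraph_def)
    obtain h where h: "bij_betw h (pverts H) {0..<?h}"
      using ex_bij_betw_finite_nat[OF H.pair_finite_verts] by blast
    have vs: "verts C \<subseteq> pverts H" using sub by (auto simp: subgraph_def)
    have arcs: "u \<in> pverts H \<and> v \<in> pverts H \<and> u \<noteq> v" if "u \<rightarrow>\<^bsub>C\<^esub> v" for u v
      using subsetD[OF arcs_ends_mono[OF sub] that]
      by (auto dest: H.in_arcsD1 H.in_arcsD2 H.no_loops')
    have inj: "inj_on h (pverts H)" and lt: "\<And>v. v \<in> pverts H \<Longrightarrow> h v < ?h"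
      using h by (auto simp: bij_betw_def)
    have "h u \<noteq> h v" if "u \<rightarrow>\<^bsub>C\<^esub> v" for u v
      using arcs[OF that] inj by (auto dest: inj_onD)
    then show ?thesis
      unfolding embeds_in_def
      using vs arcs lt inj_on_subset[OF inj vs] by (intro exI[of _ h]) (auto simp: F_def)
  qed
  ultimately show ?thesis
    unfolding connected_envelope_def using F.pair_graph by blast
qed

end

theory Submission
  imports Defs "HOL-Number_Theory.Cong" "HOL-Number_Theory.Prime_Powers"
    "HOL-Computational_Algebra.Squarefree" "HOL-Analysis.Harmonic_Numbers"
    "HOL-Analysis.Integral_Test" "HOL-Probability.Distributions" "HOL-Real_Asymp.Real_Asymp"
begin

text \<open>
  Let \<open>l = \<Xi>(H)\<close>, let \<open>x\<close> attain the maximum in \<open>\<Gamma>\<^sub>\<chi>\<close>, and let \<open>p\<close> be a prime just below \<open>n / (2 x l)\<close>.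
  Take \<open>A = {\<surd>(2 p j) | 1 \<le> j \<le> m}\<close> and let \<open>V\<close> consist of the integer points of one parity class in a ball
  of squared radius just below \<open>(m + 1) p / 2\<close>, centered so that their number is at least about the volume.
  Distinct points of \<open>V\<close> have a distance in \<open>A\<close> if and only if \<open>p\<close> divides \<open>|x - y|\<^sup>2\<close>, and by Fermat's theorem
  the indicator of this condition is \<open>1 - |x - y|\<^bsup>2 (p - 1)\<^esup>\<close> modulo \<open>p\<close>. A product of at most \<open>l\<close> such indicators in
  the same \<open>x\<close> lies in the space of polynomials of degree at most \<open>l (p - 1)\<close>, whose dimension is at most
  \<open>t\<^bsup>-l (p - 1)\<^esup> (1 - t)\<^bsup>-n - 1\<^esup>\<close> with \<open>t = e\<^bsup>-x\<^esup>\<close>. Up to a constant factor, no subset of \<open>V\<close> without a copy of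
  \<open>H\<close> exceeds this dimension.

  For the bound by \<open>d\<^sub>2\<close>, all points close to at most \<open>d\<^sub>2\<close> given ones form the support of a function of
  the space; after deleting small supports one can start from a constant map \<open>V(H) \<rightarrow> V\<close> and move all vertices but
  one to new points. For the bound by \<open>\<lambda>\<close>, the indicator of injectivity of a map is expanded into indicators of
  coarser partitions; a block of small degree in the quotient gives each nontrivial term a small partition rank, whereas the
  trivial partition gives a diagonal tensor.

  Primes \<open>p\<close> of the required size exist for every large \<open>n\<close> because the ratio of consecutive primes tends to \<open>1\<close>.
  This follows from Selberg's formula: if \<open>(q\<^sup>T, q\<^sup>T\<^sup>+\<^sup>3]\<close> contains no prime, then the masses of the windows
  \<open>(q\<^sup>i, q\<^sup>i\<^sup>+\<^sup>1]\<close> must almost all be extremal, which contradicts Mertens' theorem.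
\<close>

section \<open>Linear algebra modulo a prime\<close>

text \<open>Divisibility of the squared distance by \<open>p\<close> also holds for equal points, so
  a map of \<open>H\<close> that preserves it may be constant. What has to be forced is injectivity,
  and the two bounds in \<open>Xi\<close> reflect two ways of forcing it. All counts are compared on
  the scale of \<open>n\<close>-th powers. Constant factors are free, but a fixed relative error in
  \<open>p\<close> would cost an exponential factor; hence primes are needed in
  \<open>[(1 - \<eta>) y, y]\<close> for every \<open>\<eta> > 0\<close>. Origin of the size of
  \<open>p\<close>: for \<open>p = \<alpha> n\<close> and \<open>t = exp (- x)\<close> the points
  number about \<open>(pi e (m + 1) \<alpha>)^(n/2)\<close>, and the dimension is about
  \<open>(exp (x l \<alpha>) / (1 - t))^n\<close>. For fixed \<open>x\<close> the quotient is
  largest at \<open>2 x l \<alpha> = 1\<close>; what remains to be maximized is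
  \<open>(1 - exp (- x)) / sqrt x\<close>. Origin of the radius: it keeps squared distances below
  \<open>2 (m + 1) p\<close>. The parity class costs a factor 2 in the number of points and excludes
  odd multiples of \<open>p\<close>, which doubles the admissible squared radius for the same number
  \<open>m\<close> of distances.\<close>

lemma annihilating_weights_mod:
  fixes p :: int and f :: "'j \<Rightarrow> 'i \<Rightarrow> int"
  assumes "prime p" and "finite R" and "finite I"
  shows "\<exists>J h. J \<subseteq> I \<and> card I \<le> card J + card R \<and> (\<forall>x\<in>J. h x = 1) \<and>
           (\<forall>j\<in>R. p dvd (\<Sum>x\<in>I. h x * f j x))"
  using assms(2,3)
proof (induction R arbitrary: f I rule: finite_induct)
  case empty
  show ?case by (rule exI[of _ I], rule exI[of _ "\<lambda>_. 1"]) simp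
next
  case (insert r R)
  show ?case
  proof (cases "\<forall>x\<in>I. p dvd f r x")
    case True
    obtain J h where "J \<subseteq> I" "card I \<le> card J + card R" "\<forall>x\<in>J. h x = 1"
      "\<forall>j\<in>R. p dvd (\<Sum>x\<in>I. h x * f j x)"
      using insert.IH[OF insert.prems, of f] by blast
    moreover have "p dvd (\<Sum>x\<in>I. h x * f r x)"
      using True by (intro dvd_sum) auto
    ultimately show ?thesis using insert.hyps
      by (intro exI[of _ J] exI[of _ h]) auto
  next
    case False
    then obtain x\<^sub>0 where x0: "x\<^sub>0 \<in> I" "\<not> p dvd f r x\<^sub>0" by blast
    then have "coprime (f r x\<^sub>0) p"
      using \<open>prime p\<close> by (simp add: coprime_commute prime_imp_coprime)
    then obtain v where v: "[f r x\<^sub>0 * v = 1] (mod p)" using cong_solve_coprime_int by blast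
    \<comment> \<open>Gaussian elimination with pivot \<open>x\<^sub>0\<close>: every
      \<open>f' j\<close> vanishes there modulo \<open>p\<close>, so the weight at
      \<open>x\<^sub>0\<close> is free for annihilating \<open>f r\<close>, which suggests the value
      \<open>- v * S\<close>. Only pivots leave the set \<open>J\<close> of weight 1.\<close>
    define f' where "f' j x = f j x - f j x\<^sub>0 * v * f r x" for j x
    obtain J h where J: "J \<subseteq> I - {x\<^sub>0}" "card (I - {x\<^sub>0}) \<le> card J + card R" "\<forall>x\<in>J. h x = 1"
      and h: "\<forall>j\<in>R. p dvd (\<Sum>x\<in>I - {x\<^sub>0}. h x * f' j x)"
      using insert.IH[of "I - {x\<^sub>0}" f'] insert.prems by blast
    define S where "S = (\<Sum>x\<in>I - {x\<^sub>0}. h x * f r x)"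
    define h' where "h' = h(x\<^sub>0 := - v * S)"
    have split: "(\<Sum>x\<in>I. h' x * f j x) = - v * S * f j x\<^sub>0 + (\<Sum>x\<in>I - {x\<^sub>0}. h x * f j x)" for j
      using insert.prems x0 by (simp add: sum.remove h'_def)
    have "p dvd (\<Sum>x\<in>I. h' x * f r x)"
    proof -
      have "(\<Sum>x\<in>I. h' x * f r x) = S * (1 - f r x\<^sub>0 * v)"
        unfolding split S_def[symmetric] by (simp add: algebra_simps)
      moreover have "p dvd 1 - f r x\<^sub>0 * v" using v by (metis cong_iff_dvd_diff cong_sym)
      ultimately show ?thesis by simp
    qed
    moreover have "(\<Sum>x\<in>I. h' x * f j x) = (\<Sum>x\<in>I - {x\<^sub>0}. h x * f' j x)" for j
      unfolding split S_def f'_def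
      by (simp add: algebra_simps sum_subtractf sum_distrib_left sum_negf)
    ultimately have "\<forall>j\<in>insert r R. p dvd (\<Sum>x\<in>I. h' x * f j x)" using h by simp
    moreover have "\<forall>x\<in>J. h' x = 1" using J by (auto simp: h'_def)
    moreover have "card I \<le> card J + card (insert r R)"
      using J(2) x0 insert.prems insert.hyps by (simp add: card_Diff_singleton)
    ultimately show ?thesis using J(1) by (intro exI[of _ J] exI[of _ h']) auto
  qed
qed

text \<open>Deleting the support of a function of the span costs at most \<open>k\<close> points and
  turns this function into a nontrivial linear relation on the remaining points, so that one of the
  generators \<open>w e\<close> becomes redundant. This can happen at most \<open>card E\<close>
  times. In the contrapositive, a large \<open>I\<close> has a nonempty subset on which all nonempty
  supports have more than \<open>k\<close> points.\<close>

lemma card_le_if_small_supports_mod: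
  fixes p :: int and w :: "'e \<Rightarrow> 'i \<Rightarrow> int"
  assumes "prime p" and "finite E" and "finite I"
    and "\<And>J. J \<subseteq> I \<Longrightarrow> J \<noteq> {} \<Longrightarrow>
      \<exists>g. (\<exists>u. \<forall>x\<in>I. [g x = (\<Sum>e\<in>E. u e * w e x)] (mod p)) \<and>
        {x \<in> J. \<not> p dvd g x} \<noteq> {} \<and> card {x \<in> J. \<not> p dvd g x} \<le> k"
  shows "card I \<le> k * card E"
  using assms(2-)
proof (induction "card E" arbitrary: E I)
  case 0
  have "I = {}"
  proof (rule ccontr)
    assume "I \<noteq> {}"
    then obtain g u where "\<forall>x\<in>I. [g x = (\<Sum>e\<in>E. u e * w e x)] (mod p)"
        and ne: "{x \<in> I. \<not> p dvd g x} \<noteq> {}"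
      using 0(4)[of I] by blast
    moreover have "E = {}" using 0 by simp
    ultimately have "\<forall>x\<in>I. p dvd g x" by (simp add: cong_0_iff)
    then show False using ne by blast
  qed
  then show ?case by simp
next
  case (Suc n)
  show ?case
  proof (cases "I = {}")
    case False
    then obtain g u where g: "\<forall>x\<in>I. [g x = (\<Sum>e\<in>E. u e * w e x)] (mod p)"
      and ne: "{x \<in> I. \<not> p dvd g x} \<noteq> {}" and le: "card {x \<in> I. \<not> p dvd g x} \<le> k"
      using Suc.prems(3)[of I] by blast
    define I' where "I' = {x \<in> I. p dvd g x}"
    obtain x where x: "x \<in> I" "\<not> p dvd g x" using ne by blast
    then have "\<not> p dvd (\<Sum>e\<in>E. u e * w e x)" using g by (metis cong_dvd_iff)
    then obtain e where e: "e \<in> E" "\<not> p dvd u e" by (meson dvd_mult2 dvd_sum)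
    then have "coprime (u e) p"
      using \<open>prime p\<close> by (simp add: coprime_commute prime_imp_coprime)
    then obtain v where v: "[u e * v = 1] (mod p)" using cong_solve_coprime_int by blast
    have w: "[w e y = (\<Sum>e'\<in>E - {e}. - v * u e' * w e' y)] (mod p)" if "y \<in> I'" for y
    proof -
      have "[0 = g y] (mod p)" using that by (simp add: I'_def cong_0_iff cong_sym)
      also have "[g y = (\<Sum>e\<in>E. u e * w e y)] (mod p)" using g that by (simp add: I'_def)
      also have "(\<Sum>e\<in>E. u e * w e y) = u e * w e y + (\<Sum>e'\<in>E - {e}. u e' * w e' y)"
        using Suc.prems(1) e by (simp add: sum.remove)
      finally have "[v * 0 = v * (u e * w e y + (\<Sum>e'\<in>E - {e}. u e' * w e' y))] (mod p)"
        by (rule cong_scalar_left)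
      then have 1: "[0 = (u e * v) * w e y + v * (\<Sum>e'\<in>E - {e}. u e' * w e' y)] (mod p)"
        by (simp add: algebra_simps)
      have "[(u e * v) * w e y + v * (\<Sum>e'\<in>E - {e}. u e' * w e' y)
          = 1 * w e y + v * (\<Sum>e'\<in>E - {e}. u e' * w e' y)] (mod p)"
        by (intro cong_add cong_mult v cong_refl)
      with 1 have "[0 = 1 * w e y + v * (\<Sum>e'\<in>E - {e}. u e' * w e' y)] (mod p)"
        by (rule cong_trans)
      then have "[0 - v * (\<Sum>e'\<in>E - {e}. u e' * w e' y)
          = 1 * w e y + v * (\<Sum>e'\<in>E - {e}. u e' * w e' y) - v * (\<Sum>e'\<in>E - {e}. u e' * w e' y)] (mod p)"
        by (intro cong_diff) auto
      then show ?thesis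
        by (simp add: sum_distrib_left sum_negf algebra_simps cong_sym)
    qed
    have "card I' \<le> k * card (E - {e})"
    proof (rule Suc.hyps(1))
      show "n = card (E - {e})" using Suc.hyps(2) Suc.prems(1) e by simp
      show "finite (E - {e})" "finite I'" using Suc.prems by (auto simp: I'_def)
    next
      fix J assume J: "J \<subseteq> I'" "J \<noteq> {}"
      then have "J \<subseteq> I" by (auto simp: I'_def)
      then obtain g' u' where g': "\<forall>x\<in>I. [g' x = (\<Sum>e\<in>E. u' e * w e x)] (mod p)"
        and J': "{x \<in> J. \<not> p dvd g' x} \<noteq> {}" "card {x \<in> J. \<not> p dvd g' x} \<le> k"
        using Suc.prems(3)[of J] J by blast
      have "[g' y = (\<Sum>e'\<in>E - {e}. (u' e' - u' e * v * u e') * w e' y)] (mod p)" if "y \<in> I'" for y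
      proof -
        have "[g' y = (\<Sum>e\<in>E. u' e * w e y)] (mod p)" using g' that by (simp add: I'_def)
        also have "(\<Sum>e\<in>E. u' e * w e y) = u' e * w e y + (\<Sum>e'\<in>E - {e}. u' e' * w e' y)"
          using Suc.prems(1) e by (simp add: sum.remove)
        also have "[\<dots> = u' e * (\<Sum>e'\<in>E - {e}. - v * u e' * w e' y)
            + (\<Sum>e'\<in>E - {e}. u' e' * w e' y)] (mod p)"
          by (intro cong_add cong_mult w that cong_refl)
        also have "u' e * (\<Sum>e'\<in>E - {e}. - v * u e' * w e' y) + (\<Sum>e'\<in>E - {e}. u' e' * w e' y)
            = (\<Sum>e'\<in>E - {e}. (u' e' - u' e * v * u e') * w e' y)"
          by (simp add: sum_distrib_left sum.distrib[symmetric] algebra_simps)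
        finally show ?thesis .
      qed
      then show "\<exists>g. (\<exists>u. \<forall>x\<in>I'. [g x = (\<Sum>e'\<in>E - {e}. u e' * w e' x)] (mod p)) \<and>
          {x \<in> J. \<not> p dvd g x} \<noteq> {} \<and> card {x \<in> J. \<not> p dvd g x} \<le> k"
        using J' by (intro exI[of _ g'] conjI exI[of _ "\<lambda>e'. u' e' - u' e * v * u e'"]) auto
    qed
    moreover have "card I = card I' + card {x \<in> I. \<not> p dvd g x}"
      unfolding I'_def using Suc.prems(2)
      by (subst card_Un_disjoint[symmetric]) (auto intro!: arg_cong[of _ _ card])
    moreover have "card E = Suc (card (E - {e}))" using Suc.hyps(2) Suc.prems(1) e by simp
    ultimately show ?thesis using le by simp
  qed simp
qed

text \<open>Tensors are functions of maps, with one argument for each element of the index set. A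
  term of partition rank one is then a product of two such functions that depend on complementary
  nonempty sets of arguments.\<close>

definition depends_only_on :: "'v set \<Rightarrow> (('v \<Rightarrow> 'i) \<Rightarrow> int) \<Rightarrow> bool" where
  "depends_only_on B f \<longleftrightarrow> (\<forall>\<phi> \<psi>. (\<forall>v\<in>B. \<phi> v = \<psi> v) \<longrightarrow> f \<phi> = f \<psi>)"

lemma depends_only_onD:
  "depends_only_on B f \<Longrightarrow> (\<And>v. v \<in> B \<Longrightarrow> \<phi> v = \<psi> v) \<Longrightarrow> f \<phi> = f \<psi>"
  by (simp add: depends_only_on_def)

text \<open>
  This says that a diagonal tensor with \<open>N\<close> nonzero diagonal entries has partition rank at least \<open>N\<close>.
\<close>

lemma card_le_partition_rank_mod:
  fixes p :: int and f g :: "'j \<Rightarrow> ('v \<Rightarrow> 'i) \<Rightarrow> int"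
  assumes "prime p" and "finite V" and "V \<noteq> {}" and "finite I" and "finite R"
    and B: "\<And>j. j \<in> R \<Longrightarrow> B j \<noteq> {} \<and> B j \<subset> V"
    and f: "\<And>j. j \<in> R \<Longrightarrow> depends_only_on (B j) (f j)"
    and g: "\<And>j. j \<in> R \<Longrightarrow> depends_only_on (V - B j) (g j)"
    and h: "\<And>x. x \<in> I \<Longrightarrow> \<not> p dvd h x"
    and off: "\<And>\<phi>. \<phi> ` V \<subseteq> I \<Longrightarrow> \<not> (\<exists>x. \<forall>v\<in>V. \<phi> v = x) \<Longrightarrow> p dvd (\<Sum>j\<in>R. f j \<phi> * g j \<phi>)"
    and diag: "\<And>\<phi> x. x \<in> I \<Longrightarrow> (\<forall>v\<in>V. \<phi> v = x) \<Longrightarrow> [(\<Sum>j\<in>R. f j \<phi> * g j \<phi>) = h x] (mod p)"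
  shows "card I \<le> card R"
  using assms(2-)
proof (induction V arbitrary: I R B f g rule: finite_ne_induct)
  case (singleton a)
  have "R = {}" using singleton.prems(3) by blast
  have "I = {}"
  proof (rule ccontr)
    assume "I \<noteq> {}"
    then obtain x where "x \<in> I" by blast
    then have "[0 = h x] (mod p)"
      using singleton.prems(8)[of x "\<lambda>_. x"] \<open>R = {}\<close> by simp
    then show False using singleton.prems(6)[OF \<open>x \<in> I\<close>] cong_0_iff cong_sym by blast
  qed
  then show ?case by simp
next
  case (insert a V)
  note B = insert.prems(3) and f = insert.prems(4) and g = insert.prems(5)
    and h = insert.prems(6) and off = insert.prems(7) and diag = insert.prems(8)
  \<comment> \<open>These are the terms in which the argument \<open>a\<close> is separated from all
    others; \<open>\<alpha> j\<close> below is their factor in this argument. All other terms still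
    have a nonempty proper block after \<open>a\<close> is removed.\<close>
  define R1 where "R1 = {j \<in> R. B j = {a} \<or> B j = V}"
  define c :: "'i \<Rightarrow> 'v \<Rightarrow> 'i" where "c x = (\<lambda>_. x)" for x
  define \<alpha> where "\<alpha> j x = (if B j = {a} then f j (c x) else g j (c x))" for j x
  obtain J \<eta> where J: "J \<subseteq> I" "card I \<le> card J + card R1" "\<forall>x\<in>J. \<eta> x = 1"
    and ann: "\<forall>j\<in>R1. p dvd (\<Sum>x\<in>I. \<eta> x * \<alpha> j x)"
    using annihilating_weights_mod[OF \<open>prime p\<close>, of R1 I \<alpha>] insert.prems(1,2)
    by (auto simp: R1_def)
  define up where "up \<phi> x = \<phi>(a := x)" for \<phi> :: "'v \<Rightarrow> 'i" and x
  define B' where "B' j = B j - {a}" for j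
  define f' where "f' j \<phi> = (if a \<in> B j then \<Sum>x\<in>I. \<eta> x * f j (up \<phi> x) else f j \<phi>)" for j \<phi>
  define g' where "g' j \<phi> = (if a \<in> B j then g j \<phi> else \<Sum>x\<in>I. \<eta> x * g j (up \<phi> x))" for j \<phi>
  \<comment> \<open>The argument \<open>a\<close> is summed out against \<open>\<eta>\<close>. Terms
    of \<open>R1\<close> vanish because \<open>\<eta>\<close> annihilates their
    \<open>\<alpha> j\<close>; every other term stays a product, since only one of its two factors
    depends on \<open>a\<close>.\<close>
  have contract: "[(\<Sum>j\<in>R - R1. f' j \<phi> * g' j \<phi>)
      = (\<Sum>x\<in>I. \<eta> x * (\<Sum>j\<in>R. f j (up \<phi> x) * g j (up \<phi> x)))] (mod p)" for \<phi>
  proof -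
    have contr: "(\<Sum>x\<in>I. \<eta> x * (f j (up \<phi> x) * g j (up \<phi> x))) = f' j \<phi> * g' j \<phi>" if "j \<in> R" for j
    proof (cases "a \<in> B j")
      case True
      have "g j (up \<phi> x) = g j \<phi>" for x
        by (rule depends_only_onD[OF g[OF that]]) (use True in \<open>auto simp: up_def\<close>)
      then show ?thesis using True by (simp add: f'_def g'_def sum_distrib_right mult.assoc)
    next
      case False
      have "f j (up \<phi> x) = f j \<phi>" for x
        by (rule depends_only_onD[OF f[OF that]]) (use False in \<open>auto simp: up_def\<close>)
      then show ?thesis using False by (simp add: f'_def g'_def sum_distrib_left algebra_simps)
    qed
    have zero: "p dvd f' j \<phi> * g' j \<phi>" if "j \<in> R1" for j
    proof (cases "a \<in> B j")
      case True
      then have Bj: "B j = {a}" and j: "j \<in> R" using that insert.hyps(3) unfolding R1_def by blast+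
      have "f j (up \<phi> x) = f j (c x)" for x
        by (rule depends_only_onD[OF f[OF j]]) (simp add: up_def c_def Bj)
      then have "f' j \<phi> = (\<Sum>x\<in>I. \<eta> x * \<alpha> j x)" using True Bj by (simp add: f'_def \<alpha>_def)
      then show ?thesis using ann that by simp
    next
      case False
      then have Bj: "B j = V" and j: "j \<in> R" using that unfolding R1_def by blast+
      have "insert a V - B j = {a}" using Bj insert.hyps(3) by blast
      then have "g j (up \<phi> x) = g j (c x)" for x
        by (intro depends_only_onD[OF g[OF j]]) (simp add: up_def c_def)
      moreover have "B j \<noteq> {a}" using False by blast
      ultimately have "g' j \<phi> = (\<Sum>x\<in>I. \<eta> x * \<alpha> j x)" using False by (simp add: g'_def \<alpha>_def)
      then show ?thesis using ann that by simp
    qed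
    have "(\<Sum>x\<in>I. \<eta> x * (\<Sum>j\<in>R. f j (up \<phi> x) * g j (up \<phi> x)))
        = (\<Sum>j\<in>R. \<Sum>x\<in>I. \<eta> x * (f j (up \<phi> x) * g j (up \<phi> x)))"
      by (subst sum.swap) (simp add: sum_distrib_left)
    also have "\<dots> = (\<Sum>j\<in>R. f' j \<phi> * g' j \<phi>)" by (rule sum.cong) (simp_all add: contr)
    also have "\<dots> = (\<Sum>j\<in>R - R1. f' j \<phi> * g' j \<phi>) + (\<Sum>j\<in>R1. f' j \<phi> * g' j \<phi>)"
      using insert.prems(2) by (intro sum.subset_diff) (auto simp: R1_def)
    also have "[\<dots> = (\<Sum>j\<in>R - R1. f' j \<phi> * g' j \<phi>) + 0] (mod p)"
      by (intro cong_add cong_refl) (simp add: cong_0_iff dvd_sum zero)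
    finally show ?thesis by (simp add: cong_sym)
  qed
  have "card J \<le> card (R - R1)"
  proof (rule insert.IH[where I = J and R = "R - R1" and B = B' and f = f' and g = g'])
    show "finite J" "finite (R - R1)" using insert.prems(1,2) J(1) finite_subset by auto
  next
    fix j assume j: "j \<in> R - R1"
    then have Bj: "B j \<noteq> {}" "B j \<subset> insert a V" "B j \<noteq> {a}" "B j \<noteq> V" using B[of j] unfolding R1_def by blast+
    then show "B' j \<noteq> {} \<and> B' j \<subset> V" using insert.hyps(3) unfolding B'_def by blast
    show "depends_only_on (B' j) (f' j)"
      unfolding depends_only_on_def
    proof (intro allI impI)
      fix \<phi> \<psi> :: "'v \<Rightarrow> 'i" assume eq: "\<forall>v\<in>B' j. \<phi> v = \<psi> v"
      have "f j (up \<phi> x) = f j (up \<psi> x)" for x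
        by (rule depends_only_onD[OF f]) (use j eq in \<open>auto simp: up_def B'_def\<close>)
      moreover have "f j \<phi> = f j \<psi>" if "a \<notin> B j"
        by (rule depends_only_onD[OF f]) (use j eq that in \<open>auto simp: B'_def\<close>)
      ultimately show "f' j \<phi> = f' j \<psi>" by (simp add: f'_def)
    qed
    show "depends_only_on (V - B' j) (g' j)"
      unfolding depends_only_on_def
    proof (intro allI impI)
      fix \<phi> \<psi> :: "'v \<Rightarrow> 'i" assume eq: "\<forall>v\<in>V - B' j. \<phi> v = \<psi> v"
      have "g j (up \<phi> x) = g j (up \<psi> x)" for x
        by (rule depends_only_onD[OF g]) (use j eq in \<open>auto simp: up_def B'_def\<close>)
      moreover have "g j \<phi> = g j \<psi>" if "a \<in> B j"
        by (rule depends_only_onD[OF g]) (use j eq that in \<open>auto simp: B'_def\<close>)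
      ultimately show "g' j \<phi> = g' j \<psi>" by (simp add: g'_def)
    qed
  next
    fix x assume "x \<in> J" then show "\<not> p dvd h x" using h J(1) by blast
  next
    fix \<phi> :: "'v \<Rightarrow> 'i" assume im: "\<phi> ` V \<subseteq> J" and nc: "\<not> (\<exists>x. \<forall>v\<in>V. \<phi> v = x)"
    have "p dvd (\<Sum>x\<in>I. \<eta> x * (\<Sum>j\<in>R. f j (up \<phi> x) * g j (up \<phi> x)))"
    proof (rule dvd_sum, rule dvd_mult, rule off)
      fix x assume "x \<in> I"
      then show "up \<phi> x ` insert a V \<subseteq> I" using im J(1) by (auto simp: up_def)
      show "\<not> (\<exists>y. \<forall>v\<in>insert a V. up \<phi> x v = y)"
        using nc insert.hyps by (metis fun_upd_apply insertCI up_def)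
    qed
    then show "p dvd (\<Sum>j\<in>R - R1. f' j \<phi> * g' j \<phi>)"
      using contract cong_dvd_iff by blast
  next
    fix \<phi> :: "'v \<Rightarrow> 'i" and y assume y: "y \<in> J" and const: "\<forall>v\<in>V. \<phi> v = y"
    have yI: "y \<in> I" using y J(1) by blast
    \<comment> \<open>Inserting \<open>x \<noteq> y\<close> at \<open>a\<close> leaves the diagonal,
      so only \<open>x = y\<close> contributes to the contraction, with weight 1 because
      \<open>y\<close> lies in \<open>J\<close>. The contracted tensor is therefore diagonal on
      \<open>J\<close> with the same entries.\<close>
    have "p dvd \<eta> x * (\<Sum>j\<in>R. f j (up \<phi> x) * g j (up \<phi> x))" if "x \<in> I - {y}" for x
    proof (rule dvd_mult, rule off)
      show "up \<phi> x ` insert a V \<subseteq> I" using that const yI by (auto simp: up_def)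
      obtain v where v: "v \<in> V" using insert.hyps by blast
      then have "up \<phi> x v = y" "up \<phi> x a = x" using const insert.hyps by (auto simp: up_def)
      then show "\<not> (\<exists>z. \<forall>v\<in>insert a V. up \<phi> x v = z)"
        using v that by (metis Diff_iff insertCI)
    qed
    then have dvd: "p dvd (\<Sum>x\<in>I - {y}. \<eta> x * (\<Sum>j\<in>R. f j (up \<phi> x) * g j (up \<phi> x)))"
      by (rule dvd_sum)
    have "(\<Sum>x\<in>I. \<eta> x * (\<Sum>j\<in>R. f j (up \<phi> x) * g j (up \<phi> x)))
        = (\<Sum>j\<in>R. f j (up \<phi> y) * g j (up \<phi> y))
        + (\<Sum>x\<in>I - {y}. \<eta> x * (\<Sum>j\<in>R. f j (up \<phi> x) * g j (up \<phi> x)))"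
      using insert.prems(1) yI y J(3) by (simp add: sum.remove)
    also have "[\<dots> = (\<Sum>j\<in>R. f j (up \<phi> y) * g j (up \<phi> y)) + 0] (mod p)"
      using dvd by (intro cong_add cong_refl) (simp add: cong_0_iff)
    also have "[(\<Sum>j\<in>R. f j (up \<phi> y) * g j (up \<phi> y)) + 0 = h y] (mod p)"
      unfolding add_0_right by (rule diag[OF yI]) (use const in \<open>simp add: up_def\<close>)
    finally show "[(\<Sum>j\<in>R - R1. f' j \<phi> * g' j \<phi>) = h y] (mod p)"
      using contract cong_trans by blast
  qed
  moreover have "R1 \<subseteq> R" unfolding R1_def by blast
  then have "card R = card (R - R1) + card R1"
    using insert.prems(2) card_mono[of R R1] finite_subset[of R1 R] by (simp add: card_Diff_subset)
  ultimately show ?case using J(2) by simp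
qed

section \<open>Embedding graphs under a rank condition\<close>

definition embeds_near :: "('p \<Rightarrow> 'p \<Rightarrow> bool) \<Rightarrow> 'p set \<Rightarrow> 'a pair_pre_digraph \<Rightarrow> bool" where
  "embeds_near near I H \<longleftrightarrow> (\<exists>\<phi>. \<phi> \<in> pverts H \<rightarrow> I \<and> inj_on \<phi> (pverts H) \<and>
     (\<forall>(u, v)\<in>parcs H. near (\<phi> u) (\<phi> v)))"

text \<open>The graph theoretic part uses the geometry only through this condition: modulo
  \<open>p\<close>, the indicators of common neighbourhoods of at most \<open>l\<close> points lie
  in a space spanned by \<open>D\<close> functions. The functions \<open>w\<close> must not depend
  on \<open>Y\<close>.\<close>

definition nbhd_rank_le :: "int \<Rightarrow> 'p set \<Rightarrow> ('p \<Rightarrow> 'p \<Rightarrow> bool) \<Rightarrow> nat \<Rightarrow> nat \<Rightarrow> bool" where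
  "nbhd_rank_le p I near l D \<longleftrightarrow> (\<exists>w :: nat \<Rightarrow> 'p \<Rightarrow> int. \<forall>Y\<subseteq>I. card Y \<le> l \<longrightarrow>
     (\<exists>u. \<forall>x\<in>I. [of_bool (\<forall>y\<in>Y. near x y) = (\<Sum>e<D. u e * w e x)] (mod p)))"

lemma nbhd_rank_le_subset: "nbhd_rank_le p (I :: 'p set) near l D \<Longrightarrow> I' \<subseteq> I \<Longrightarrow> nbhd_rank_le p I' near l D"
  unfolding nbhd_rank_le_def
proof (elim exE)
  fix w :: "nat \<Rightarrow> 'p \<Rightarrow> int"
  assume w: "\<forall>Y\<subseteq>I. card Y \<le> l \<longrightarrow> (\<exists>u. \<forall>x\<in>I. [of_bool (\<forall>y\<in>Y. near x y) = (\<Sum>e<D. u e * w e x)] (mod p))"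
    and sub: "I' \<subseteq> I"
  show "\<exists>w. \<forall>Y\<subseteq>I'. card Y \<le> l \<longrightarrow> (\<exists>u. \<forall>x\<in>I'. [of_bool (\<forall>y\<in>Y. near x y) = (\<Sum>e<D. u e * w e x)] (mod p))"
  proof (intro exI[of _ w] allI impI)
    fix Y assume "Y \<subseteq> I'" "card Y \<le> l"
    then obtain u where "\<forall>x\<in>I. [of_bool (\<forall>y\<in>Y. near x y) = (\<Sum>e<D. u e * w e x)] (mod p)"
      using w sub by (meson subset_trans)
    then show "\<exists>u. \<forall>x\<in>I'. [of_bool (\<forall>y\<in>Y. near x y) = (\<Sum>e<D. u e * w e x)] (mod p)"
      using sub by blast
  qed
qed

lemma out_degree_pair: "out_degree (with_proj G) v = card {u. (v, u) \<in> parcs G}"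
proof -
  have "out_arcs (with_proj G) v = Pair v ` {u. (v, u) \<in> parcs G}"
    by (auto simp: out_arcs_def)
  moreover have "inj_on (Pair v) {u. (v, u) \<in> parcs G}" by (rule inj_onI) simp
  ultimately show ?thesis unfolding out_degree_def by (simp add: card_image)
qed

text \<open>A vertex is moved within the common neighbourhood of the current images of its
  neighbours, which is of the controlled form if its degree is at most \<open>l\<close>. The vertex
  \<open>r\<close> never moves, so its degree is unrestricted; this is why the second largest degree
  suffices.\<close>

lemma embeds_near_if_degrees_le:
  fixes p :: int and near :: "'p \<Rightarrow> 'p \<Rightarrow> bool"
  assumes H: "pair_graph H" and r: "r \<in> pverts H"
    and deg: "\<And>v. v \<in> pverts H \<Longrightarrow> v \<noteq> r \<Longrightarrow> out_degree H v \<le> l"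
    and near: "\<And>x. near x x" "\<And>x y. near x y \<Longrightarrow> near y x"
    and p: "prime p" and I: "finite I" and rank: "nbhd_rank_le p I near l D"
    and large: "card I > card (pverts H) * D"
  shows "embeds_near near I H"
proof -
  interpret pair_graph H by (rule H)
  define V where "V = pverts H"
  have finV: "finite V" using pair_finite_verts by (simp add: V_def)
  obtain w :: "nat \<Rightarrow> 'p \<Rightarrow> int" where w: "\<forall>Y\<subseteq>I. card Y \<le> l \<longrightarrow>
     (\<exists>u. \<forall>x\<in>I. [of_bool (\<forall>y\<in>Y. near x y) = (\<Sum>e<D. u e * w e x)] (mod p))"
    by (rule exE[OF rank[unfolded nbhd_rank_le_def]])
  have p1: "\<not> p dvd 1" using prime_gt_1_int[OF p] by auto
  \<comment> \<open>Otherwise every nonempty \<open>J\<close> would contain a nonempty common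
    neighbourhood with at most \<open>card V\<close> points, and the bound for small supports would
    contradict the size of \<open>I\<close>.\<close>
  have "\<exists>J\<subseteq>I. J \<noteq> {} \<and> (\<forall>Y\<subseteq>I. card Y \<le> l \<longrightarrow> {x \<in> J. \<forall>y\<in>Y. near x y} \<noteq> {} \<longrightarrow>
      card {x \<in> J. \<forall>y\<in>Y. near x y} > card V)"
  proof (rule ccontr)
    assume neg: "\<not> ?thesis"
    have "card I \<le> card V * card {..<D}"
    proof (rule card_le_if_small_supports_mod[where E = "{..<D}" and w = w and k = "card V", OF p _ I])
      fix J assume "J \<subseteq> I" "J \<noteq> {}"
      then have "\<not> (\<forall>Y\<subseteq>I. card Y \<le> l \<longrightarrow> {x \<in> J. \<forall>y\<in>Y. near x y} \<noteq> {} \<longrightarrow>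
          card {x \<in> J. \<forall>y\<in>Y. near x y} > card V)"
        using neg by blast
      then obtain Y where Y: "Y \<subseteq> I" "card Y \<le> l" "{x \<in> J. \<forall>y\<in>Y. near x y} \<noteq> {}"
        "card {x \<in> J. \<forall>y\<in>Y. near x y} \<le> card V"
        unfolding not_all not_imp not_less by (elim exE conjE) (rule that)
      have "{x \<in> J. \<not> p dvd of_bool (\<forall>y\<in>Y. near x y)} = {x \<in> J. \<forall>y\<in>Y. near x y}"
        using p1 by auto
      then show "\<exists>g. (\<exists>u. \<forall>x\<in>I. [g x = (\<Sum>e\<in>{..<D}. u e * w e x)] (mod p)) \<and>
        {x \<in> J. \<not> p dvd g x} \<noteq> {} \<and> card {x \<in> J. \<not> p dvd g x} \<le> card V"
        using w[rule_format, OF Y(1,2)] Y(3,4) by (intro exI[of _ "\<lambda>x. of_bool (\<forall>y\<in>Y. near x y)"]) simp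
    qed simp
    then show False using large by (simp add: V_def)
  qed
  then obtain J x\<^sub>0 where J: "J \<subseteq> I" "x\<^sub>0 \<in> J" and many: "\<And>Y. Y \<subseteq> I \<Longrightarrow> card Y \<le> l \<Longrightarrow>
      {x \<in> J. \<forall>y\<in>Y. near x y} \<noteq> {} \<Longrightarrow> card {x \<in> J. \<forall>y\<in>Y. near x y} > card V"
    by blast
  \<comment> \<open>\<open>S\<close> is the set of vertices moved so far. Nearness along all edges
    is kept throughout; injectivity is claimed only on \<open>S\<close> and \<open>r\<close>, since
    the other vertices still sit on the starting point.\<close>
  have "\<exists>\<phi>. \<phi> ` V \<subseteq> J \<and> inj_on \<phi> (insert r S) \<and> (\<forall>(u, v)\<in>parcs H. near (\<phi> u) (\<phi> v))"
    if "finite S" "S \<subseteq> V - {r}" for S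
    using that
  proof (induction S rule: finite_induct)
    case empty
    show ?case using J near by (intro exI[of _ "\<lambda>_. x\<^sub>0"]) auto
  next
    case (insert v S)
    have "S \<subseteq> V - {r}" using insert.prems by blast
    then obtain \<phi> where \<phi>: "\<phi> ` V \<subseteq> J" "inj_on \<phi> (insert r S)"
      and hom: "\<forall>(u, v)\<in>parcs H. near (\<phi> u) (\<phi> v)" using insert.IH by blast
    have \<phi>3: "near (\<phi> u) (\<phi> v)" if "(u, v) \<in> parcs H" for u v using hom that by blast
    have v: "v \<in> V" "v \<noteq> r" using insert.prems by auto
    define Y where "Y = \<phi> ` {u. (v, u) \<in> parcs H}"
    have sub: "{u. (v, u) \<in> parcs H} \<subseteq> V" unfolding V_def using in_arcsD2 by auto
    then have "Y \<subseteq> I" using \<phi>(1) J(1) by (auto simp: Y_def)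
    moreover have "card Y \<le> l"
      using deg[of v] v card_image_le[OF finite_subset[OF sub finV], of \<phi>]
      by (simp add: Y_def out_degree_pair V_def)
    \<comment> \<open>The present image of \<open>v\<close> shows that the common neighbourhood is
      nonempty, hence larger than the set of all images.\<close>
    moreover have "\<phi> v \<in> {x \<in> J. \<forall>y\<in>Y. near x y}"
      using \<phi>(1) \<phi>3 v by (auto simp: Y_def)
    ultimately have gt: "card {x \<in> J. \<forall>y\<in>Y. near x y} > card V" using many by blast
    have "\<not> {x \<in> J. \<forall>y\<in>Y. near x y} \<subseteq> \<phi> ` V"
    proof
      assume "{x \<in> J. \<forall>y\<in>Y. near x y} \<subseteq> \<phi> ` V"
      then have "card {x \<in> J. \<forall>y\<in>Y. near x y} \<le> card (\<phi> ` V)"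
        using finV by (intro card_mono) auto
      then show False using gt card_image_le[OF finV, of \<phi>] by linarith
    qed
    then obtain z where z: "z \<in> J" "z \<notin> \<phi> ` V" and nz: "\<And>u. (v, u) \<in> parcs H \<Longrightarrow> near z (\<phi> u)"
      by (auto simp: Y_def)
    have nl: "(v, v) \<notin> parcs H" using no_loops' by auto
    have sym: "(v, u) \<in> parcs H" if "(u, v) \<in> parcs H" for u
      using pair_sym_arcs that by (auto simp: symmetric_def sym_def)
    show ?case
    proof (intro exI[of _ "\<phi>(v := z)"] conjI)
      show "(\<phi>(v := z)) ` V \<subseteq> J" using \<phi>(1) z(1) by auto
      have "insert r S \<subseteq> V" "v \<notin> insert r S" using insert.prems insert.hyps v r by (auto simp: V_def)
      then show "inj_on (\<phi>(v := z)) (insert r (insert v S))"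
        using \<phi>(2) z(2) by (subst insert_commute) (auto simp: inj_on_def)
      show "\<forall>(a, b)\<in>parcs H. near ((\<phi>(v := z)) a) ((\<phi>(v := z)) b)"
      proof safe
        fix a b assume e: "(a, b) \<in> parcs H"
        show "near ((\<phi>(v := z)) a) ((\<phi>(v := z)) b)"
        proof (cases "a = v")
          case True
          then have "b \<noteq> v" "near z (\<phi> b)" using e nl nz by blast+
          then show ?thesis using True by simp
        next
          case False
          have "near (\<phi> a) z" if "b = v" using near(2) nz sym e that by blast
          then show ?thesis using False \<phi>3[OF e] by (cases "b = v") simp_all
        qed
      qed
    qed
  qed
  from this[of "V - {r}"] obtain \<phi> where \<phi>: "\<phi> ` V \<subseteq> J" "inj_on \<phi> (insert r (V - {r}))"
    "\<forall>(u, v)\<in>parcs H. near (\<phi> u) (\<phi> v)" using finV by blast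
  moreover have "insert r (V - {r}) = V" using r by (auto simp: V_def)
  ultimately show ?thesis
    unfolding embeds_near_def V_def[symmetric] using J(1)
    by (intro exI[of _ \<phi>]) auto
qed

text \<open>An idempotent \<open>\<sigma>\<close> encodes a partition of the vertices into its
  fibres, with \<open>\<sigma> v\<close> as the representative of the block of \<open>v\<close>. As
  \<open>lam F\<close> is a maximum over partitions, this quotient has a block of degree at most
  \<open>lam F\<close>; its neighbours are counted by their representatives.\<close>

lemma lam_quotient_block:
  assumes F: "pair_graph F" and \<sigma>: "\<And>v. v \<in> pverts F \<Longrightarrow> \<sigma> v \<in> pverts F"
    "\<And>v. v \<in> pverts F \<Longrightarrow> \<sigma> (\<sigma> v) = \<sigma> v"
    and two: "card (\<sigma> ` pverts F) \<ge> 2"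
  shows "\<exists>r\<in>\<sigma> ` pverts F. card {\<sigma> v |u v. (u, v) \<in> parcs F \<and> \<sigma> u = r \<and> \<sigma> v \<noteq> r} \<le> lam F"
proof -
  interpret pair_graph F by fact
  define V where "V = pverts F"
  have finV: "finite V" using pair_finite_verts by (simp add: V_def)
  define blk where "blk r = {v \<in> V. \<sigma> v = r}" for r
  define P where "P = blk ` \<sigma> ` V"
  have self: "r \<in> blk r" if "r \<in> \<sigma> ` V" for r using that \<sigma> by (auto simp: blk_def V_def)
  have inj: "inj_on blk (\<sigma> ` V)"
  proof (rule inj_onI)
    fix r s assume "r \<in> \<sigma> ` V" "s \<in> \<sigma> ` V" "blk r = blk s"
    then have "s \<in> blk r" using self by metis
    moreover have "\<sigma> s = s" using \<open>s \<in> \<sigma> ` V\<close> \<sigma>(2) by (auto simp: V_def)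
    ultimately show "r = s" by (simp add: blk_def)
  qed
  have part: "partition_on V P"
  proof (rule partition_onI)
    show "\<Union> P = V" by (auto simp: P_def blk_def)
    show "disjnt A B" if "A \<in> P" "B \<in> P" "A \<noteq> B" for A B
      using that by (auto simp: P_def blk_def disjnt_def)
    show "{} \<notin> P" using self by (auto simp: P_def)
  qed
  have cP: "card P \<ge> 2" unfolding P_def card_image[OF inj] using two by (simp add: V_def)
  have cV: "card V > 1"
    using two card_image_le[OF finV, of \<sigma>] by (simp add: V_def)
  have finP: "finite P" "P \<noteq> {}" using finV cP by (auto simp: P_def)
  define Q where "Q = quotient_graph F P"
  have Qv: "pverts Q = P" by (simp add: Q_def quotient_graph_def)
  have "min_degree Q \<le> lam F"
    using lam_set(1)[OF F] cV part cP unfolding lam_def V_def Q_def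
    by (auto intro!: Max_ge)
  moreover have "min_degree Q \<in> out_degree Q ` P"
    unfolding min_degree_def Qv using finP by (intro Min_in) auto
  ultimately obtain B where B: "B \<in> P" "out_degree Q B \<le> lam F" by auto
  then obtain r where r: "r \<in> \<sigma> ` V" "B = blk r" by (auto simp: P_def)
  define N where "N = {\<sigma> v |u v. (u, v) \<in> parcs F \<and> \<sigma> u = r \<and> \<sigma> v \<noteq> r}"
  have arcV: "u \<in> V \<and> v \<in> V" if "(u, v) \<in> parcs F" for u v
    using in_arcsD1[OF that] in_arcsD2[OF that] by (simp add: V_def)
  have NV: "N \<subseteq> \<sigma> ` V" using arcV by (auto simp: N_def)
  have "blk ` N \<subseteq> {C. (B, C) \<in> parcs Q}"
  proof
    fix C assume "C \<in> blk ` N"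
    then obtain u v where uv: "(u, v) \<in> parcs F" "\<sigma> u = r" "\<sigma> v \<noteq> r" "C = blk (\<sigma> v)"
      by (auto simp: N_def)
    have "C \<in> P" using uv arcV by (auto simp: P_def)
    moreover have "C \<noteq> B"
      using uv r inj arcV by (auto dest: inj_onD)
    moreover have "u \<in> B" "v \<in> C" using uv arcV r(2) by (auto simp: blk_def)
    ultimately show "C \<in> {C. (B, C) \<in> parcs Q}"
      using B(1) uv(1) by (auto simp: Q_def quotient_graph_def)
  qed
  moreover have "finite {C. (B, C) \<in> parcs Q}"
    by (rule finite_subset[OF _ finP(1)]) (auto simp: Q_def quotient_graph_def)
  ultimately have "card (blk ` N) \<le> out_degree Q B"
    unfolding out_degree_pair by (rule card_mono[rotated])
  moreover have "card (blk ` N) = card N" using inj NV inj_on_subset card_image by blast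
  ultimately have "card N \<le> lam F" using B(2) by simp
  then show ?thesis using r(1) unfolding N_def V_def by blast
qed

text \<open>The sum multiplies out the product over \<open>j\<close> of
  \<open>1 - card {i. i < j, g i = g j}\<close>. A factor is 0 or 1 as long as the earlier values
  are distinct, and after the first repetition the product is 0. A choice of one term per factor is
  a map \<open>h\<close> with \<open>h j \<le> j\<close>, where \<open>h j = j\<close> stands for
  the term 1; such maps are forests whose trees are the blocks of a partition.\<close>

lemma of_bool_inj_on_expansion:
  fixes g :: "nat \<Rightarrow> 'p"
  shows "(of_bool (inj_on g {..<k}) :: int) =
    (\<Sum>h\<in>PiE {..<k} (\<lambda>j. {..j}). (\<Prod>j<k. if h j = j then 1 else - 1) * of_bool (\<forall>j<k. g (h j) = g j))"
proof -
  define a :: "nat \<Rightarrow> nat \<Rightarrow> int" where "a j i = (if i = j then 1 else - of_bool (g i = g j))" for j i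
  have step: "of_bool (inj_on g {..<k}) = (\<Prod>j<k. \<Sum>i\<le>j. a j i)"
  proof (induction k)
    case (Suc k)
    have sum: "(\<Sum>i\<le>k. a k i) = 1 - int (card {i \<in> {..<k}. g i = g k})"
    proof -
      have "(\<Sum>i\<le>k. a k i) = a k k + (\<Sum>i<k. a k i)"
        by (simp add: lessThan_Suc_atMost[symmetric])
      also have "(\<Sum>i<k. a k i) = (\<Sum>i<k. - of_bool (g i = g k))" by (rule sum.cong) (auto simp: a_def)
      finally show ?thesis by (simp add: a_def sum_negf of_bool_def sum.If_cases Int_def)
    qed
    show ?case
    proof (cases "inj_on g {..<k}")
      case True
      have "card {i \<in> {..<k}. g i = g k} = of_bool (g k \<in> g ` {..<k})"
      proof (cases "g k \<in> g ` {..<k}")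
        case True
        then obtain i where "i < k" "g i = g k" by auto
        then have "{i \<in> {..<k}. g i = g k} = {i}" using \<open>inj_on g {..<k}\<close>
          by (auto simp: inj_on_def)
        then show ?thesis using True by simp
      next
        case False
        then have "g i \<noteq> g k" if "i < k" for i using that by (metis imageI lessThan_iff)
        then have "{i \<in> {..<k}. g i = g k} = {}" by auto
        then show ?thesis using False by simp
      qed
      moreover have "inj_on g {..<Suc k} \<longleftrightarrow> g k \<notin> g ` {..<k}"
        using True by (auto simp: lessThan_Suc)
      ultimately show ?thesis using Suc True by (simp add: sum)
    next
      case False
      then have "\<not> inj_on g {..<Suc k}" by (auto simp: lessThan_Suc)
      then show ?thesis using Suc False by simp
    qed
  qed simp
  also have "(\<Prod>j<k. \<Sum>i\<le>j. a j i) = (\<Sum>h\<in>PiE {..<k} (\<lambda>j. {..j}). \<Prod>j<k. a j (h j))"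
    by (rule prod_sum_PiE) auto
  also have "\<dots> = (\<Sum>h\<in>PiE {..<k} (\<lambda>j. {..j}).
      (\<Prod>j<k. if h j = j then 1 else - 1) * of_bool (\<forall>j<k. g (h j) = g j))"
  proof (rule sum.cong[OF refl])
    fix h :: "nat \<Rightarrow> nat"
    have "(\<Prod>j<k. a j (h j)) = (\<Prod>j<k. (if h j = j then 1 else - 1) * of_bool (g (h j) = g j))"
      by (rule prod.cong) (auto simp: a_def)
    also have "\<dots> = (\<Prod>j<k. if h j = j then 1 else - 1) * (\<Prod>j<k. of_bool (g (h j) = g j))"
      by (rule prod.distrib)
    also have "(\<Prod>j<k. of_bool (g (h j) = g j)) = (of_bool (\<forall>j<k. g (h j) = g j) :: int)"
      by (auto simp: of_bool_def intro!: prod.neutral)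
    finally show "(\<Prod>j<k. a j (h j)) =
      (\<Prod>j<k. if h j = j then 1 else - 1) * of_bool (\<forall>j<k. g (h j) = g j)" .
  qed
  finally show ?thesis .
qed

text \<open>Each step that is not stationary lowers the index, so the root of the tree of
  \<open>j\<close> is reached after at most \<open>j\<close> steps.\<close>

lemma funpow_decreasing_fixpoint:
  fixes h :: "nat \<Rightarrow> nat"
  assumes "\<And>j. j < k \<Longrightarrow> h j \<le> j" and "j < k" and "j \<le> i"
  shows "h ((h ^^ i) j) = (h ^^ i) j"
  using assms(2,3)
proof (induction j arbitrary: i rule: less_induct)
  case (less j)
  show ?case
  proof (cases "h j = j")
    case True
    then have "(h ^^ i) j = j" by (induction i) auto
    then show ?thesis using True by simp
  next
    case False
    then have lt: "h j < j" using assms(1)[of j] less.prems by simp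
    then obtain i' where i': "i = Suc i'" using less.prems by (cases i) auto
    have "h ((h ^^ i') (h j)) = (h ^^ i') (h j)"
      using lt less.prems i' by (intro less.IH) auto
    then show ?thesis by (simp add: i' funpow_swap1)
  qed
qed

text \<open>If there is no copy, the indicator of injective maps that preserve nearness is the zero
  tensor on \<open>I\<close>. In its expansion the forests with one root give a diagonal tensor,
  which is thus the negative of the sum over the forests with several roots. There are at most
  \<open>k!\<close> of these, each of partition rank at most \<open>D\<close>.\<close>

lemma card_le_if_not_embeds_near:
  fixes p :: int and F :: "'a pair_pre_digraph" and near :: "'p \<Rightarrow> 'p \<Rightarrow> bool"
  assumes F: "pair_graph F" and ne: "pverts F \<noteq> {}" and lam: "lam F \<le> l"
    and near: "\<And>x. near x x" "\<And>x y. near x y \<Longrightarrow> near y x"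
    and p: "prime p" and large: "p > int (card (pverts F))"
    and I: "finite I" and rank: "nbhd_rank_le p I near l D"
    and free: "\<not> embeds_near near I F"
  shows "card I \<le> fact (card (pverts F)) * D"
proof -
  interpret pair_graph F by fact
  define V where "V = pverts F"
  define k where "k = card V"
  have finV: "finite V" using pair_finite_verts by (simp add: V_def)
  have k0: "k > 0" using finV ne by (simp add: k_def V_def card_gt_0_iff)
  have arcV: "u \<in> V" "v \<in> V" if "(u, v) \<in> parcs F" for u v
    using in_arcsD1[OF that] in_arcsD2[OF that] by (simp_all add: V_def)
  have sym: "(v, u) \<in> parcs F" if "(u, v) \<in> parcs F" for u v
    using pair_sym_arcs that by (auto simp: symmetric_def sym_def)
  obtain b where b: "bij_betw b {..<k} V"
    using ex_bij_betw_nat_finite[OF finV] by (auto simp: k_def atLeast0LessThan)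
  define b' where "b' = inv_into {..<k} b"
  have b': "b' v < k" "b (b' v) = v" if "v \<in> V" for v
    using b that bij_betw_inv_into_right[OF b that] bij_betwE[OF bij_betw_inv_into[OF b]]
    by (auto simp: b'_def)
  have bV: "b j \<in> V" "b' (b j) = j" if "j < k" for j
    using b that bij_betw_inv_into_left[OF b] by (auto simp: b'_def bij_betw_def)
  define P where "P = PiE {..<k} (\<lambda>j. {..j})"
  have finP: "finite P" unfolding P_def by (rule finite_PiE) auto
  have cardP: "card P = fact k"
    unfolding P_def by (simp add: card_PiE fact_prod_Suc atLeast0LessThan)
  \<comment> \<open>The forests whose only root is 0; the index 0 is always a root.\<close>
  define P0 where "P0 = {h \<in> P. \<forall>j\<in>{0<..<k}. h j \<noteq> j}"
  define P1 where "P1 = P - P0"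
  define sg :: "(nat \<Rightarrow> nat) \<Rightarrow> int" where "sg h = (\<Prod>j<k. if h j = j then 1 else - 1)" for h
  define cp where "cp h \<phi> \<longleftrightarrow> (\<forall>j<k. \<phi> (b (h j)) = \<phi> (b j))" for h and \<phi> :: "'a \<Rightarrow> 'p"
  define T where "T \<phi> \<longleftrightarrow> (\<forall>(u, v)\<in>parcs F. near (\<phi> u) (\<phi> v))" for \<phi>
  have P_le: "h j \<le> j" if "h \<in> P" "j < k" for h j
    using PiE_mem[of h "{..<k}" "\<lambda>j. {..j}" j] that by (simp add: P_def)
  have expand: "(\<Sum>h\<in>P1. sg h * of_bool (T \<phi> \<and> cp h \<phi>)) = - (\<Sum>h\<in>P0. sg h * of_bool (T \<phi> \<and> cp h \<phi>))"
    if "\<phi> ` V \<subseteq> I" for \<phi>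
  proof -
    have "inj_on (\<phi> \<circ> b) {..<k} \<longleftrightarrow> inj_on \<phi> V"
      using b by (metis bij_betw_def comp_inj_on_iff)
    then have "(of_bool (inj_on \<phi> V) :: int) = (\<Sum>h\<in>P. sg h * of_bool (cp h \<phi>))"
      using of_bool_inj_on_expansion[of "\<phi> \<circ> b" k] by (simp add: P_def sg_def cp_def)
    moreover have "\<not> (inj_on \<phi> V \<and> T \<phi>)"
      using free that by (auto simp: embeds_near_def T_def V_def)
    ultimately have "0 = of_bool (T \<phi>) * (\<Sum>h\<in>P. sg h * of_bool (cp h \<phi>))"
      by (metis (full_types) mult_eq_0_iff of_bool_eq(1))
    also have "\<dots> = (\<Sum>h\<in>P. sg h * of_bool (T \<phi> \<and> cp h \<phi>))"
      by (simp add: sum_distrib_left of_bool_conj ac_simps)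
    also have "\<dots> = (\<Sum>h\<in>P1. sg h * of_bool (T \<phi> \<and> cp h \<phi>)) + (\<Sum>h\<in>P0. sg h * of_bool (T \<phi> \<and> cp h \<phi>))"
      unfolding P1_def using finP by (intro sum.subset_diff) (auto simp: P0_def)
    finally show ?thesis by simp
  qed
  \<comment> \<open>\<open>\<rho> h j\<close> is the root of \<open>j\<close>, because
    \<open>k\<close> iterations suffice for every index below \<open>k\<close>.\<close>
  define \<rho> where "\<rho> h j = (h ^^ k) j" for h :: "nat \<Rightarrow> nat" and j
  have pow_lt: "(h ^^ i) j < k" if "h \<in> P" "j < k" for h i j
    using that by (induction i) (auto intro: le_less_trans[OF P_le])
  have \<rho>_fix: "h (\<rho> h j) = \<rho> h j" if "h \<in> P" "j < k" for h j
    unfolding \<rho>_def using that P_le by (intro funpow_decreasing_fixpoint[of k]) auto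
  have fix_\<rho>: "\<rho> h j = j" if "h j = j" for h j
    unfolding \<rho>_def using that by (induction k) auto
  have cp_\<rho>: "cp h \<phi> \<longleftrightarrow> (\<forall>j<k. \<phi> (b (\<rho> h j)) = \<phi> (b j))" if h: "h \<in> P" for h \<phi>
  proof
    assume cp: "cp h \<phi>"
    have "\<phi> (b ((h ^^ i) j)) = \<phi> (b j)" if "j < k" for i j
      using that by (induction i) (use cp pow_lt[OF h] in \<open>auto simp: cp_def\<close>)
    then show "\<forall>j<k. \<phi> (b (\<rho> h j)) = \<phi> (b j)" by (simp add: \<rho>_def)
  next
    assume eq: "\<forall>j<k. \<phi> (b (\<rho> h j)) = \<phi> (b j)"
    show "cp h \<phi>" unfolding cp_def
    proof (intro allI impI)
      fix j assume j: "j < k"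
      have "\<rho> h (h j) = \<rho> h j"
        using \<rho>_fix[OF h j] by (simp add: \<rho>_def funpow_swap1)
      moreover have "h j < k" using P_le[OF h j] j by simp
      ultimately show "\<phi> (b (h j)) = \<phi> (b j)" using eq j by metis
    qed
  qed
  have const0: "cp h \<phi> \<longleftrightarrow> (\<forall>v\<in>V. \<phi> v = \<phi> (b 0))" if h: "h \<in> P0" for h \<phi>
  proof -
    have hP: "h \<in> P" using h by (simp add: P0_def)
    have "\<rho> h j = 0" if "j < k" for j
    proof (rule ccontr)
      assume "\<rho> h j \<noteq> 0"
      moreover have "\<rho> h j < k" unfolding \<rho>_def using pow_lt[OF hP that] .
      ultimately show False using h \<rho>_fix[OF hP that] by (auto simp: P0_def)
    qed
    then show ?thesis unfolding cp_\<rho>[OF hP] using bV b' by metis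
  qed
  have sg0: "sg h = (- 1) ^ (k - 1)" if "h \<in> P0" for h
  proof -
    have "h 0 = 0" using P_le[of h 0] that k0 by (simp add: P0_def)
    obtain k' where k': "k = Suc k'" using k0 by (cases k) auto
    have "sg h = (\<Prod>j<k'. - 1)"
      unfolding sg_def k' prod.lessThan_Suc_shift using \<open>h 0 = 0\<close> that
      by (auto simp: P0_def k' intro!: prod.cong)
    then show ?thesis by (simp add: k')
  qed
  \<comment> \<open>The index 0 needs the singleton \<open>{0}\<close> in place of the empty set
    \<open>{..<0}\<close>.\<close>
  have P0_eq: "P0 = PiE {..<k} (\<lambda>j. if j = 0 then {0} else {..<j})"
  proof (rule set_eqI)
    fix h :: "nat \<Rightarrow> nat"
    have "h \<in> P0 \<longleftrightarrow> (\<forall>j\<in>{..<k}. h j \<in> {..j} \<and> (0 < j \<longrightarrow> h j \<noteq> j)) \<and> h \<in> extensional {..<k}"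
      unfolding P0_def P_def PiE_iff by auto
    moreover have "(h j \<in> {..j} \<and> (0 < j \<longrightarrow> h j \<noteq> j)) = (h j \<in> (if j = 0 then {0} else {..<j}))" for j
      by auto
    ultimately show "h \<in> P0 \<longleftrightarrow> h \<in> PiE {..<k} (\<lambda>j. if j = 0 then {0} else {..<j})"
      unfolding PiE_iff by simp
  qed
  \<comment> \<open>\<open>card P0\<close> is the factorial of \<open>k - 1\<close>, all of whose
    factors are less than \<open>p\<close>; with the common sign of these forests this makes the
    diagonal entries nonzero modulo \<open>p\<close>.\<close>
  have card0: "\<not> p dvd int (card P0)"
  proof
    assume "p dvd int (card P0)"
    also have "int (card P0) = (\<Prod>j<k. if j = 0 then 1 else int j)"
      unfolding P0_eq by (auto simp: card_PiE intro!: prod.cong)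
    finally obtain j where "j < k" "p dvd (if j = 0 then 1 else int j)"
      using prime_dvd_prod_iff[OF _ p, of "{..<k}"] by auto
    then show False
      using zdvd_imp_le[of p "if j = 0 then 1 else int j"] large k0
      by (auto simp: k_def V_def split: if_splits)
  qed
  define \<sigma> where "\<sigma> h v = b (\<rho> h (b' v))" for h v
  have \<sigma>V: "\<sigma> h v \<in> V" if "h \<in> P" "v \<in> V" for h v
    unfolding \<sigma>_def \<rho>_def using pow_lt[OF that(1)] b' bV that(2) by auto
  have \<sigma>\<sigma>: "\<sigma> h (\<sigma> h v) = \<sigma> h v" if "h \<in> P" "v \<in> V" for h v
  proof -
    have "\<rho> h (b' v) < k" unfolding \<rho>_def using pow_lt b' that by auto
    moreover have "\<rho> h (\<rho> h (b' v)) = \<rho> h (b' v)"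
      using \<rho>_fix[of h "b' v"] b' that fix_\<rho> by auto
    ultimately show ?thesis by (simp add: \<sigma>_def bV)
  qed
  have cp_\<sigma>: "cp h \<phi> \<longleftrightarrow> (\<forall>v\<in>V. \<phi> (\<sigma> h v) = \<phi> v)" if "h \<in> P" for h \<phi>
    unfolding cp_\<rho>[OF that] \<sigma>_def using b' bV by metis
  have two: "card (\<sigma> h ` V) \<ge> 2" if h1: "h \<in> P1" for h
  proof -
    obtain j where j: "0 < j" "j < k" "h j = j" and hP: "h \<in> P"
      using h1 by (auto simp: P1_def P0_def)
    have "h 0 = 0" using P_le[OF hP, of 0] k0 by simp
    then have "\<sigma> h (b 0) = b 0" "\<sigma> h (b j) = b j" using j k0 fix_\<rho> by (auto simp: \<sigma>_def bV)
    then have "{b 0, b j} \<subseteq> \<sigma> h ` V" using bV j k0 by (metis empty_subsetI imageI insert_subset)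
    moreover have "b 0 \<noteq> b j" using bV j k0 by (metis less_irrefl)
    ultimately show ?thesis using card_mono[of "\<sigma> h ` V" "{b 0, b j}"] finV by simp
  qed
  have "\<exists>r. h \<in> P1 \<longrightarrow> r \<in> \<sigma> h ` V \<and> card {\<sigma> h v |u v. (u, v) \<in> parcs F \<and> \<sigma> h u = r \<and> \<sigma> h v \<noteq> r} \<le> l"
    for h
  proof (cases "h \<in> P1")
    case True
    then have hP: "h \<in> P" by (simp add: P1_def)
    have "\<exists>r\<in>\<sigma> h ` pverts F. card {\<sigma> h v |u v. (u, v) \<in> parcs F \<and> \<sigma> h u = r \<and> \<sigma> h v \<noteq> r} \<le> lam F"
    proof (rule lam_quotient_block[OF F])
      show "\<sigma> h v \<in> pverts F" "\<sigma> h (\<sigma> h v) = \<sigma> h v" if "v \<in> pverts F" for v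
        using \<sigma>V[OF hP] \<sigma>\<sigma>[OF hP] that by (auto simp: V_def)
      show "card (\<sigma> h ` pverts F) \<ge> 2" using two[OF True] by (simp add: V_def)
    qed
    then obtain r where "r \<in> \<sigma> h ` V"
      "card {\<sigma> h v |u v. (u, v) \<in> parcs F \<and> \<sigma> h u = r \<and> \<sigma> h v \<noteq> r} \<le> lam F"
      unfolding V_def by blast
    then show ?thesis using lam le_trans by blast
  qed simp
  then have "\<exists>r. \<forall>h. h \<in> P1 \<longrightarrow> r h \<in> \<sigma> h ` V \<and>
      card {\<sigma> h v |u v. (u, v) \<in> parcs F \<and> \<sigma> h u = r h \<and> \<sigma> h v \<noteq> r h} \<le> l"
    by (intro choice allI)
  then obtain r where r: "\<And>h. h \<in> P1 \<Longrightarrow> r h \<in> \<sigma> h ` V"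
    and N_le: "\<And>h. h \<in> P1 \<Longrightarrow> card {\<sigma> h v |u v. (u, v) \<in> parcs F \<and> \<sigma> h u = r h \<and> \<sigma> h v \<noteq> r h} \<le> l"
    by blast
  define B where "B h = {v \<in> V. \<sigma> h v = r h}" for h
  define N where "N h = {\<sigma> h v |u v. (u, v) \<in> parcs F \<and> \<sigma> h u = r h \<and> \<sigma> h v \<noteq> r h}" for h
  have P1P: "h \<in> P" if "h \<in> P1" for h using that by (simp add: P1_def)
  have rfix: "\<sigma> h (r h) = r h" "r h \<in> V" if "h \<in> P1" for h
    using r[OF that] \<sigma>\<sigma> \<sigma>V P1P[OF that] by auto
  have rB: "r h \<in> B h" if "h \<in> P1" for h using rfix[OF that] by (simp add: B_def)
  have NB: "N h \<subseteq> V - B h" if "h \<in> P1" for h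
    using \<sigma>V \<sigma>\<sigma> P1P[OF that] arcV by (auto simp: N_def B_def)
  obtain w :: "nat \<Rightarrow> 'p \<Rightarrow> int" where w: "\<forall>Y\<subseteq>I. card Y \<le> l \<longrightarrow>
     (\<exists>u. \<forall>x\<in>I. [of_bool (\<forall>y\<in>Y. near x y) = (\<Sum>e<D. u e * w e x)] (mod p))"
    by (rule exE[OF rank[unfolded nbhd_rank_le_def]])
  have "\<exists>u. Y \<subseteq> I \<longrightarrow> card Y \<le> l \<longrightarrow>
     (\<forall>x\<in>I. [of_bool (\<forall>y\<in>Y. near x y) = (\<Sum>e<D. u e * w e x)] (mod p))" for Y
    using w by blast
  then have "\<exists>u. \<forall>Y. Y \<subseteq> I \<longrightarrow> card Y \<le> l \<longrightarrow>
     (\<forall>x\<in>I. [of_bool (\<forall>y\<in>Y. near x y) = (\<Sum>e<D. u Y e * w e x)] (mod p))"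
    by (intro choice allI)
  then obtain u where u: "\<And>Y x. Y \<subseteq> I \<Longrightarrow> card Y \<le> l \<Longrightarrow> x \<in> I \<Longrightarrow>
     [of_bool (\<forall>y\<in>Y. near x y) = (\<Sum>e<D. u Y e * w e x)] (mod p)"
    by blast
  \<comment> \<open>For a forest \<open>h\<close>, the block \<open>B h\<close> of small degree with
    representative \<open>r h\<close> is split off. Its nearness to the neighbouring blocks is
    expanded in the functions \<open>w e\<close>, evaluated at the image of \<open>r h\<close>; the
    coefficients \<open>u\<close> see only the images of \<open>N h\<close>, which lie outside the
    block. Hence \<open>f\<close> and \<open>g\<close> depend on complementary arguments.\<close>
  define f where "f = (\<lambda>(h, e) \<phi>. of_bool (\<forall>v\<in>B h. \<phi> v = \<phi> (r h)) * w e (\<phi> (r h)))"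
  define rest where "rest h \<phi> \<longleftrightarrow> (\<forall>v\<in>V - B h. \<phi> (\<sigma> h v) = \<phi> v) \<and>
    (\<forall>(u, v)\<in>parcs F. u \<notin> B h \<longrightarrow> v \<notin> B h \<longrightarrow> near (\<phi> u) (\<phi> v))" for h and \<phi> :: "'a \<Rightarrow> 'p"
  define g where "g = (\<lambda>(h, e) \<phi>. sg h * of_bool (rest h \<phi>) * u (\<phi> ` N h) e)"
  have \<sigma>notB: "\<sigma> h v \<in> V - B h" if "h \<in> P1" "v \<in> V - B h" for h v
    using that \<sigma>V[OF P1P] \<sigma>\<sigma>[OF P1P] by (auto simp: B_def)
  \<comment> \<open>Given the coincidences, edges inside the block hold by reflexivity of
    \<open>near\<close>, edges leaving it say that \<open>\<phi> (r h)\<close> is near the images of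
    the representatives in \<open>N h\<close>, and all remaining conditions are collected in
    \<open>rest\<close>.\<close>
  have decomp: "T \<phi> \<and> cp h \<phi> \<longleftrightarrow> (\<forall>v\<in>B h. \<phi> v = \<phi> (r h)) \<and> rest h \<phi> \<and> (\<forall>y\<in>\<phi> ` N h. near (\<phi> (r h)) y)"
    if h: "h \<in> P1" for h \<phi>
  proof
    assume L: "T \<phi> \<and> cp h \<phi>"
    then have eq: "\<phi> (\<sigma> h v) = \<phi> v" if "v \<in> V" for v
      using that cp_\<sigma>[OF P1P[OF h]] by blast
    have "near (\<phi> (r h)) (\<phi> n)" if n: "n \<in> N h" for n
    proof -
      obtain u v where uv: "(u, v) \<in> parcs F" "\<sigma> h u = r h" "n = \<sigma> h v" using n by (auto simp: N_def)
      then have "\<phi> n = \<phi> v" "\<phi> (r h) = \<phi> u" using eq arcV by metis+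
      then show ?thesis using L uv(1) by (auto simp: T_def)
    qed
    moreover have "\<forall>v\<in>B h. \<phi> v = \<phi> (r h)" using eq unfolding B_def by force
    moreover have "rest h \<phi>" using L eq by (auto simp: rest_def T_def)
    ultimately show "(\<forall>v\<in>B h. \<phi> v = \<phi> (r h)) \<and> rest h \<phi> \<and> (\<forall>y\<in>\<phi> ` N h. near (\<phi> (r h)) y)" by blast
  next
    assume R: "(\<forall>v\<in>B h. \<phi> v = \<phi> (r h)) \<and> rest h \<phi> \<and> (\<forall>y\<in>\<phi> ` N h. near (\<phi> (r h)) y)"
    then have eqB: "\<phi> v = \<phi> (r h)" if "v \<in> B h" for v using that by blast
    have eq: "\<phi> (\<sigma> h v) = \<phi> v" if "v \<in> V" for v
    proof (cases "v \<in> B h")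
      case True then show ?thesis using eqB[OF True] by (simp add: B_def)
    next
      case False then show ?thesis using R that by (simp add: rest_def)
    qed
    have cross: "near (\<phi> a) (\<phi> c)" if "(a, c) \<in> parcs F" "a \<in> B h" "c \<notin> B h" for a c
    proof -
      have "\<sigma> h c \<in> N h" using that arcV by (auto simp: N_def B_def)
      then have "near (\<phi> (r h)) (\<phi> (\<sigma> h c))" using R by blast
      then show ?thesis using eqB[OF that(2)] eq arcV that(1) by metis
    qed
    have "near (\<phi> a) (\<phi> c)" if e: "(a, c) \<in> parcs F" for a c
    proof (cases "a \<in> B h"; cases "c \<in> B h")
      assume "a \<in> B h" "c \<in> B h" then show ?thesis using eqB near(1) by metis
    next
      assume "a \<in> B h" "c \<notin> B h" then show ?thesis using cross e by blast
    next
      assume "a \<notin> B h" "c \<in> B h" then show ?thesis using cross[of c a] sym e near(2) by blast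
    next
      assume "a \<notin> B h" "c \<notin> B h" then show ?thesis using R e by (auto simp: rest_def)
    qed
    then show "T \<phi> \<and> cp h \<phi>" using eq cp_\<sigma>[OF P1P[OF h]] by (auto simp: T_def)
  qed
  have per_h: "[(\<Sum>e<D. f (h, e) \<phi> * g (h, e) \<phi>) = sg h * of_bool (T \<phi> \<and> cp h \<phi>)] (mod p)"
    if h: "h \<in> P1" and im: "\<phi> ` V \<subseteq> I" for h \<phi>
  proof -
    let ?c = "of_bool (\<forall>v\<in>B h. \<phi> v = \<phi> (r h)) * sg h * of_bool (rest h \<phi>) :: int"
    have "(\<Sum>e<D. f (h, e) \<phi> * g (h, e) \<phi>) = ?c * (\<Sum>e<D. u (\<phi> ` N h) e * w e (\<phi> (r h)))"
      unfolding f_def g_def by (simp add: sum_distrib_left ac_simps)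
    also have "[\<dots> = ?c * of_bool (\<forall>y\<in>\<phi> ` N h. near (\<phi> (r h)) y)] (mod p)"
    proof (rule cong_scalar_left, rule cong_sym, rule u)
      show "\<phi> ` N h \<subseteq> I" "\<phi> (r h) \<in> I" using im NB[OF h] rfix[OF h] by auto
      have "finite (N h)" using NB[OF h] finV finite_subset by blast
      then show "card (\<phi> ` N h) \<le> l" using N_le[OF h] card_image_le[of "N h" \<phi>] by (simp add: N_def)
    qed
    also have "?c * of_bool (\<forall>y\<in>\<phi> ` N h. near (\<phi> (r h)) y) = sg h * of_bool (T \<phi> \<and> cp h \<phi>)"
      unfolding decomp[OF h] by (simp add: of_bool_conj ac_simps)
    finally show ?thesis .
  qed
  have total: "[(\<Sum>j\<in>P1 \<times> {..<D}. f j \<phi> * g j \<phi>) = - (\<Sum>h\<in>P0. sg h * of_bool (T \<phi> \<and> cp h \<phi>))] (mod p)"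
    if im: "\<phi> ` V \<subseteq> I" for \<phi>
  proof -
    have "(\<Sum>j\<in>P1 \<times> {..<D}. f j \<phi> * g j \<phi>) = (\<Sum>h\<in>P1. \<Sum>e<D. f (h, e) \<phi> * g (h, e) \<phi>)"
      unfolding sum.cartesian_product by (rule sum.cong) auto
    also have "[\<dots> = (\<Sum>h\<in>P1. sg h * of_bool (T \<phi> \<and> cp h \<phi>))] (mod p)"
      by (rule cong_sum) (rule per_h[OF _ im])
    finally show ?thesis by (simp add: expand[OF im])
  qed
  define c where "c = - (int (card P0) * (- 1) ^ (k - 1))"
  have "card I \<le> card (P1 \<times> {..<D})"
  proof (rule card_le_partition_rank_mod[OF p finV, where B = "\<lambda>j. B (fst j)" and f = f and g = g
        and h = "\<lambda>_. c"])
    show "V \<noteq> {}" using ne by (simp add: V_def)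
    show "finite I" by fact
    show "finite (P1 \<times> {..<D})" using finP by (simp add: P1_def)
  next
    fix j assume "j \<in> P1 \<times> {..<D}"
    then obtain h e where j: "j = (h, e)" and h: "h \<in> P1" by auto
    have "\<not> \<sigma> h ` V \<subseteq> {r h}"
      using two[OF h] card_mono[of "{r h}" "\<sigma> h ` V"] by auto
    then obtain v where v: "v \<in> V" "\<sigma> h v \<noteq> r h" by blast
    then have "v \<notin> B h" by (simp add: B_def)
    then show "B (fst j) \<noteq> {} \<and> B (fst j) \<subset> V" using rB[OF h] v(1) by (auto simp: j B_def)
    show "depends_only_on (B (fst j)) (f j)"
      using rB[OF h] by (auto simp: depends_only_on_def f_def j)
    show "depends_only_on (V - B (fst j)) (g j)"
      unfolding depends_only_on_def
    proof (intro allI impI)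
      fix \<phi> \<psi> :: "'a \<Rightarrow> 'p" assume "\<forall>v\<in>V - B (fst j). \<phi> v = \<psi> v"
      then have eq: "\<phi> v = \<psi> v" if "v \<in> V - B h" for v using that by (simp add: j)
      have "\<phi> ` N h = \<psi> ` N h" using NB[OF h] eq by (intro image_cong) auto
      moreover have "rest h \<phi> = rest h \<psi>"
      proof -
        have "(\<forall>v\<in>V - B h. \<phi> (\<sigma> h v) = \<phi> v) = (\<forall>v\<in>V - B h. \<psi> (\<sigma> h v) = \<psi> v)"
          using eq \<sigma>notB[OF h] by auto
        moreover have "near (\<phi> x) (\<phi> y) = near (\<psi> x) (\<psi> y)"
          if "(x, y) \<in> parcs F" "x \<notin> B h" "y \<notin> B h" for x y
          using eq arcV that by auto
        ultimately show ?thesis unfolding rest_def by (auto split: prod.splits)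
      qed
      ultimately show "g j \<phi> = g j \<psi>" by (simp add: g_def j)
    qed
  next
    show "\<not> p dvd c"
      using card0 by (cases "even (k - 1)") (simp_all add: c_def)
  next
    fix \<phi> :: "'a \<Rightarrow> 'p" assume im: "\<phi> ` V \<subseteq> I" and nc: "\<not> (\<exists>x. \<forall>v\<in>V. \<phi> v = x)"
    have "(\<Sum>h\<in>P0. sg h * of_bool (T \<phi> \<and> cp h \<phi>)) = 0"
      using const0 nc by (intro sum.neutral) auto
    then show "p dvd (\<Sum>j\<in>P1 \<times> {..<D}. f j \<phi> * g j \<phi>)"
      using total[OF im] by (simp add: cong_0_iff)
  next
    fix \<phi> :: "'a \<Rightarrow> 'p" and x assume x: "x \<in> I" and const: "\<forall>v\<in>V. \<phi> v = x"
    then have im: "\<phi> ` V \<subseteq> I" by auto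
    have "T \<phi>" using const arcV near(1) by (auto simp: T_def)
    moreover have "cp h \<phi>" if "h \<in> P0" for h using const0[OF that] const bV k0 by metis
    ultimately have "(\<Sum>h\<in>P0. sg h * of_bool (T \<phi> \<and> cp h \<phi>)) = (\<Sum>h\<in>P0. (- 1) ^ (k - 1))"
      by (intro sum.cong) (auto simp: sg0)
    then show "[(\<Sum>j\<in>P1 \<times> {..<D}. f j \<phi> * g j \<phi>) = c] (mod p)"
      using total[OF im] by (simp add: c_def)
  qed
  also have "\<dots> \<le> card P * D"
    unfolding card_cartesian_product using finP by (auto simp: P1_def intro!: card_mono mult_right_mono)
  finally show ?thesis by (simp add: cardP k_def V_def)
qed

text \<open>The components are placed one after another, each through a new copy of \<open>F\<close>
  in the points not yet used. At most \<open>card (pverts H)\<close> points are ever occupied, and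
  no edge joins different components, so nothing has to be arranged between the copies.\<close>

lemma embeds_near_by_components:
  fixes near :: "'p \<Rightarrow> 'p \<Rightarrow> bool"
  assumes H: "pair_graph H" and comp: "\<And>C. C \<in> pre_digraph.sccs (with_proj H) \<Longrightarrow> embeds_in C (with_proj F)"
    and I: "finite I"
    and large: "\<And>I'. I' \<subseteq> I \<Longrightarrow> card I \<le> card I' + card (pverts H) \<Longrightarrow> embeds_near near I' F"
  shows "embeds_near near I H"
proof -
  interpret pair_graph H by (rule H)
  have finV: "finite (pverts H)" by (rule pair_finite_verts)
  have arcE: "(u, v) \<in> parcs H" if "u \<rightarrow>\<^bsub>with_proj H\<^esub> v" for u v
    using that by (auto simp: arcs_ends_def arc_to_ends_def)
  have "\<exists>\<phi>. \<phi> ` \<Union> \<S> \<subseteq> I \<and> inj_on \<phi> (\<Union> \<S>) \<and>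
      (\<forall>(u, v)\<in>parcs H. u \<in> \<Union> \<S> \<longrightarrow> v \<in> \<Union> \<S> \<longrightarrow> near (\<phi> u) (\<phi> v))"
    if "finite \<S>" "\<S> \<subseteq> sccs_verts" for \<S>
    using that
  proof (induction \<S> rule: finite_induct)
    case (insert S \<S>)
    have sub\<S>: "\<S> \<subseteq> sccs_verts" and S: "S \<in> sccs_verts" using insert.prems by auto
    obtain \<phi> where \<phi>: "\<phi> ` \<Union> \<S> \<subseteq> I" "inj_on \<phi> (\<Union> \<S>)"
      and hom\<phi>: "\<forall>(u, v)\<in>parcs H. u \<in> \<Union> \<S> \<longrightarrow> v \<in> \<Union> \<S> \<longrightarrow> near (\<phi> u) (\<phi> v)"
      using insert.IH[OF sub\<S>] by (elim exE conjE) (rule that)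
    have U: "\<Union> \<S> \<subseteq> pverts H" using sub\<S> sccs_verts_subsets by fastforce
    have finU: "finite (\<Union> \<S>)" using U finV by (rule finite_subset)
    define I' where "I' = I - \<phi> ` \<Union> \<S>"
    have "card I \<le> card I' + card (pverts H)"
    proof -
      have "card I = card I' + card (\<phi> ` \<Union> \<S>)"
        unfolding I'_def using I \<phi>(1) by (simp add: card_Diff_subset finite_subset card_mono)
      also have "card (\<phi> ` \<Union> \<S>) \<le> card (pverts H)"
        using card_image_le[OF finU, of \<phi>] card_mono[OF finV U] by linarith
      finally show ?thesis by simp
    qed
    then have "embeds_near near I' F" by (intro large) (auto simp: I'_def)
    then obtain \<psi> where \<psi>: "\<psi> \<in> pverts F \<rightarrow> I'" "inj_on \<psi> (pverts F)"
      and hom\<psi>: "\<forall>(u, v)\<in>parcs F. near (\<psi> u) (\<psi> v)"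
      unfolding embeds_near_def by (elim exE conjE) (rule that)
    have "with_proj H \<restriction> S \<in> sccs" using S in_verts_sccsD_sccs by blast
    from comp[OF this] obtain f where f: "f \<in> S \<rightarrow> pverts F" "inj_on f S"
      and homf: "\<And>u v. u \<rightarrow>\<^bsub>with_proj H \<restriction> S\<^esub> v \<Longrightarrow> f u \<rightarrow>\<^bsub>with_proj F\<^esub> f v"
      unfolding embeds_in_def by auto
    have homS: "near (\<psi> (f u)) (\<psi> (f v))" if "(u, v) \<in> parcs H" "u \<in> S" "v \<in> S" for u v
    proof -
      have "u \<rightarrow>\<^bsub>with_proj H \<restriction> S\<^esub> v"
        using that by (force simp: arcs_ends_def arc_to_ends_def induce_subgraph_def)
      then have "f u \<rightarrow>\<^bsub>with_proj F\<^esub> f v" by (rule homf)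
      then have "(f u, f v) \<in> parcs F" by (auto simp: arcs_ends_def arc_to_ends_def)
      then show ?thesis using hom\<psi> by blast
    qed
    have disj: "S \<inter> \<Union> \<S> = {}"
      using sccs_verts_disjoint[OF S] sub\<S> insert.hyps(2) by blast
    have noarc: False if "(u, v) \<in> parcs H" "u \<in> S" "v \<notin> S" for u v
    proof -
      have "u \<rightarrow>\<^bsub>with_proj H\<^esub> v" "v \<rightarrow>\<^bsub>with_proj H\<^esub> u"
        using that(1) pair_sym_arcs by (auto simp: symmetric_def sym_def)
      then have "u \<rightarrow>\<^sup>*\<^bsub>with_proj H\<^esub> v" "v \<rightarrow>\<^sup>*\<^bsub>with_proj H\<^esub> u" by auto
      then show False using S that(2,3) unfolding sccs_verts_def by blast
    qed
    have sym: "(v, u) \<in> parcs H" if "(u, v) \<in> parcs H" for u v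
      using pair_sym_arcs that by (auto simp: symmetric_def sym_def)
    define \<theta> where "\<theta> v = (if v \<in> S then \<psi> (f v) else \<phi> v)" for v
    have \<theta>S: "\<theta> ` S \<subseteq> I'" using f(1) \<psi>(1) by (auto simp: \<theta>_def)
    have \<theta>U: "\<theta> v = \<phi> v" if "v \<in> \<Union> \<S>" for v using that disj by (auto simp: \<theta>_def)
    show ?case
    proof (intro exI[of _ \<theta>] conjI)
      have \<theta>\<S>: "\<theta> ` \<Union> \<S> = \<phi> ` \<Union> \<S>" using \<theta>U by (intro image_cong) auto
      show "\<theta> ` \<Union> (insert S \<S>) \<subseteq> I"
        unfolding Union_insert image_Un \<theta>\<S> using \<theta>S \<phi>(1) unfolding I'_def by blast
      have "inj_on \<theta> S"
      proof (rule inj_onI)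
        fix u v assume "u \<in> S" "v \<in> S" "\<theta> u = \<theta> v"
        then have "\<psi> (f u) = \<psi> (f v)" by (simp add: \<theta>_def)
        then have "f u = f v" using \<psi>(2) f(1) \<open>u \<in> S\<close> \<open>v \<in> S\<close> by (auto dest: inj_onD)
        then show "u = v" using f(2) \<open>u \<in> S\<close> \<open>v \<in> S\<close> by (auto dest: inj_onD)
      qed
      moreover have "inj_on \<theta> (\<Union> \<S>)" using \<phi>(2) \<theta>U by (simp add: inj_on_def)
      moreover have "\<theta> ` S \<inter> \<theta> ` \<Union> \<S> = {}" unfolding \<theta>\<S> using \<theta>S I'_def by blast
      ultimately show "inj_on \<theta> (\<Union> (insert S \<S>))"
        unfolding Union_insert inj_on_Un by blast
      show "\<forall>(u, v)\<in>parcs H. u \<in> \<Union> (insert S \<S>) \<longrightarrow> v \<in> \<Union> (insert S \<S>) \<longrightarrow> near (\<theta> u) (\<theta> v)"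
      proof clarify
        fix u v A B assume uv: "(u, v) \<in> parcs H" and u: "u \<in> A" "A \<in> insert S \<S>" and v: "v \<in> B" "B \<in> insert S \<S>"
        show "near (\<theta> u) (\<theta> v)"
        proof (cases "u \<in> S")
          case True
          then have "v \<in> S" using noarc uv by blast
          then show ?thesis using True homS uv by (simp add: \<theta>_def)
        next
          case False
          then have "v \<notin> S" using noarc sym uv by blast
          then have "u \<in> \<Union> \<S>" "v \<in> \<Union> \<S>" using False u v by auto
          then show ?thesis using bspec[OF hom\<phi> uv] \<theta>U by simp
        qed
      qed
    qed
  qed simp
  from this[OF finite_sccs_verts order.refl] obtain \<phi> where \<phi>: "\<phi> ` \<Union> sccs_verts \<subseteq> I"
      "inj_on \<phi> (\<Union> sccs_verts)"
    and hom: "\<forall>(u, v)\<in>parcs H. u \<in> \<Union> sccs_verts \<longrightarrow> v \<in> \<Union> sccs_verts \<longrightarrow> near (\<phi> u) (\<phi> v)"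
    by (elim exE conjE) (rule that)
  have "pverts H \<subseteq> \<Union> sccs_verts"
    using scc_of_in_sccs_verts in_scc_of_self by fastforce
  then have eq: "\<Union> sccs_verts = pverts H" using sccs_verts_subsets by fastforce
  show ?thesis
    unfolding embeds_near_def
  proof (intro exI[of _ \<phi>] conjI)
    show "\<phi> \<in> pverts H \<rightarrow> I" "inj_on \<phi> (pverts H)" using \<phi> by (auto simp: eq)
    show "\<forall>(u, v)\<in>parcs H. near (\<phi> u) (\<phi> v)"
      using hom in_arcsD1 in_arcsD2 unfolding eq by fastforce
  qed
qed

section \<open>Combining the degree bound and the envelope bound\<close>

lemma degree_sequence_second:
  assumes H: "pair_graph H" and ne: "pverts H \<noteq> {}"
  shows "\<exists>r\<in>pverts H. \<forall>v\<in>pverts H - {r}. out_degree H v \<le> degree_sequence H ! 1"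
proof -
  interpret pair_graph H by (rule H)
  define V where "V = pverts H"
  define d where "d v = out_degree H v" for v
  have fin: "finite V" using pair_finite_verts by (simp add: V_def)
  have "Max (d ` V) \<in> d ` V" using fin ne by (intro Max_in) (auto simp: V_def)
  then obtain r where r: "r \<in> V" "d r = Max (d ` V)" by auto
  have max: "d v \<le> d r" if "v \<in> V" for v using fin that by (simp add: r(2))
  define R where "R = image_mset d (mset_set (V - {r}))"
  have "image_mset d (mset_set V) = add_mset (d r) R"
    unfolding R_def using fin r(1) by (metis Diff_iff finite_Diff image_mset_add_mset insertI1 insert_Diff mset_set.insert)
  moreover have setR: "set (sorted_list_of_multiset R) = d ` (V - {r})" using fin by (simp add: R_def)
  ultimately have ds: "degree_sequence H = d r # rev (sorted_list_of_multiset R)"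
    unfolding degree_sequence_def V_def[symmetric] d_def[abs_def, symmetric]
    using max by (auto simp: sorted_insort_is_snoc)
  have "d v \<le> degree_sequence H ! 1" if v: "v \<in> V - {r}" for v
  proof -
    define xs where "xs = sorted_list_of_multiset R"
    have "d v \<in> set xs" using setR v by (simp add: xs_def)
    then obtain i where i: "i < length xs" "xs ! i = d v" by (auto simp: in_set_conv_nth)
    then have "xs ! i \<le> xs ! (length xs - 1)" by (intro sorted_nth_mono) (auto simp: xs_def)
    also have "\<dots> = rev xs ! 0" using i rev_nth[of 0 xs] by force
    finally show ?thesis using i by (simp add: ds xs_def)
  qed
  then show ?thesis using r(1) unfolding V_def d_def by blast
qed

text \<open>The constant \<open>C\<close> depends on \<open>H\<close> alone and is uniform in
  \<open>p\<close>, \<open>near\<close>, \<open>I\<close> and \<open>D\<close>, all of which vary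
  with the dimension.\<close>

lemma embeds_near_if_rank_le_Xi:
  assumes H: "pair_graph H" and ne: "pverts H \<noteq> {}" and Xi: "Xi H > 0"
  shows "\<exists>C. \<forall>(p :: int) (near :: 'p \<Rightarrow> 'p \<Rightarrow> bool) I D. prime p \<longrightarrow> int C < p \<longrightarrow> finite I \<longrightarrow>
    (\<forall>x. near x x) \<longrightarrow> (\<forall>x y. near x y \<longrightarrow> near y x) \<longrightarrow> nbhd_rank_le p I near (Xi H) D \<longrightarrow>
    card I > C * (D + 1) \<longrightarrow> embeds_near near I H"
proof (cases "lam_hat H \<le> degree_sequence H ! 1")
  case True
  then have Xi_eq: "Xi H = lam_hat H" by (simp add: Xi_def)
  have "\<exists>F :: nat pair_pre_digraph. connected_envelope H F \<and> lam F = lam_hat H"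
    unfolding lam_hat_def
    by (rule LeastI_ex) (use connected_envelope_exists[OF H ne] in blast)
  then obtain F :: "nat pair_pre_digraph" where env: "connected_envelope H F" and lam: "lam F = lam_hat H"
    by blast
  have F: "pair_graph F" using env by (simp add: connected_envelope_def)
  \<comment> \<open>\<open>lam\<close> of a graph without vertices is 0, whereas \<open>Xi H\<close>
    is positive.\<close>
  have Fne: "pverts F \<noteq> {}" using Xi lam unfolding Xi_eq lam_def by (auto split: if_splits)
  define k where "k = card (pverts F)"
  \<comment> \<open>The summands pay for the rank bound \<open>k! * D\<close>, for the requirement
    \<open>p > k\<close>, and for the points occupied by other components; the last cost is
    additive, whence \<open>D + 1\<close>.\<close>
  define C :: nat where "C = fact k + k + card (pverts H)"
  show ?thesis
  proof (intro exI[of _ C] allI impI)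
    fix p :: int and near :: "'p \<Rightarrow> 'p \<Rightarrow> bool" and I D
    assume p: "prime p" and Cp: "int C < p" and I: "finite I" and near: "\<forall>x. near x x" "\<forall>x y. near x y \<longrightarrow> near y x"
      and rank: "nbhd_rank_le p I near (Xi H) D" and large: "card I > C * (D + 1)"
    show "embeds_near near I H"
    proof (rule embeds_near_by_components[OF H _ I])
      show "embeds_in C (with_proj F)" if "C \<in> pre_digraph.sccs (with_proj H)" for C
        using env that by (simp add: connected_envelope_def)
    next
      fix I' assume sub: "I' \<subseteq> I" and card: "card I \<le> card I' + card (pverts H)"
      show "embeds_near near I' F"
      proof (rule ccontr)
        assume free: "\<not> embeds_near near I' F"
        have "card I' \<le> fact (card (pverts F)) * D"
        proof (rule card_le_if_not_embeds_near[OF F Fne _ _ _ p _ _ nbhd_rank_le_subset[OF rank sub] free])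
          show "lam F \<le> Xi H" by (simp add: lam Xi_eq)
          have "k \<le> C" by (simp add: C_def)
          then show "int (card (pverts F)) < p" using Cp unfolding k_def by linarith
          show "finite I'" using sub I finite_subset by blast
        qed (use near in blast)+
        moreover have "fact k * D + card (pverts H) \<le> C * (D + 1)"
          by (simp add: C_def algebra_simps)
        ultimately show False using card large by (simp add: k_def)
      qed
    qed
  qed
next
  case False
  then have Xi_eq: "Xi H = degree_sequence H ! 1" by (simp add: Xi_def)
  obtain r where r: "r \<in> pverts H" "\<And>v. v \<in> pverts H - {r} \<Longrightarrow> out_degree H v \<le> Xi H"
    using degree_sequence_second[OF H ne] unfolding Xi_eq by blast
  show ?thesis
  proof (intro exI[of _ "card (pverts H)"] allI impI)
    fix p :: int and near :: "'p \<Rightarrow> 'p \<Rightarrow> bool" and I D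
    assume p: "prime p" and I: "finite I" and near: "\<forall>x. near x x" "\<forall>x y. near x y \<longrightarrow> near y x"
      and rank: "nbhd_rank_le p I near (Xi H) D" and large: "card I > card (pverts H) * (D + 1)"
    show "embeds_near near I H"
    proof (rule embeds_near_if_degrees_le[OF H r(1) _ _ _ p I rank])
      show "card (pverts H) * D < card I" using large by simp
    qed (use r(2) near in blast)+
  qed
qed

section \<open>Lattice points\<close>

definition sqdist :: "nat \<Rightarrow> (nat \<Rightarrow> int) \<Rightarrow> (nat \<Rightarrow> int) \<Rightarrow> int" where
  "sqdist n x y = (\<Sum>i<n. (x i - y i)\<^sup>2)"

lemma pigeonhole_fibre:
  assumes "finite U" and "finite C" and "C \<noteq> {}" and "f ` U \<subseteq> C"
  shows "\<exists>c\<in>C. card U \<le> card C * card {x \<in> U. f x = c}"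
proof (rule ccontr)
  assume "\<not> ?thesis"
  then have lt: "card C * card {x \<in> U. f x = c} < card U" if "c \<in> C" for c using that by (meson not_le)
  have "card C * card U = card C * (\<Sum>c\<in>C. card {x \<in> U. f x = c})"
    using sum.group[OF assms(1,2,4), of "\<lambda>_. 1 :: nat"] by simp
  also have "\<dots> = (\<Sum>c\<in>C. card C * card {x \<in> U. f x = c})" by (rule sum_distrib_left)
  also have "\<dots> < (\<Sum>c\<in>C. card U)" using assms lt by (intro sum_strict_mono) auto
  also have "\<dots> = card C * card U" by simp
  finally show False by simp
qed

section \<open>Gaussian weights on integer points\<close>

lemma sum_Un_le_sum_add:
  fixes f :: "'a \<Rightarrow> real"
  assumes "finite A" and "finite B" and "\<And>x. 0 \<le> f x"
  shows "sum f (A \<union> B) \<le> sum f A + sum f B"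
proof -
  have "sum f (A \<union> B) = sum f A + sum f (B - A)"
    using assms(1,2) by (subst sum.union_disjoint[symmetric]) auto
  also have "sum f (B - A) \<le> sum f B" using assms by (intro sum_mono2) auto
  finally show ?thesis by simp
qed

text \<open>Chernoff's method: the tilted sum \<open>\<phi> t\<close> has negative derivative at 0,
  so \<open>\<phi> t < \<phi> 0\<close> for some \<open>t > 0\<close>, and on the tail every weight
  is at most its tilted value. The tail is thus exponentially smaller than the total weight
  \<open>\<phi> 0 ^ n\<close>.\<close>

lemma chernoff_product_weights:
  fixes w g :: "int \<Rightarrow> real"
  assumes S: "finite S" "S \<noteq> {}" and w: "\<And>i. i \<in> S \<Longrightarrow> w i > 0" and neg: "(\<Sum>i\<in>S. w i * g i) < 0"
  shows "\<exists>r. 0 \<le> r \<and> r < (\<Sum>i\<in>S. w i) \<and> (\<forall>n :: nat.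
    (\<Sum>x\<in>{x \<in> {..<n} \<rightarrow>\<^sub>E S. (\<Sum>j<n. g (x j)) \<ge> 0}. \<Prod>j<n. w (x j)) \<le> r ^ n)"
proof -
  define \<phi> where "\<phi> t = (\<Sum>i\<in>S. w i * exp (t * g i))" for t
  have "DERIV \<phi> 0 :> (\<Sum>i\<in>S. w i * g i)"
    unfolding \<phi>_def by (auto intro!: derivative_eq_intros sum.cong)
  from DERIV_neg_dec_right[OF this neg] obtain d where d: "d > 0" "\<And>t. 0 < t \<Longrightarrow> t < d \<Longrightarrow> \<phi> (0 + t) < \<phi> 0"
    by blast
  define t where "t = d / 2"
  have t: "t > 0" "\<phi> t < \<phi> 0" using d(1) d(2)[of t] by (auto simp: t_def)
  show ?thesis
  proof (intro exI[of _ "\<phi> t"] conjI allI)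
    show "0 \<le> \<phi> t" unfolding \<phi>_def using w by (intro sum_nonneg) (auto intro: less_imp_le)
    show "\<phi> t < (\<Sum>i\<in>S. w i)" using t(2) by (simp add: \<phi>_def)
    fix n :: nat
    have pos: "0 \<le> (\<Prod>j<n. w (x j))" if "x \<in> {..<n} \<rightarrow>\<^sub>E S" for x
      using that w by (intro prod_nonneg) (auto intro: less_imp_le)
    have "(\<Sum>x\<in>{x \<in> {..<n} \<rightarrow>\<^sub>E S. (\<Sum>j<n. g (x j)) \<ge> 0}. \<Prod>j<n. w (x j))
      \<le> (\<Sum>x\<in>{x \<in> {..<n} \<rightarrow>\<^sub>E S. (\<Sum>j<n. g (x j)) \<ge> 0}. \<Prod>j<n. w (x j) * exp (t * g (x j)))"
    proof (rule sum_mono)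
      fix x assume x: "x \<in> {x \<in> {..<n} \<rightarrow>\<^sub>E S. (\<Sum>j<n. g (x j)) \<ge> 0}"
      then have "1 \<le> exp (t * (\<Sum>j<n. g (x j)))" using t(1) by simp
      then have "(\<Prod>j<n. w (x j)) * 1 \<le> (\<Prod>j<n. w (x j)) * exp (t * (\<Sum>j<n. g (x j)))"
        using pos x by (intro mult_left_mono) auto
      then show "(\<Prod>j<n. w (x j)) \<le> (\<Prod>j<n. w (x j) * exp (t * g (x j)))"
        by (simp add: prod.distrib sum_distrib_left exp_sum)
    qed
    also have "\<dots> \<le> (\<Sum>x\<in>{..<n} \<rightarrow>\<^sub>E S. \<Prod>j<n. w (x j) * exp (t * g (x j)))"
      using S w by (intro sum_mono2 finite_PiE prod_nonneg mult_nonneg_nonneg) (auto intro!: less_imp_le[OF w])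
    also have "\<dots> = (\<Prod>j<n. \<phi> t)" unfolding \<phi>_def using S by (intro prod_sum_PiE[symmetric]) auto
    finally show "(\<Sum>x\<in>{x \<in> {..<n} \<rightarrow>\<^sub>E S. (\<Sum>j<n. g (x j)) \<ge> 0}. \<Prod>j<n. w (x j)) \<le> \<phi> t ^ n" by simp
  qed
qed

text \<open>Monotonicity on the half line bounds the sum over \<open>k \<ge> 0\<close> from below by
  the Gaussian integral. Doubling it counts the term at 0 twice, which explains the
  \<open>- 1\<close>; truncation at \<open>L\<close> costs the factor
  \<open>1 - \<eta>\<close>.\<close>

lemma gaussian_sum_lower_bound:
  assumes s: "s > 0" and \<eta>: "\<eta> > 0"
  shows "\<exists>L. (1 - \<eta>) * sqrt (pi / s) - 1 \<le> (\<Sum>i\<in>{- int L..int L}. exp (- (s * (real_of_int i)\<^sup>2)))"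
proof -
  define f where "f v = exp (- (s * v\<^sup>2))" for v :: real
  have "has_bochner_integral lborel (\<lambda>x. indicator {0..} (0 + sqrt s * x) *\<^sub>R exp (- (0 + sqrt s * x)\<^sup>2)) ((sqrt pi / 2) /\<^sub>R \<bar>sqrt s\<bar>)"
    using gaussian_moment_0 s by (subst lborel_has_bochner_integral_real_affine_iff[symmetric]) auto
  moreover have "(indicator {0..} (0 + sqrt s * x) :: real) = indicator {0..} x" for x
    using s by (auto simp: indicator_def zero_le_mult_iff)
  moreover have "exp (- (0 + sqrt s * x)\<^sup>2) = f x" for x
    using s by (simp add: f_def power_mult_distrib)
  moreover have "(sqrt pi / 2) /\<^sub>R \<bar>sqrt s\<bar> = sqrt (pi / s) / 2"
    unfolding real_scaleR_def real_sqrt_divide using s by (simp add: field_simps)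
  ultimately have bi: "has_bochner_integral lborel (\<lambda>x. indicator {0..} x *\<^sub>R f x) (sqrt (pi / s) / 2)"
    by (simp only:)
  have lim: "((\<lambda>y. LINT x:{0..y}|lborel. f x) \<longlongrightarrow> (LINT x:{0..}|lborel. f x)) at_top"
    using bi by (intro tendsto_set_lebesgue_integral_at_top)
      (auto simp: set_integrable_def has_bochner_integral_iff)
  have val: "(LINT x:{0..}|lborel. f x) = sqrt (pi / s) / 2"
    using bi by (simp add: set_lebesgue_integral_def has_bochner_integral_iff)
  have "(1 - \<eta>) * (sqrt (pi / s) / 2) < sqrt (pi / s) / 2"
    using s \<eta> by (simp add: field_simps)
  from order_tendstoD(1)[OF filterlim_compose[OF lim filterlim_real_sequentially], unfolded val, OF this]
  have "\<forall>\<^sub>F L in sequentially. (1 - \<eta>) * (sqrt (pi / s) / 2) < (LINT x:{0..real L}|lborel. f x)" .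
  then obtain L where L: "(1 - \<eta>) * (sqrt (pi / s) / 2) < (LINT x:{0..real L}|lborel. f x)"
    by (auto simp: eventually_sequentially)
  have cont: "continuous_on {0..} f" unfolding f_def by (intro continuous_intros)
  interpret f: antimono_fun_sum_integral_diff f
  proof
    show "f y \<le> f x" if "x \<ge> 0" "x \<le> y" for x y
      using that s by (simp add: f_def power_mono)
    show "f x \<ge> 0" for x by (simp add: f_def)
  qed fact
  have "(LINT x:{0..real L}|lborel. f x) = integral {0..real L} f"
  proof (rule set_borel_integral_eq_integral(2))
    show "set_integrable lborel {0..real L} f"
      unfolding set_integrable_def
      by (intro borel_integrable_compact continuous_on_subset[OF cont]) auto
  qed
  also have "\<dots> \<le> (\<Sum>k\<le>L. f (real k))"
    using f.sum_integral_diff_series_nonneg[of L] by (simp add: f.sum_integral_diff_series_def)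
  finally have 1: "(1 - \<eta>) * (sqrt (pi / s) / 2) \<le> (\<Sum>k\<le>L. f (real k))" using L by linarith
  have split: "{- int L..int L} = int ` {..L} \<union> (\<lambda>k. - int k) ` {1..L}"
  proof
    show "{- int L..int L} \<subseteq> int ` {..L} \<union> (\<lambda>k. - int k) ` {1..L}"
    proof
      fix i assume i: "i \<in> {- int L..int L}"
      show "i \<in> int ` {..L} \<union> (\<lambda>k. - int k) ` {1..L}"
      proof (cases "i \<ge> 0")
        case True then show ?thesis using i by (intro UnI1 image_eqI[of _ _ "nat i"]) auto
      next
        case False then show ?thesis using i by (intro UnI2 image_eqI[of _ _ "nat (- i)"]) auto
      qed
    qed
  qed auto
  have "(\<Sum>i\<in>{- int L..int L}. f (real_of_int i))
      = (\<Sum>i\<in>int ` {..L}. f (real_of_int i)) + (\<Sum>i\<in>(\<lambda>k. - int k) ` {1..L}. f (real_of_int i))"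
    unfolding split by (rule sum.union_disjoint) auto
  also have "\<dots> = (\<Sum>k\<le>L. f (real k)) + (\<Sum>k\<in>{1..L}. f (real k))"
    by (simp add: sum.reindex inj_on_def f_def)
  also have "(\<Sum>k\<le>L. f (real k)) = f 0 + (\<Sum>k\<in>{1..L}. f (real k))"
  proof -
    have "{..L} = insert 0 {1..L}" by auto
    then show ?thesis by simp
  qed
  finally have 2: "(\<Sum>i\<in>{- int L..int L}. f (real_of_int i)) = 2 * (\<Sum>k\<le>L. f (real k)) - 1"
    using \<open>(\<Sum>k\<le>L. f (real k)) = f 0 + (\<Sum>k\<in>{1..L}. f (real k))\<close> by (simp add: f_def)
  show ?thesis using 1 2 unfolding f_def by (intro exI[of _ L]) (simp add: field_simps)
qed

text \<open>For a wide Gaussian the lattice sum is nearly the integral, and few points are close to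
  0, so the second moment can be made as large as desired. A large second moment makes the later
  rounding of the scale harmless.\<close>

lemma discrete_gaussian:
  assumes \<eta>: "0 < \<eta>" "\<eta> < 1"
  shows "\<exists>s L. s > 0 \<and> (1 - \<eta>) * sqrt (pi / s) \<le> (\<Sum>i\<in>{- int L..int L}. exp (- (s * (real_of_int i)\<^sup>2))) \<and>
    real B * (\<Sum>i\<in>{- int L..int L}. exp (- (s * (real_of_int i)\<^sup>2)))
      \<le> (\<Sum>i\<in>{- int L..int L}. (real_of_int i)\<^sup>2 * exp (- (s * (real_of_int i)\<^sup>2)))"
proof -
  \<comment> \<open>The width \<open>t\<close> is \<open>sqrt (pi / s)\<close>. Its first bound
    absorbs the \<open>- 1\<close> of the Gaussian sum into \<open>\<eta> / 2\<close>; the second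
    gives \<open>Z \<ge> 8 * B + 2\<close>, so that the at most \<open>4 * B + 1\<close> points of
    \<open>S1\<close>, of weight at most 1 each, carry at most half of the mass.\<close>
  define t where "t = max (2 / \<eta>) ((8 * real B + 2) / (1 - \<eta>))"
  define s where "s = pi / t\<^sup>2"
  have t: "2 / \<eta> \<le> t" "(8 * real B + 2) / (1 - \<eta>) \<le> t" by (auto simp: t_def)
  have t0: "t > 0" using t(1) \<eta> by (smt (verit) divide_pos_pos)
  have s: "s > 0" using t0 by (simp add: s_def)
  have sq: "sqrt (pi / s) = t" using t0 by (simp add: s_def real_sqrt_divide)
  obtain L where L: "(1 - \<eta> / 2) * sqrt (pi / s) - 1 \<le> (\<Sum>i\<in>{- int L..int L}. exp (- (s * (real_of_int i)\<^sup>2)))"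
    using gaussian_sum_lower_bound[OF s, of "\<eta> / 2"] \<eta> by auto
  define S where "S = {- int L..int L}"
  define w where "w i = exp (- (s * (real_of_int i)\<^sup>2))" for i
  define Z where "Z = (\<Sum>i\<in>S. w i)"
  have w: "0 < w i" "w i \<le> 1" for i using s by (auto simp: w_def)
  have "1 \<le> \<eta> / 2 * t" using t(1) \<eta> by (simp add: field_simps)
  moreover have "(1 - \<eta> / 2) * t - 1 \<le> Z" using L unfolding Z_def S_def w_def sq .
  moreover have "(1 - \<eta> / 2) * t = (1 - \<eta>) * t + \<eta> / 2 * t" by (simp add: algebra_simps)
  ultimately have Z: "(1 - \<eta>) * t \<le> Z" by linarith
  have "8 * real B + 2 \<le> (1 - \<eta>) * t" using t(2) \<eta> by (simp add: field_simps)
  then have ZB: "8 * real B + 2 \<le> Z" using Z by linarith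
  define S1 where "S1 = {i \<in> S. \<bar>i\<bar> < 2 * int B}"
  have "(\<Sum>i\<in>S1. w i) \<le> (\<Sum>i\<in>S1. 1)" using w by (intro sum_mono) auto
  also have "\<dots> = real (card S1)" by simp
  also have "\<dots> \<le> 4 * real B + 1"
  proof -
    have "card S1 \<le> card {- (2 * int B)..2 * int B}" by (intro card_mono) (auto simp: S1_def)
    then show ?thesis by simp
  qed
  finally have S1: "(\<Sum>i\<in>S1. w i) \<le> 4 * real B + 1" .
  have "Z = (\<Sum>i\<in>S1. w i) + (\<Sum>i\<in>S - S1. w i)"
    unfolding Z_def by (subst sum.subset_diff[of S1 S]) (auto simp: S1_def S_def)
  then have half: "Z / 2 \<le> (\<Sum>i\<in>S - S1. w i)" using S1 ZB by linarith
  have "real B * Z = 2 * real B * (Z / 2)" by simp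
  also have "\<dots> \<le> 2 * real B * (\<Sum>i\<in>S - S1. w i)" using half by (intro mult_left_mono) auto
  also have "\<dots> = (\<Sum>i\<in>S - S1. 2 * real B * w i)" by (rule sum_distrib_left)
  also have "\<dots> \<le> (\<Sum>i\<in>S - S1. (real_of_int i)\<^sup>2 * w i)"
  proof (intro sum_mono mult_right_mono)
    fix i assume i: "i \<in> S - S1"
    then have ge: "2 * int B \<le> \<bar>i\<bar>" by (auto simp: S1_def)
    have "\<bar>i\<bar> * 1 \<le> \<bar>i\<bar> * \<bar>i\<bar>"
    proof (cases "i = 0")
      case False
      then show ?thesis by (intro mult_left_mono) auto
    qed simp
    then have "2 * int B \<le> i\<^sup>2" using ge by (simp add: power2_eq_square)
    then have "real_of_int (2 * int B) \<le> real_of_int (i\<^sup>2)" by (simp only: of_int_le_iff)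
    then show "2 * real B \<le> (real_of_int i)\<^sup>2" by simp
  qed (use w in \<open>auto intro: less_imp_le\<close>)
  also have "\<dots> \<le> (\<Sum>i\<in>S. (real_of_int i)\<^sup>2 * w i)"
    using w by (intro sum_mono2) (auto simp: S_def intro!: mult_nonneg_nonneg less_imp_le[OF w(1)])
  finally have "real B * Z \<le> (\<Sum>i\<in>S. (real_of_int i)\<^sup>2 * w i)" .
  then show ?thesis using s Z unfolding Z_def S_def w_def sq[symmetric] by blast
qed

text \<open>
  The number of lattice points of a shell is bounded below through Gaussian weights on a fine
  lattice; the pigeonhole principle then selects a coset of the coarse lattice, which plays the role of
  a suitably centered ball.
\<close>

lemma many_even_lattice_points:
  assumes c: "c > 0" and K: "K > 0" "K < sqrt (2 * pi * exp 1 * c)"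
  shows "\<forall>\<^sub>F n in sequentially. \<exists>V. finite V \<and> V \<subseteq> ({..<n} \<rightarrow>\<^sub>E UNIV) \<and> K ^ n \<le> real (card V) \<and>
    (\<forall>x\<in>V. \<forall>y\<in>V. real_of_int (sqdist n x y) \<le> 4 * c * real n \<and> even (sqdist n x y))"
proof -
  define Q where "Q = sqrt (2 * pi * exp 1 * c)"
  have Q: "Q > 0" using c by (simp add: Q_def)
  \<comment> \<open>With \<open>K / Q = 1 - 4 \<eta>\<close>, two losses can be afforded:
    \<open>(1 - 4 \<eta>) (1 + \<eta>) < 1 - \<eta>\<close>, one from rounding the scale and one
    from the Gaussian sum.\<close>
  define \<eta> where "\<eta> = (1 - K / Q) / 4"
  have KQ: "0 < K / Q" "K / Q < 1" using K Q by (auto simp: Q_def)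
  then have \<eta>: "0 < \<eta>" "\<eta> < 1" by (auto simp: \<eta>_def)
  obtain B :: nat where B: "c / \<eta>\<^sup>2 < real B" using reals_Archimedean2 by blast
  obtain s L where s: "s > 0" and Zlow: "(1 - \<eta>) * sqrt (pi / s) \<le> (\<Sum>i\<in>{- int L..int L}. exp (- (s * (real_of_int i)\<^sup>2)))"
    and Elow: "real B * (\<Sum>i\<in>{- int L..int L}. exp (- (s * (real_of_int i)\<^sup>2)))
      \<le> (\<Sum>i\<in>{- int L..int L}. (real_of_int i)\<^sup>2 * exp (- (s * (real_of_int i)\<^sup>2)))"
    using discrete_gaussian[OF \<eta>] by blast
  define S where "S = {- int L..int L}"
  define w where "w i = exp (- (s * (real_of_int i)\<^sup>2))" for i
  define Z where "Z = (\<Sum>i\<in>S. w i)"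
  define E where "E = (\<Sum>i\<in>S. (real_of_int i)\<^sup>2 * w i) / Z"
  have S: "finite S" "S \<noteq> {}" by (auto simp: S_def)
  have w: "0 < w i" for i by (simp add: w_def)
  have Z: "Z > 0" unfolding Z_def using S w by (intro sum_pos) auto
  have ZE: "(\<Sum>i\<in>S. w i * (real_of_int i)\<^sup>2) = Z * E" using Z by (simp add: E_def mult.commute)
  have EB: "real B \<le> E" using Elow Z unfolding E_def Z_def S_def w_def by (simp add: le_divide_eq)
  have Z1: "(1 - \<eta>) * sqrt (pi / s) \<le> Z" using Zlow unfolding Z_def S_def w_def .
  have E0: "E > 0" "c / \<eta>\<^sup>2 \<le> E"
  proof -
    have "0 < c / \<eta>\<^sup>2" using c \<eta> by simp
    then show "E > 0" "c / \<eta>\<^sup>2 \<le> E" using B EB by linarith+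
  qed
  \<comment> \<open>Typical points have squared norm near \<open>n E\<close> and are to end up at
    \<open>n c\<close>, so \<open>a\<close> is the ideal side of the coarse lattice and
    \<open>M\<close> an integer just above it. The choice of \<open>B\<close> makes
    \<open>a \<ge> 1 / \<eta>\<close>, hence \<open>M \<le> (1 + \<eta>) a\<close>.\<close>
  define a where "a = sqrt (E / c)"
  have a: "1 / \<eta> \<le> a" "a > 0" "a\<^sup>2 = E / c"
  proof -
    have "(1 / \<eta>)\<^sup>2 \<le> E / c" using E0(2) c \<eta> by (simp add: field_simps)
    then show "1 / \<eta> \<le> a" unfolding a_def using \<eta> by (intro real_le_rsqrt) auto
    show "a > 0" "a\<^sup>2 = E / c" using E0 c by (auto simp: a_def)
  qed
  define M where "M = \<lfloor>a\<rfloor> + 1"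
  have M: "a < real_of_int M" "real_of_int M \<le> a + 1" "M > 0" using a(2) unfolding M_def by linarith+
  have EM: "E < c * (real_of_int M)\<^sup>2"
  proof -
    have "a\<^sup>2 < (real_of_int M)\<^sup>2" using M a by (intro power_strict_mono) auto
    then show ?thesis using a(3) c by (simp add: divide_less_eq mult.commute)
  qed
  \<comment> \<open>\<open>Z * exp (s * E)\<close> is the number of shell points per coordinate. The
    inequality \<open>u \<le> exp (u - 1)\<close> at \<open>u = 2 s E\<close> bounds it without
    knowledge of the exact second moment; for the continuous Gaussian \<open>u = 1\<close>, where
    equality holds.\<close>
  have ZE_low: "(1 - \<eta>) * sqrt (2 * pi * exp 1 * E) \<le> Z * exp (s * E)"
  proof -
    have "2 * (s * E) \<le> exp (2 * (s * E) - 1)" using exp_ge_add_one_self[of "2 * (s * E) - 1"] by simp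
    then have "exp 1 * (2 * (s * E)) \<le> exp 1 * exp (2 * (s * E) - 1)" by simp
    also have "\<dots> = (exp (s * E))\<^sup>2" by (simp add: exp_add[symmetric] power2_eq_square)
    finally have "sqrt (exp 1 * (2 * (s * E))) \<le> exp (s * E)" by (intro real_le_lsqrt) auto
    then have "(1 - \<eta>) * sqrt (pi / s) * sqrt (exp 1 * (2 * (s * E))) \<le> Z * exp (s * E)"
      using Z1 Z \<eta> s E0 by (intro mult_mono) auto
    moreover have "sqrt (pi / s) * sqrt (exp 1 * (2 * (s * E))) = sqrt (2 * pi * exp 1 * E)"
      using s by (simp add: real_sqrt_mult[symmetric] field_simps)
    ultimately show ?thesis by (simp add: mult.assoc)
  qed
  have K_less: "K * real_of_int M < Z * exp (s * E)"
  proof -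
    have "sqrt (2 * pi * exp 1 * E) = Q * a"
      using c by (simp add: Q_def a_def real_sqrt_mult[symmetric])
    then have 1: "(1 - \<eta>) * (Q * a) \<le> Z * exp (s * E)" using ZE_low by simp
    have "a + 1 \<le> a * (1 + \<eta>)" using a(1) \<eta> by (simp add: field_simps)
    then have "K * real_of_int M \<le> K * (a * (1 + \<eta>))" using M K by (intro mult_left_mono) auto
    also have "\<dots> = (K / Q * (1 + \<eta>)) * (Q * a)" using Q by simp
    also have "\<dots> < (1 - \<eta>) * (Q * a)"
    proof (rule mult_strict_right_mono)
      have "4 * \<eta> = 1 - K / Q" by (simp add: \<eta>_def)
      then have KQ_eq: "K / Q = 1 - 4 * \<eta>" by simp
      have "0 < 2 * \<eta> + 4 * (\<eta> * \<eta>)" using \<eta> by (intro add_pos_pos) auto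
      then show "K / Q * (1 + \<eta>) < 1 - \<eta>" unfolding KQ_eq by (simp add: algebra_simps)
      show "0 < Q * a" using Q a by simp
    qed
    finally show ?thesis using 1 by linarith
  qed
  have r: "1 < Z * exp (s * E) / (K * real_of_int M)" using K_less K M by (simp add: less_divide_eq)
  \<comment> \<open>Thickness of the shell: the first term keeps it inside the ball, the second
    limits the loss \<open>exp (s \<delta>)\<close> per coordinate so that the rate stays above
    \<open>K\<close>.\<close>
  define \<delta> where "\<delta> = min (c * (real_of_int M)\<^sup>2 - E) (ln (Z * exp (s * E) / (K * real_of_int M)) / (2 * s))"
  have \<delta>: "\<delta> > 0" "E + \<delta> \<le> c * (real_of_int M)\<^sup>2"
    using EM r s by (auto simp: \<delta>_def)
  define K1 where "K1 = Z * exp (s * (E - \<delta>)) / real_of_int M"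
  have K1: "K < K1"
  proof -
    have "s * \<delta> \<le> ln (Z * exp (s * E) / (K * real_of_int M)) / 2"
      using s mult_left_mono[of \<delta> "ln (Z * exp (s * E) / (K * real_of_int M)) / (2 * s)" s] by (simp add: \<delta>_def)
    also have "\<dots> < ln (Z * exp (s * E) / (K * real_of_int M))" using r by simp
    finally have "exp (s * \<delta>) < Z * exp (s * E) / (K * real_of_int M)"
      using r by (metis exp_less_cancel_iff exp_ln less_trans zero_less_one)
    then have "exp (s * \<delta>) * (K * real_of_int M) < Z * exp (s * E)" using K M by (simp add: less_divide_eq)
    moreover have "exp (s * E) = exp (s * (E - \<delta>)) * exp (s * \<delta>)"
      by (simp add: exp_add[symmetric] algebra_simps)
    ultimately have "exp (s * \<delta>) * (K * real_of_int M) < exp (s * \<delta>) * (Z * exp (s * (E - \<delta>)))" by simp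
    then have "K * real_of_int M < Z * exp (s * (E - \<delta>))" by (simp only: mult_less_cancel_left_pos[OF exp_gt_zero])
    then show ?thesis using M by (simp add: K1_def less_divide_eq)
  qed
  have "(\<Sum>i\<in>S. w i * ((real_of_int i)\<^sup>2 - E - \<delta>)) < 0"
  proof -
    have "(\<Sum>i\<in>S. w i * ((real_of_int i)\<^sup>2 - E - \<delta>)) = - (Z * \<delta>)"
      using ZE by (simp add: right_diff_distrib sum_subtractf sum_distrib_right[symmetric] Z_def[symmetric])
    then show ?thesis using Z \<delta> by simp
  qed
  from chernoff_product_weights[OF S w this] obtain r1 where r1: "0 \<le> r1" "r1 < Z"
    and tail1: "\<And>n. (\<Sum>x\<in>{x \<in> {..<n} \<rightarrow>\<^sub>E S. (\<Sum>j<n. (real_of_int (x j))\<^sup>2 - E - \<delta>) \<ge> 0}. \<Prod>j<n. w (x j)) \<le> r1 ^ n"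
    unfolding Z_def by blast
  have "(\<Sum>i\<in>S. w i * (E - \<delta> - (real_of_int i)\<^sup>2)) < 0"
  proof -
    have "(\<Sum>i\<in>S. w i * (E - \<delta> - (real_of_int i)\<^sup>2)) = - (Z * \<delta>)"
      using ZE by (simp add: right_diff_distrib sum_subtractf sum_distrib_right[symmetric] Z_def[symmetric])
    then show ?thesis using Z \<delta> by simp
  qed
  from chernoff_product_weights[OF S w this] obtain r2 where r2: "0 \<le> r2" "r2 < Z"
    and tail2: "\<And>n. (\<Sum>x\<in>{x \<in> {..<n} \<rightarrow>\<^sub>E S. (\<Sum>j<n. E - \<delta> - (real_of_int (x j))\<^sup>2) \<ge> 0}. \<Prod>j<n. w (x j)) \<le> r2 ^ n"
    unfolding Z_def by blast
  have lims: "(\<lambda>n. (r1 / Z) ^ n) \<longlonglongrightarrow> 0" "(\<lambda>n. (r2 / Z) ^ n) \<longlonglongrightarrow> 0" "(\<lambda>n. (K / K1) ^ n) \<longlonglongrightarrow> 0"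
    using r1 r2 Z K K1 by (auto intro!: LIMSEQ_realpow_zero)
  have quarter: "(0 :: real) < 1 / 4" by simp
  show ?thesis
    using order_tendstoD(2)[OF lims(1) quarter] order_tendstoD(2)[OF lims(2) quarter]
      order_tendstoD(2)[OF lims(3) quarter]
  proof eventually_elim
    case (elim n)
    define P where "P = {..<n} \<rightarrow>\<^sub>E S"
    define W where "W x = (\<Prod>j<n. w (x j))" for x
    \<comment> \<open>By the two tail bounds the shell \<open>U\<close> carries at least half of the
      total weight. The weight depends only on the squared norm, so it is at most a fixed value on
      \<open>U\<close>, and this turns the weight into a number of points.\<close>
    define U where "U = {x \<in> P. real n * (E - \<delta>) < (\<Sum>j<n. (real_of_int (x j))\<^sup>2) \<and> (\<Sum>j<n. (real_of_int (x j))\<^sup>2) < real n * (E + \<delta>)}"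
    define U1 where "U1 = {x \<in> P. (\<Sum>j<n. (real_of_int (x j))\<^sup>2 - E - \<delta>) \<ge> 0}"
    define U2 where "U2 = {x \<in> P. (\<Sum>j<n. E - \<delta> - (real_of_int (x j))\<^sup>2) \<ge> 0}"
    have finP: "finite P" unfolding P_def using S by (intro finite_PiE) auto
    have W: "0 < W x" for x unfolding W_def by (intro prod_pos w)
    have W_eq: "W x = exp (- (s * (\<Sum>j<n. (real_of_int (x j))\<^sup>2)))" for x
      unfolding W_def w_def by (simp add: exp_sum[symmetric] sum_negf sum_distrib_left)
    have s1: "(\<Sum>j<n. (real_of_int (x j))\<^sup>2 - E - \<delta>) = (\<Sum>j<n. (real_of_int (x j))\<^sup>2) - real n * (E + \<delta>)" for x
      by (simp add: sum_subtractf algebra_simps)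
    have s2: "(\<Sum>j<n. E - \<delta> - (real_of_int (x j))\<^sup>2) = real n * (E - \<delta>) - (\<Sum>j<n. (real_of_int (x j))\<^sup>2)" for x
      by (simp add: sum_subtractf)
    have "P \<subseteq> U \<union> U1 \<union> U2" unfolding U_def U1_def U2_def s1 s2 by auto
    then have "(\<Sum>x\<in>P. W x) \<le> (\<Sum>x\<in>U \<union> U1 \<union> U2. W x)"
      using finP less_imp_le[OF W] by (intro sum_mono2) (auto simp: U_def U1_def U2_def)
    also have "\<dots> \<le> (\<Sum>x\<in>U \<union> U1. W x) + (\<Sum>x\<in>U2. W x)"
      using finP less_imp_le[OF W] by (intro sum_Un_le_sum_add) (auto simp: U_def U1_def U2_def)
    also have "(\<Sum>x\<in>U \<union> U1. W x) \<le> (\<Sum>x\<in>U. W x) + (\<Sum>x\<in>U1. W x)"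
      using finP less_imp_le[OF W] by (intro sum_Un_le_sum_add) (auto simp: U_def U1_def)
    also have "(\<Sum>x\<in>U1. W x) \<le> r1 ^ n" using tail1[of n] unfolding U1_def W_def P_def .
    also have "(\<Sum>x\<in>U2. W x) \<le> r2 ^ n" using tail2[of n] unfolding U2_def W_def P_def .
    also have "(\<Sum>x\<in>P. W x) = Z ^ n"
      unfolding P_def W_def Z_def using S by (subst prod_sum_PiE[symmetric]) auto
    finally have "Z ^ n \<le> (\<Sum>x\<in>U. W x) + r1 ^ n + r2 ^ n" by simp
    moreover have "r1 ^ n \<le> Z ^ n / 4" "r2 ^ n \<le> Z ^ n / 4"
      using elim(1,2) Z by (auto simp: power_divide divide_less_eq)
    ultimately have half: "Z ^ n / 2 \<le> (\<Sum>x\<in>U. W x)" by linarith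
    also have "\<dots> \<le> (\<Sum>x\<in>U. exp (- (s * (real n * (E - \<delta>)))))"
      unfolding W_eq using s by (intro sum_mono) (auto simp: U_def)
    also have "\<dots> = real (card U) * exp (- (s * (real n * (E - \<delta>))))" by simp
    finally have "Z ^ n / 2 \<le> real (card U) * exp (- (s * (real n * (E - \<delta>))))" .
    from mult_right_mono[OF this, of "exp (s * (real n * (E - \<delta>)))"]
    have "Z ^ n / 2 * exp (s * (real n * (E - \<delta>))) \<le> real (card U)"
      by (simp add: mult.assoc exp_add[symmetric])
    moreover have "exp (s * (real n * (E - \<delta>))) = exp (s * (E - \<delta>)) ^ n"
      by (simp add: exp_of_nat_mult[symmetric] mult_ac)
    ultimately have cardU: "(K1 * real_of_int M) ^ n / 2 \<le> real (card U)"
      using M by (simp add: K1_def power_mult_distrib)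
    define C where "C = ({..<n} \<rightarrow>\<^sub>E {0..<M}) \<times> {0, 1 :: int}"
    \<comment> \<open>Points with equal residues modulo \<open>M\<close> differ by \<open>M\<close>
      times an integer vector. The second component fixes the parity of the coordinate sum of the
      quotients and so makes squared distances even, squares being congruent to their bases modulo
      2.\<close>
    define cl where "cl x = ((\<lambda>j\<in>{..<n}. x j mod M), (\<Sum>j<n. x j div M) mod 2)" for x :: "nat \<Rightarrow> int"
    have finC: "finite C" unfolding C_def by (intro finite_cartesian_product finite_PiE) auto
    have cardC: "card C = nat M ^ n * 2"
      unfolding C_def by (simp add: card_cartesian_product card_PiE)
    have clC: "cl x \<in> C" for x unfolding cl_def C_def using M(3) by auto
    have finU: "finite U" using finP by (simp add: U_def)
    obtain k where k: "card U \<le> card C * card {x \<in> U. cl x = k}"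
      using pigeonhole_fibre[OF finU finC, of cl] clC by blast
    define U' where "U' = {x \<in> U. cl x = k}"
    define dv where "dv x = (\<lambda>j\<in>{..<n}. x j div M)" for x :: "nat \<Rightarrow> int"
    define V where "V = dv ` U'"
    have modeq: "x j mod M = y j mod M" if "x \<in> U'" "y \<in> U'" "j < n" for x y j
    proof -
      have "fst (cl x) j = fst (cl y) j" using that by (simp add: U'_def)
      then show ?thesis using that(3) by (simp add: cl_def)
    qed
    have diff: "x j - y j = M * (dv x j - dv y j)" if "x \<in> U'" "y \<in> U'" "j < n" for x y j
    proof -
      have "M * (x j div M) + x j mod M = x j" "M * (y j div M) + y j mod M = y j" by simp_all
      then have "x j - y j = M * (x j div M) - M * (y j div M)" using modeq[OF that] by linarith
      then show ?thesis using that(3) by (simp add: dv_def right_diff_distrib)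
    qed
    have inj: "inj_on dv U'"
    proof (rule inj_onI)
      fix x y assume xy: "x \<in> U'" "y \<in> U'" "dv x = dv y"
      have "x j = y j" if "j < n" for j using diff[OF xy(1,2) that] xy(3) by simp
      moreover have "x \<in> P" "y \<in> P" using xy by (auto simp: U'_def U_def)
      ultimately show "x = y" unfolding P_def by (intro PiE_ext) auto
    qed
    have "K1 ^ n / 4 \<le> real (card V)"
    proof -
      have "(K1 * real_of_int M) ^ n / 2 \<le> real (nat M ^ n * 2 * card U')"
        using cardU k unfolding cardC U'_def by linarith
      also have "\<dots> = real_of_int M ^ n * 2 * real (card U')" using M(3) by simp
      finally have "K1 ^ n * real_of_int M ^ n \<le> (4 * real (card U')) * real_of_int M ^ n"
        by (simp add: power_mult_distrib mult.commute mult.left_commute)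
      then have "K1 ^ n \<le> 4 * real (card U')" using M(3) by (simp add: mult_le_cancel_right)
      then show ?thesis by (simp add: V_def card_image[OF inj])
    qed
    moreover have "K ^ n \<le> K1 ^ n / 4" using elim(3) K K1 by (simp add: power_divide divide_less_eq)
    ultimately have cardV: "K ^ n \<le> real (card V)" by linarith
    have pair: "real_of_int (sqdist n (dv x) (dv y)) \<le> 4 * c * real n \<and> even (sqdist n (dv x) (dv y))"
      if xy: "x \<in> U'" "y \<in> U'" for x y
    proof
      have "(real_of_int M)\<^sup>2 * real_of_int (sqdist n (dv x) (dv y)) = (\<Sum>j<n. (real_of_int (M * (dv x j - dv y j)))\<^sup>2)"
        by (simp add: sqdist_def sum_distrib_left power_mult_distrib)
      also have "\<dots> = (\<Sum>j<n. (real_of_int (x j - y j))\<^sup>2)"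
        using diff[OF xy] by (intro sum.cong) auto
      also have "\<dots> \<le> (\<Sum>j<n. 2 * (real_of_int (x j))\<^sup>2 + 2 * (real_of_int (y j))\<^sup>2)"
      proof (rule sum_mono)
        fix j
        have "0 \<le> (real_of_int (x j) + real_of_int (y j))\<^sup>2" by simp
        then show "(real_of_int (x j - y j))\<^sup>2 \<le> 2 * (real_of_int (x j))\<^sup>2 + 2 * (real_of_int (y j))\<^sup>2"
          by (simp add: power2_sum power2_diff)
      qed
      also have "\<dots> = 2 * (\<Sum>j<n. (real_of_int (x j))\<^sup>2) + 2 * (\<Sum>j<n. (real_of_int (y j))\<^sup>2)"
        by (simp add: sum.distrib sum_distrib_left)
      also have "\<dots> \<le> 4 * (real n * (E + \<delta>))" using xy by (simp add: U'_def U_def)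
      also have "\<dots> \<le> 4 * (real n * (c * (real_of_int M)\<^sup>2))" using \<delta>(2) by (intro mult_left_mono) auto
      also have "\<dots> = (real_of_int M)\<^sup>2 * (4 * c * real n)" by simp
      finally show "real_of_int (sqdist n (dv x) (dv y)) \<le> 4 * c * real n" using M(3) by simp
      have "(\<Sum>j<n. x j div M) mod 2 = (\<Sum>j<n. y j div M) mod 2"
        using xy by (auto simp: U'_def cl_def)
      then have "even ((\<Sum>j<n. x j div M) - (\<Sum>j<n. y j div M))" by (simp add: mod_eq_dvd_iff)
      also have "(\<Sum>j<n. x j div M) - (\<Sum>j<n. y j div M) = (\<Sum>j<n. dv x j - dv y j)"
        by (simp add: dv_def sum_subtractf)
      finally have ev: "even (\<Sum>j<n. dv x j - dv y j)" .
      have "even (\<Sum>j<n. (dv x j - dv y j)\<^sup>2 - (dv x j - dv y j))"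
        by (intro dvd_sum) simp
      then show "even (sqdist n (dv x) (dv y))" using ev by (simp add: sqdist_def sum_subtractf)
    qed
    show ?case
    proof (intro exI[of _ V] conjI)
      show "finite V" unfolding V_def U'_def using finU by simp
      show "V \<subseteq> {..<n} \<rightarrow>\<^sub>E UNIV" unfolding V_def dv_def
        by (intro image_subsetI) (simp add: PiE_iff)
      show "K ^ n \<le> real (card V)" by (rule cardV)
      show "\<forall>x\<in>V. \<forall>y\<in>V. real_of_int (sqdist n x y) \<le> 4 * c * real n \<and> even (sqdist n x y)"
        unfolding V_def using pair by blast
    qed
  qed
qed

section \<open>Polynomials and the rank condition\<close>

definition monom_exps :: "nat \<Rightarrow> nat \<Rightarrow> (nat \<Rightarrow> nat) set" where
  "monom_exps n d = {e \<in> {..<n} \<rightarrow>\<^sub>E {..d}. (\<Sum>i<n. e i) \<le> d}"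

lemma finite_monom_exps: "finite (monom_exps n d)"
  unfolding monom_exps_def by (rule finite_subset[OF _ finite_PiE[of "{..<n}" "\<lambda>_. {..d}"]]) auto

text \<open>Rankin's trick: \<open>t ^ d\<close> is at most the weight \<open>t\<close> to the power
  of the total degree, and summing these weights over all exponents gives a product of geometric
  series.\<close>

lemma card_monom_exps_le:
  fixes t :: real
  assumes t: "0 < t" "t < 1"
  shows "real (card (monom_exps n d)) * t ^ d \<le> (1 / (1 - t)) ^ n"
proof -
  have "real (card (monom_exps n d)) * t ^ d = (\<Sum>e\<in>monom_exps n d. t ^ d)" by simp
  also have "\<dots> \<le> (\<Sum>e\<in>monom_exps n d. \<Prod>i<n. t ^ e i)"
    using t by (intro sum_mono) (auto simp: monom_exps_def power_sum[symmetric] intro!: power_decreasing)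
  also have "\<dots> \<le> (\<Sum>e\<in>{..<n} \<rightarrow>\<^sub>E {..d}. \<Prod>i<n. t ^ e i)"
    using t by (intro sum_mono2 finite_PiE prod_nonneg) (auto simp: monom_exps_def)
  also have "\<dots> = (\<Prod>i<n. \<Sum>j\<le>d. t ^ j)" by (rule prod_sum_PiE[symmetric]) auto
  also have "\<dots> \<le> (1 / (1 - t)) ^ n"
  proof -
    have "(\<Sum>j\<le>d. t ^ j) \<le> 1 / (1 - t)"
    proof -
      have "(1 - t) * (\<Sum>j\<le>d. t ^ j) = 1 - t ^ Suc d" by (rule sum_gp_basic)
      also have "\<dots> \<le> 1" using t by simp
      finally show ?thesis using t by (simp add: pos_le_divide_eq mult.commute)
    qed
    moreover have "0 \<le> (\<Sum>j\<le>d. t ^ j)" using t by (intro sum_nonneg) auto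
    ultimately show ?thesis by (simp add: power_mono)
  qed
  finally show ?thesis .
qed

text \<open>The coordinates \<open>\<xi>\<close> are arbitrary functions on the points, so that
  functions of the points themselves, such as the squared norm, can serve as variables.\<close>

definition poly_funs :: "(nat \<Rightarrow> 'p \<Rightarrow> int) \<Rightarrow> nat \<Rightarrow> nat \<Rightarrow> ('p \<Rightarrow> int) set" where
  "poly_funs \<xi> n d = {g. \<exists>u. g = (\<lambda>x. \<Sum>e\<in>monom_exps n d. u e * (\<Prod>i<n. \<xi> i x ^ e i))}"

lemma poly_funs_add:
  assumes "f \<in> poly_funs \<xi> n d" and "g \<in> poly_funs \<xi> n d"
  shows "(\<lambda>x. f x + g x) \<in> poly_funs \<xi> n d"
proof -
  from assms obtain u v where "f = (\<lambda>x. \<Sum>e\<in>monom_exps n d. u e * (\<Prod>i<n. \<xi> i x ^ e i))"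
    "g = (\<lambda>x. \<Sum>e\<in>monom_exps n d. v e * (\<Prod>i<n. \<xi> i x ^ e i))" unfolding poly_funs_def by blast
  then show ?thesis unfolding poly_funs_def
    by (intro CollectI exI[of _ "\<lambda>e. u e + v e"]) (simp add: algebra_simps sum.distrib)
qed

lemma poly_funs_scale:
  assumes "f \<in> poly_funs \<xi> n d"
  shows "(\<lambda>x. c * f x) \<in> poly_funs \<xi> n d"
proof -
  from assms obtain u where "f = (\<lambda>x. \<Sum>e\<in>monom_exps n d. u e * (\<Prod>i<n. \<xi> i x ^ e i))"
    unfolding poly_funs_def by blast
  then show ?thesis unfolding poly_funs_def
    by (intro CollectI exI[of _ "\<lambda>e. c * u e"]) (simp add: sum_distrib_left ac_simps)
qed

lemma poly_funs_monom:
  assumes "e \<in> monom_exps n d"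
  shows "(\<lambda>x. \<Prod>i<n. \<xi> i x ^ e i) \<in> poly_funs \<xi> n d"
proof -
  have "(\<Prod>i<n. \<xi> i x ^ e i) = (\<Sum>e'\<in>monom_exps n d. of_bool (e' = e) * (\<Prod>i<n. \<xi> i x ^ e' i))" for x
  proof -
    have "(\<Sum>e'\<in>monom_exps n d. of_bool (e' = e) * (\<Prod>i<n. \<xi> i x ^ e' i))
        = (\<Sum>e'\<in>monom_exps n d. if e' = e then \<Prod>i<n. \<xi> i x ^ e' i else 0)"
      by (rule sum.cong) auto
    then show ?thesis using assms by (simp add: sum.delta[OF finite_monom_exps])
  qed
  then show ?thesis unfolding poly_funs_def by (intro CollectI exI[of _ "\<lambda>e'. of_bool (e' = e)"] ext)
qed

lemma poly_funs_zero: "(\<lambda>_. 0) \<in> poly_funs \<xi> n d"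
  unfolding poly_funs_def by (intro CollectI exI[of _ "\<lambda>_. 0"]) simp

lemma poly_funs_sum:
  assumes "finite S" and "\<And>s. s \<in> S \<Longrightarrow> f s \<in> poly_funs \<xi> n d"
  shows "(\<lambda>x. \<Sum>s\<in>S. f s x) \<in> poly_funs \<xi> n d"
  using assms by (induction S rule: finite_induct) (simp_all add: poly_funs_zero poly_funs_add)

lemma poly_funs_mono:
  assumes "f \<in> poly_funs \<xi> n d" and "d \<le> d'"
  shows "f \<in> poly_funs \<xi> n d'"
proof -
  from assms(1) obtain u where f: "f = (\<lambda>x. \<Sum>e\<in>monom_exps n d. u e * (\<Prod>i<n. \<xi> i x ^ e i))"
    unfolding poly_funs_def by blast
  have "monom_exps n d \<subseteq> monom_exps n d'"
    using assms(2) unfolding monom_exps_def PiE_iff by (auto intro: order_trans)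
  then show ?thesis unfolding f
    by (intro poly_funs_sum finite_monom_exps poly_funs_scale poly_funs_monom) auto
qed

lemma poly_funs_const: "(\<lambda>_. c) \<in> poly_funs \<xi> n d"
proof -
  have "(\<lambda>i\<in>{..<n}. 0) \<in> monom_exps n 0" by (auto simp: monom_exps_def)
  from poly_funs_monom[OF this, of \<xi>] have "(\<lambda>_. 1) \<in> poly_funs \<xi> n 0" by simp
  from poly_funs_scale[OF poly_funs_mono[OF this], of d c] show ?thesis by simp
qed

lemma poly_funs_mult_var:
  assumes "f \<in> poly_funs \<xi> n d" and i: "i < n"
  shows "(\<lambda>x. \<xi> i x * f x) \<in> poly_funs \<xi> n (Suc d)"
proof -
  from assms(1) obtain u where f: "f = (\<lambda>x. \<Sum>e\<in>monom_exps n d. u e * (\<Prod>i<n. \<xi> i x ^ e i))"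
    unfolding poly_funs_def by blast
  have up: "e(i := Suc (e i)) \<in> monom_exps n (Suc d)" if e: "e \<in> monom_exps n d" for e
  proof -
    have sum: "(\<Sum>j<n. (e(i := Suc (e i))) j) = Suc (\<Sum>j<n. e j)"
      using i by (simp add: sum.remove[of _ i])
    moreover have "e j \<le> d" if "j < n" for j using e that by (auto simp: monom_exps_def PiE_iff)
    ultimately show ?thesis
      using e i by (auto simp: monom_exps_def PiE_iff extensional_def intro: le_SucI)
  qed
  have mult: "\<xi> i x * (\<Prod>j<n. \<xi> j x ^ e j) = (\<Prod>j<n. \<xi> j x ^ (e(i := Suc (e i))) j)" for e x
    using i by (simp add: prod.remove[of _ i])
  have "(\<lambda>x. \<xi> i x * f x) = (\<lambda>x. \<Sum>e\<in>monom_exps n d. u e * (\<Prod>j<n. \<xi> j x ^ (e(i := Suc (e i))) j))"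
    unfolding f mult[symmetric] by (simp add: sum_distrib_left ac_simps)
  then show ?thesis
    by (simp only:) (intro poly_funs_sum finite_monom_exps poly_funs_scale poly_funs_monom up)
qed

lemma poly_funs_mult_affine:
  assumes f: "f \<in> poly_funs \<xi> n d"
  shows "(\<lambda>x. (c + (\<Sum>i<n. a i * \<xi> i x)) * f x) \<in> poly_funs \<xi> n (Suc d)"
proof -
  have "(\<lambda>x. c * f x + (\<Sum>i<n. a i * (\<xi> i x * f x))) \<in> poly_funs \<xi> n (Suc d)"
    by (intro poly_funs_add poly_funs_sum poly_funs_scale poly_funs_mult_var f poly_funs_mono[OF f]) auto
  moreover have "(\<lambda>x. c * f x + (\<Sum>i<n. a i * (\<xi> i x * f x)))
      = (\<lambda>x. (c + (\<Sum>i<n. a i * \<xi> i x)) * f x)"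
    by (simp add: algebra_simps sum_distrib_left)
  ultimately show ?thesis by simp
qed

lemma poly_funs_mult_affine_power:
  assumes f: "f \<in> poly_funs \<xi> n d"
  shows "(\<lambda>x. (c + (\<Sum>i<n. a i * \<xi> i x)) ^ k * f x) \<in> poly_funs \<xi> n (d + k)"
proof (induction k)
  case (Suc k)
  from poly_funs_mult_affine[OF this, of c a] show ?case by (simp add: mult.assoc)
qed (use f in simp)

section \<open>Indicators of divisibility as polynomial functions\<close>

definition lattice_coord :: "nat \<Rightarrow> nat \<Rightarrow> (nat \<Rightarrow> int) \<Rightarrow> int" where
  "lattice_coord n i x = (if i < n then x i else \<Sum>j<n. (x j)\<^sup>2)"

text \<open>
  Treating \<open>|x|\<^sup>2\<close> as an additional variable makes the squared distance to a fixed point affine,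
  so that its power has degree \<open>p - 1\<close> and not \<open>2 (p - 1)\<close>.
\<close>

lemma sqdist_affine:
  "sqdist n x y = (\<Sum>i<n. (y i)\<^sup>2) + (\<Sum>i<Suc n. (if i < n then - 2 * y i else 1) * lattice_coord n i x)"
  by (simp add: sqdist_def lattice_coord_def power2_diff sum.distrib sum_subtractf sum_negf algebra_simps)

lemma power_prime_cong:
  fixes a :: int
  assumes p: "prime p"
  shows "[a ^ p = a] (mod int p)"
proof -
  have nat: "[int k ^ p = int k] (mod int p)" for k
  proof (induction k)
    case 0
    then show ?case using prime_gt_0_nat[OF p] by (simp add: zero_power)
  next
    case (Suc k)
    have p1: "p > 1" using p by (rule prime_gt_1_nat)
    have "int (Suc k) ^ p = (\<Sum>j\<le>p. int (p choose j) * int k ^ j)"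
      using binomial_ring[of "int k" 1 p] by (simp add: add.commute)
    also have "{..p} = insert 0 (insert p {0<..<p})" using p1 by auto
    also have "(\<Sum>j\<in>insert 0 (insert p {0<..<p}). int (p choose j) * int k ^ j)
        = 1 + (int k ^ p + (\<Sum>j\<in>{0<..<p}. int (p choose j) * int k ^ j))"
      using p1 by simp
    also have "[\<dots> = 1 + (int k + 0)] (mod int p)"
    proof (intro cong_add cong_refl Suc)
      have "int p dvd int (p choose j) * int k ^ j" if "j \<in> {0<..<p}" for j
        using that p by (intro dvd_mult2) (simp add: dvd_choose_prime)
      then show "[(\<Sum>j\<in>{0<..<p}. int (p choose j) * int k ^ j) = 0] (mod int p)"
        unfolding cong_0_iff by (intro dvd_sum)
    qed
    finally show ?case by simp
  qed
  have "[a = int (nat (a mod int p))] (mod int p)" using prime_gt_0_nat[OF p] by (simp add: cong_def)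
  then show ?thesis using nat[of "nat (a mod int p)"] by (meson cong_pow cong_sym cong_trans)
qed

text \<open>Including a further point in \<open>Y\<close> replaces a function \<open>f\<close> by
  \<open>f - d ^ (p - 1) * f\<close> with \<open>d\<close> affine, which raises the degree by
  \<open>p - 1\<close>. The squared norm is one of the \<open>Suc n\<close> variables.\<close>

lemma nbhd_rank_le_sqdist:
  fixes p :: nat and I :: "(nat \<Rightarrow> int) set"
  assumes p: "prime p" and I: "finite I"
  shows "nbhd_rank_le (int p) I (\<lambda>x y. int p dvd sqdist n x y) l (card (monom_exps (Suc n) (l * (p - 1))))"
proof -
  let ?\<xi> = "lattice_coord n" and ?d = "l * (p - 1)"
  let ?mon = "\<lambda>e x. \<Prod>i<Suc n. ?\<xi> i x ^ e i"
  have fermat: "[1 - a ^ (p - 1) = of_bool (int p dvd a)] (mod int p)" for a :: int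
  proof (cases "int p dvd a")
    case True
    have "p - 1 > 0" using prime_gt_1_nat[OF p] by simp
    then have "int p dvd a ^ (p - 1)" using dvd_trans[OF True dvd_power[of "p - 1" a]] by blast
    then show ?thesis using True by (simp add: cong_iff_dvd_diff)
  next
    case False
    have "a ^ p = a * a ^ (p - 1)" using prime_gt_0_nat[OF p] by (simp add: power_eq_if)
    then have "int p dvd a * (1 - a ^ (p - 1))"
      using power_prime_cong[OF p, of a] by (simp add: cong_iff_dvd_diff dvd_diff_commute right_diff_distrib)
    then show ?thesis using False p by (simp add: prime_dvd_mult_iff cong_0_iff)
  qed
  have span: "(\<lambda>x. \<Prod>y\<in>Y. 1 - sqdist n x y ^ (p - 1)) \<in> poly_funs ?\<xi> (Suc n) (card Y * (p - 1))"
    if "finite Y" for Y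
    using that
  proof (induction Y rule: finite_induct)
    case empty
    show ?case using poly_funs_const[of 1] by simp
  next
    case (insert y Y)
    let ?f = "\<lambda>x. \<Prod>y\<in>Y. 1 - sqdist n x y ^ (p - 1)"
    have "(\<lambda>x. ?f x + (- 1) * (sqdist n x y ^ (p - 1) * ?f x)) \<in> poly_funs ?\<xi> (Suc n) (card Y * (p - 1) + (p - 1))"
      unfolding sqdist_affine[of n _ y]
      by (intro poly_funs_add poly_funs_scale poly_funs_mult_affine_power insert.IH poly_funs_mono[OF insert.IH]) simp
    moreover have "card Y * (p - 1) + (p - 1) = card (insert y Y) * (p - 1)"
      using insert.hyps by simp
    moreover have "(\<lambda>x. ?f x + (- 1) * (sqdist n x y ^ (p - 1) * ?f x))
        = (\<lambda>x. \<Prod>y\<in>insert y Y. 1 - sqdist n x y ^ (p - 1))"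
      using insert.hyps by (simp add: left_diff_distrib)
    ultimately show ?case by (simp only:)
  qed
  obtain b where b: "bij_betw b {..<card (monom_exps (Suc n) ?d)} (monom_exps (Suc n) ?d)"
    using ex_bij_betw_nat_finite[OF finite_monom_exps] by (auto simp: atLeast0LessThan)
  show ?thesis
    unfolding nbhd_rank_le_def
  proof (intro exI[of _ "\<lambda>j. ?mon (b j)"] allI impI)
    fix Y assume Y: "Y \<subseteq> I" "card Y \<le> l"
    have finY: "finite Y" using Y I finite_subset by blast
    have "(\<lambda>x. \<Prod>y\<in>Y. 1 - sqdist n x y ^ (p - 1)) \<in> poly_funs ?\<xi> (Suc n) ?d"
      by (rule poly_funs_mono[OF span[OF finY]]) (use Y in simp)
    then obtain u where u: "(\<lambda>x. \<Prod>y\<in>Y. 1 - sqdist n x y ^ (p - 1)) = (\<lambda>x. \<Sum>e\<in>monom_exps (Suc n) ?d. u e * ?mon e x)"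
      unfolding poly_funs_def by blast
    have "[of_bool (\<forall>y\<in>Y. int p dvd sqdist n x y)
      = (\<Sum>j<card (monom_exps (Suc n) ?d). u (b j) * ?mon (b j) x)] (mod int p)" for x
    proof -
      have "of_bool (\<forall>y\<in>Y. int p dvd sqdist n x y) = (\<Prod>y\<in>Y. of_bool (int p dvd sqdist n x y) :: int)"
        using finY by (auto simp: of_bool_def intro!: prod.neutral)
      also have "[\<dots> = (\<Prod>y\<in>Y. 1 - sqdist n x y ^ (p - 1))] (mod int p)"
        by (rule cong_sym, rule cong_prod, rule fermat)
      also have "(\<Prod>y\<in>Y. 1 - sqdist n x y ^ (p - 1)) = (\<Sum>e\<in>monom_exps (Suc n) ?d. u e * ?mon e x)"
        using fun_cong[OF u, of x] .
      also have "\<dots> = (\<Sum>j<card (monom_exps (Suc n) ?d). u (b j) * ?mon (b j) x)"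
        by (rule sum.reindex_bij_betw[OF b, symmetric])
      finally show ?thesis .
    qed
    then have "\<forall>x\<in>I. [of_bool (\<forall>y\<in>Y. int p dvd sqdist n x y)
      = (\<Sum>j<card (monom_exps (Suc n) ?d). u (b j) * ?mon (b j) x)] (mod int p)" ..
    then show "\<exists>u. \<forall>x\<in>I. [of_bool (\<forall>y\<in>Y. int p dvd sqdist n x y)
      = (\<Sum>j<card (monom_exps (Suc n) ?d). u j * ?mon (b j) x)] (mod int p)"
      by (rule exI[of _ "\<lambda>j. u (b j)"])
  qed
qed

section \<open>Chebyshev, Mertens and Selberg\<close>

definition moebius_mu :: "nat \<Rightarrow> real" where
  "moebius_mu n = (if squarefree n then (- 1) ^ card (prime_factors n) else 0)"

lemma abs_moebius_mu_le: "\<bar>moebius_mu n\<bar> \<le> 1"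
  by (simp add: moebius_mu_def power_abs)

text \<open>For a prime \<open>p\<close> dividing \<open>n\<close>, multiplication by
  \<open>p\<close> matches the squarefree divisors prime to \<open>p\<close> with the other
  squarefree divisors and reverses the sign.\<close>

lemma sum_moebius_dvd:
  assumes "n > 0"
  shows "(\<Sum>d | d dvd n. moebius_mu d) = of_bool (n = 1)"
proof (cases "n = 1")
  case True
  then have "{d. d dvd n} = {1}" by auto
  then show ?thesis using True by (simp add: moebius_mu_def)
next
  case False
  then obtain p where p: "prime p" "p dvd n" using prime_factor_nat by blast
  define A where "A = {d. d dvd n \<and> squarefree d \<and> \<not> p dvd d}"
  define B where "B = {d. d dvd n \<and> squarefree d \<and> p dvd d}"
  have fin: "finite {d. d dvd n}" using assms by simp
  have finAB: "finite A" "finite B" unfolding A_def B_def by (rule finite_subset[OF _ fin]; auto)+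
  have sq: "squarefree (p * d) \<and> moebius_mu (p * d) = - moebius_mu d" if "squarefree d" "\<not> p dvd d" for d
  proof -
    have "d > 0" using that(1) by (cases d) auto
    have cop: "coprime p d" using p(1) that(2) by (rule prime_imp_coprime)
    then have "squarefree (p * d)"
      using that(1) squarefree_prime[OF p(1)] by (intro squarefree_mult_coprime)
    moreover have "prime_factors (p * d) = insert p (prime_factors d)"
      using p(1) that \<open>d > 0\<close> prime_gt_0_nat[OF p(1)]
      by (subst prime_factors_product) (auto simp: prime_prime_factors)
    moreover have "p \<notin> prime_factors d" using that(2) by auto
    ultimately show ?thesis using that(1) by (simp add: moebius_mu_def)
  qed
  have B: "B = (*) p ` A"
  proof
    show "B \<subseteq> (*) p ` A"
    proof
      fix b assume b: "b \<in> B"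
      then obtain e where e: "b = p * e" unfolding B_def by (auto elim: dvdE)
      have "squarefree (p * e)" "p * e dvd n" using b e by (auto simp: B_def)
      moreover have "\<not> p dvd e"
      proof
        assume "p dvd e"
        then have "p ^ 2 dvd p * e" by (simp add: power2_eq_square)
        then show False using \<open>squarefree (p * e)\<close> p(1) squarefreeD not_prime_unit by blast
      qed
      ultimately have "e \<in> A"
        unfolding A_def using squarefree_mono[of e "p * e"] dvd_mult_right by auto
      then show "b \<in> (*) p ` A" using e by blast
    qed
    show "(*) p ` A \<subseteq> B"
    proof
      fix b assume "b \<in> (*) p ` A"
      then obtain d where d: "b = p * d" "d dvd n" "squarefree d" "\<not> p dvd d" by (auto simp: A_def)
      have "coprime p d" using p(1) d(4) by (rule prime_imp_coprime)
      then have "p * d dvd n" using p(2) d(2) by (intro divides_mult)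
      then show "b \<in> B" using sq d by (simp add: B_def)
    qed
  qed
  have "(\<Sum>d | d dvd n. moebius_mu d) = (\<Sum>d\<in>A \<union> B. moebius_mu d)"
    using fin by (intro sum.mono_neutral_right) (auto simp: A_def B_def moebius_mu_def)
  also have "\<dots> = (\<Sum>d\<in>A. moebius_mu d) + (\<Sum>d\<in>B. moebius_mu d)"
    using finAB by (intro sum.union_disjoint) (auto simp: A_def B_def)
  also have "(\<Sum>d\<in>B. moebius_mu d) = (\<Sum>d\<in>A. moebius_mu (p * d))"
    unfolding B using p(1) prime_gt_0_nat by (subst sum.reindex) (auto intro: inj_onI)
  also have "\<dots> = (\<Sum>d\<in>A. - moebius_mu d)" using sq by (intro sum.cong) (auto simp: A_def)
  finally show ?thesis using False by (simp add: sum_negf)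
qed

lemma sum_dvd_eq_sum_sum:
  fixes f :: "nat \<Rightarrow> nat \<Rightarrow> 'a :: comm_monoid_add"
  shows "(\<Sum>k=1..N. \<Sum>d | d dvd k. f d (k div d)) = (\<Sum>d=1..N. \<Sum>e=1..N div d. f d e)"
proof -
  have *: "d \<le> N" if "d * k \<le> N" "0 < k" for d k
    using that by (cases k) auto
  have "(\<Sum>k=1..N. \<Sum>d | d dvd k. f d (k div d))
      = (\<Sum>(k, d)\<in>Sigma {1..N} (\<lambda>k. {d. d dvd k}). f d (k div d))"
    by (rule sum.Sigma) auto
  also have "\<dots> = (\<Sum>(d, e)\<in>Sigma {1..N} (\<lambda>d. {1..N div d}). f d e)"
    by (rule sum.reindex_bij_witness[of _ "\<lambda>(d, e). (d * e, d)" "\<lambda>(k, d). (d, k div d)"])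
      (auto simp: less_eq_div_iff_mult_less_eq mult.commute Suc_le_eq
        intro: * elim!: dvdE)
  also have "\<dots> = (\<Sum>d=1..N. \<Sum>e=1..N div d. f d e)" by (rule sum.Sigma[symmetric]) auto
  finally show ?thesis .
qed

lemma sum_sum_div_commute:
  fixes f :: "nat \<Rightarrow> nat \<Rightarrow> 'a :: comm_monoid_add"
  shows "(\<Sum>d=1..N. \<Sum>e=1..N div d. f d e) = (\<Sum>e=1..N. \<Sum>d=1..N div e. f d e)"
proof -
  have "(\<Sum>d=1..N. \<Sum>e=1..N div d. f d e) = (\<Sum>(d, e)\<in>Sigma {1..N} (\<lambda>d. {1..N div d}). f d e)"
    by (rule sum.Sigma) auto
  also have "\<dots> = (\<Sum>(e, d)\<in>Sigma {1..N} (\<lambda>e. {1..N div e}). f d e)"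
  proof (rule sum.reindex_bij_witness[of _ prod.swap prod.swap])
    have *: "d * e \<le> N \<Longrightarrow> 0 < d \<Longrightarrow> e \<le> N" for d e :: nat
      by (metis dual_order.trans mult_le_mono1 nat_mult_1 Suc_leI One_nat_def)
    show "prod.swap a \<in> Sigma {1..N} (\<lambda>e. {1..N div e})" if "a \<in> Sigma {1..N} (\<lambda>d. {1..N div d})" for a
      using that * by (auto simp: less_eq_div_iff_mult_less_eq mult.commute Suc_le_eq)
    show "prod.swap a \<in> Sigma {1..N} (\<lambda>e. {1..N div e})" if "a \<in> Sigma {1..N} (\<lambda>d. {1..N div d})" for a
      using that * by (auto simp: less_eq_div_iff_mult_less_eq mult.commute Suc_le_eq)
  qed auto
  also have "\<dots> = (\<Sum>e=1..N. \<Sum>d=1..N div e. f d e)" by (rule sum.Sigma[symmetric]) auto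
  finally show ?thesis .
qed

abbreviation \<Lambda> :: "nat \<Rightarrow> real" where "\<Lambda> \<equiv> mangoldt"

text \<open>Moebius inversion of \<open>ln = \<Sum> \<Lambda>\<close>: after
  \<open>ln (n / d)\<close> is expanded over divisors \<open>e\<close> of \<open>n div d\<close>,
  the inner Moebius sum retains only \<open>e = n\<close>.\<close>

lemma sum_moebius_ln:
  assumes "n > 0"
  shows "(\<Sum>d | d dvd n. moebius_mu d * ln (real n / real d)) = \<Lambda> n"
proof -
  have fin: "finite {d. d dvd k}" if "k > 0" for k :: nat using that by simp
  have pos: "d > 0" if "d dvd n" for d using that assms by (auto intro: Nat.gr0I)
  have "(\<Sum>d | d dvd n. moebius_mu d * ln (real n / real d))
      = (\<Sum>d | d dvd n. \<Sum>e | e dvd n div d. moebius_mu d * \<Lambda> e)"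
  proof (rule sum.cong[OF refl])
    fix d assume "d \<in> {d. d dvd n}"
    then have d: "d dvd n" by simp
    have "n div d \<noteq> 0" using d assms pos[OF d] by (auto elim!: dvdE)
    then have "ln (real (n div d)) = (\<Sum>e | e dvd n div d. \<Lambda> e)"
      using mangoldt_sum[of "n div d", where ?'a = real] by simp
    moreover have "real (n div d) = real n / real d" using d by (simp add: real_of_nat_div)
    ultimately show "moebius_mu d * ln (real n / real d) = (\<Sum>e | e dvd n div d. moebius_mu d * \<Lambda> e)"
      by (simp add: sum_distrib_left)
  qed
  also have "\<dots> = (\<Sum>(d, e)\<in>Sigma {d. d dvd n} (\<lambda>d. {e. e dvd n div d}). moebius_mu d * \<Lambda> e)"
    using assms pos by (intro sum.Sigma) (auto simp: div_greater_zero_iff dvd_imp_le)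
  also have "\<dots> = (\<Sum>(e, d)\<in>Sigma {e. e dvd n} (\<lambda>e. {d. d dvd n div e}). moebius_mu d * \<Lambda> e)"
  proof (rule sum.reindex_bij_witness[of _ prod.swap prod.swap])
    have *: "d dvd n \<and> e dvd n div d \<longleftrightarrow> e dvd n \<and> d dvd n div e" for d e
    proof -
      have "d dvd n \<and> e dvd n div d \<longleftrightarrow> d * e dvd n" for d e
        using assms by (metis dvd_div_iff_mult dvd_mult_left dvd_0_left_iff mult.commute neq0_conv)
      then show ?thesis by (metis mult.commute)
    qed
    show "prod.swap a \<in> Sigma {e. e dvd n} (\<lambda>e. {d. d dvd n div e})"
      if "a \<in> Sigma {e. e dvd n} (\<lambda>e. {d. d dvd n div e})" for a
      using that * by auto
    show "prod.swap a \<in> Sigma {e. e dvd n} (\<lambda>e. {d. d dvd n div e})"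
      if "a \<in> Sigma {e. e dvd n} (\<lambda>e. {d. d dvd n div e})" for a
      using that * by auto
  qed auto
  also have "\<dots> = (\<Sum>e | e dvd n. \<Sum>d | d dvd n div e. moebius_mu d * \<Lambda> e)"
    using assms pos by (intro sum.Sigma[symmetric]) (auto simp: div_greater_zero_iff dvd_imp_le)
  also have "\<dots> = (\<Sum>e | e dvd n. if e = n then \<Lambda> n else 0)"
  proof (rule sum.cong[OF refl])
    fix e assume "e \<in> {e. e dvd n}"
    then have e: "e dvd n" by simp
    then have "n div e > 0" using assms by (auto simp: div_greater_zero_iff dvd_imp_le pos)
    moreover have "n div e = 1 \<longleftrightarrow> e = n" using e assms by (auto elim!: dvdE)
    ultimately show "(\<Sum>d | d dvd n div e. moebius_mu d * \<Lambda> e) = (if e = n then \<Lambda> n else 0)"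
      by (simp add: sum_distrib_right[symmetric] sum_moebius_dvd)
  qed
  also have "\<dots> = \<Lambda> n" using assms by (simp add: sum.delta)
  finally show ?thesis .
qed

section \<open>Chebyshev's upper bound\<close>

definition chebyshev_psi :: "nat \<Rightarrow> real" where "chebyshev_psi N = (\<Sum>n=1..N. \<Lambda> n)"

abbreviation \<psi> :: "nat \<Rightarrow> real" where "\<psi> \<equiv> chebyshev_psi"

lemma psi_Suc: "\<psi> (Suc N) = \<psi> N + \<Lambda> (Suc N)" by (simp add: chebyshev_psi_def)

lemma psi_nonneg: "0 \<le> \<psi> N" by (simp add: chebyshev_psi_def sum_nonneg mangoldt_nonneg)

lemma psi_mono: "M \<le> N \<Longrightarrow> \<psi> M \<le> \<psi> N"
  unfolding chebyshev_psi_def by (rule sum_mono2) (auto simp: mangoldt_nonneg)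

lemma sum_mangoldt_div: "(\<Sum>d=1..N. \<Lambda> d * real (N div d)) = ln (fact N)"
proof -
  have "(\<Sum>d=1..N. \<Lambda> d * real (N div d)) = (\<Sum>d=1..N. \<Sum>e=1..N div d. \<Lambda> d)" by (simp add: mult.commute)
  also have "\<dots> = (\<Sum>k=1..N. \<Sum>d | d dvd k. \<Lambda> d)" by (rule sum_dvd_eq_sum_sum[symmetric])
  also have "\<dots> = (\<Sum>k=1..N. ln (real k))"
  proof (rule sum.cong[OF refl])
    fix k assume "k \<in> {1..N}"
    then show "(\<Sum>d | d dvd k. \<Lambda> d) = ln (real k)" using mangoldt_sum[of k, where ?'a = real] by simp
  qed
  also have "\<dots> = ln (fact N)"
    unfolding fact_prod by (subst ln_prod[symmetric]) auto
  finally show ?thesis .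
qed

lemma sum_psi_div: "(\<Sum>d=1..N. \<psi> (N div d)) = ln (fact N)"
proof -
  have "(\<Sum>d=1..N. \<psi> (N div d)) = (\<Sum>e=1..N. \<Sum>d=1..N div e. \<Lambda> e)"
    unfolding chebyshev_psi_def by (rule sum_sum_div_commute)
  then show ?thesis using sum_mangoldt_div by (simp add: mult.commute)
qed

text \<open>The integer \<open>2 * n div d - 2 * (n div d)\<close> is never negative and is at least
  1 for \<open>n < d \<le> 2 * n\<close>. Weighted with \<open>\<Lambda>\<close> it sums to the
  logarithm of the central binomial coefficient.\<close>

lemma psi_double_le: "\<psi> (2 * n) - \<psi> n \<le> 2 * real n * ln 2"
proof -
  have ext: "(\<Sum>d=1..n. \<Lambda> d * real (n div d)) = (\<Sum>d=1..2 * n. \<Lambda> d * real (n div d))"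
    by (rule sum.mono_neutral_left) auto
  have "\<psi> (2 * n) - \<psi> n = (\<Sum>d\<in>{n<..2 * n}. \<Lambda> d)"
  proof -
    have "{1..2 * n} = {1..n} \<union> {n<..2 * n}" by auto
    moreover have "sum \<Lambda> ({1..n} \<union> {n<..2 * n}) = sum \<Lambda> {1..n} + sum \<Lambda> {n<..2 * n}"
      by (rule sum.union_disjoint) auto
    ultimately show ?thesis unfolding chebyshev_psi_def by simp
  qed
  also have "\<dots> \<le> (\<Sum>d\<in>{n<..2 * n}. \<Lambda> d * (real (2 * n div d) - 2 * real (n div d)))"
  proof (rule sum_mono)
    fix d assume d: "d \<in> {n<..2 * n}"
    then have "1 \<le> 2 * n div d" by (simp add: less_eq_div_iff_mult_less_eq)
    moreover have "n div d = 0" using d by simp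
    ultimately have "1 \<le> real (2 * n div d) - 2 * real (n div d)" by simp
    from mult_left_mono[OF this mangoldt_nonneg[of d]]
    show "\<Lambda> d \<le> \<Lambda> d * (real (2 * n div d) - 2 * real (n div d))" by simp
  qed
  also have "\<dots> \<le> (\<Sum>d=1..2 * n. \<Lambda> d * (real (2 * n div d) - 2 * real (n div d)))"
  proof (rule sum_mono2)
    fix d
    have "2 * (n div d) \<le> 2 * n div d"
    proof (cases "d = 0")
      case False
      have "2 * (n div d) * d \<le> 2 * n"
        using div_times_less_eq_dividend[of n d] by simp
      then show ?thesis using False by (simp add: less_eq_div_iff_mult_less_eq)
    qed simp
    then have "2 * real (n div d) \<le> real (2 * n div d)" by (metis of_nat_le_iff of_nat_mult of_nat_numeral)
    then show "0 \<le> \<Lambda> d * (real (2 * n div d) - 2 * real (n div d))" by (simp add: mangoldt_nonneg)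
  qed auto
  also have "\<dots> = ln (fact (2 * n)) - 2 * ln (fact n)"
  proof -
    have "(\<Sum>d=1..2 * n. \<Lambda> d * (real (2 * n div d) - 2 * real (n div d)))
        = (\<Sum>d=1..2 * n. \<Lambda> d * real (2 * n div d)) - 2 * (\<Sum>d=1..2 * n. \<Lambda> d * real (n div d))"
      by (simp add: right_diff_distrib sum_subtractf sum_distrib_left mult.left_commute)
    then show ?thesis unfolding sum_mangoldt_div ext[symmetric] .
  qed
  also have "\<dots> = ln (real (2 * n choose n))"
    by (simp add: binomial_fact ln_div ln_mult mult_2[symmetric])
  also have "\<dots> \<le> ln (2 ^ (2 * n))"
  proof -
    have "2 * n choose n \<le> 2 ^ (2 * n)" by (rule binomial_le_pow2)
    then have "real (2 * n choose n) \<le> real (2 ^ (2 * n))" by (rule of_nat_mono)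
    moreover have "0 < real (2 * n choose n)" by simp
    ultimately show ?thesis by (intro ln_mono) auto
  qed
  also have "\<dots> = 2 * real n * ln 2" by (simp add: ln_realpow)
  finally show ?thesis .
qed

lemma psi_le: "\<psi> n \<le> 6 * real n"
proof (induction n rule: less_induct)
  case (less n)
  consider "n = 0" | "n = 1" | "n \<ge> 2" by linarith
  then show ?case
  proof cases
    case 3
    \<comment> \<open>Half of \<open>n\<close>, rounded up, so that \<open>n \<le> 2 * m\<close>;
      the constant 6 works because \<open>8 * m \<le> 4 * n + 4 \<le> 6 * n\<close> for
      \<open>n \<ge> 2\<close>.\<close>
    define m where "m = (n + 1) div 2"
    have m: "m < n" "n \<le> 2 * m" "2 * real m \<le> real n + 1" using 3 by (auto simp: m_def)
    have "\<psi> n \<le> \<psi> (2 * m)" by (rule psi_mono) (fact m(2))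
    also have "\<dots> \<le> \<psi> m + 2 * real m * ln 2" using psi_double_le[of m] by simp
    also have "\<dots> \<le> 6 * real m + 2 * real m * 1"
      using less.IH[OF m(1)] ln_2_less_1 by (intro add_mono mult_left_mono) auto
    also have "\<dots> \<le> 6 * real n" using m(3) 3 by simp
    finally show ?thesis .
  qed (simp_all add: chebyshev_psi_def)
qed

section \<open>Logarithms, harmonic numbers and Mertens' theorem\<close>

lemma ln_Suc_diff_bounds:
  assumes "n > 0"
  shows "1 / (real n + 1) \<le> ln (real n + 1) - ln (real n)" "ln (real n + 1) - ln (real n) \<le> 1 / real n"
proof -
  have "ln (real n + 1) - ln (real n) = ln (1 + 1 / real n)"
  proof -
    have "1 + 1 / real n = (real n + 1) / real n" using assms by (simp add: field_simps)
    then show ?thesis using assms by (simp add: ln_div)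
  qed
  also have "\<dots> \<le> 1 / real n" by (rule ln_add_one_self_le_self) simp
  finally show "ln (real n + 1) - ln (real n) \<le> 1 / real n" .
  have "ln (real n) - ln (real n + 1) = ln (real n / (real n + 1))"
    using assms by (simp add: ln_div)
  also have "\<dots> \<le> real n / (real n + 1) - 1"
    using assms by (intro ln_le_minus_one) simp
  also have "\<dots> = - (1 / (real n + 1))" by (simp add: field_simps)
  finally show "1 / (real n + 1) \<le> ln (real n + 1) - ln (real n)" by simp
qed

lemma ln_fact_bounds:
  assumes "n > 0"
  shows "real n * ln (real n) - real n \<le> ln (fact n)"
    and "ln (fact n) \<le> real n * ln (real n) - real n + 1 + ln (real n)"
proof -
  have "real n * ln (real n) - real n \<le> ln (fact n) \<and> ln (fact n) \<le> real n * ln (real n) - real n + 1 + ln (real n)"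
    using assms
  proof (induction n rule: nat_induct_non_zero)
    case (Suc n)
    define L where "L = ln (real n + 1)"
    have f: "ln (fact (Suc n) :: real) = L + ln (fact n)"
      unfolding L_def by (simp add: ln_mult add.commute)
    have 1: "real n * (L - ln (real n)) \<le> 1" "1 \<le> (real n + 1) * (L - ln (real n))"
      using ln_Suc_diff_bounds[OF Suc.hyps] Suc.hyps unfolding L_def[symmetric]
      by (simp_all add: pos_divide_le_eq pos_le_divide_eq mult.commute add_pos_pos)
    have L': "ln (real (Suc n)) = L" by (simp add: L_def add.commute)
    show ?case unfolding f L' using Suc.IH 1 by (simp add: algebra_simps)
  qed simp
  then show "real n * ln (real n) - real n \<le> ln (fact n)"
    and "ln (fact n) \<le> real n * ln (real n) - real n + 1 + ln (real n)" by auto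
qed

lemma real_div_bounds:
  "real (N div d) \<le> real N / real d" "real N / real d < real (N div d) + 1"
  using floor_divide_of_nat_eq[where ?'a = real, of N d] by linarith+

text \<open>In Legendre's formula for \<open>ln (fact N)\<close>, replacing \<open>N div d\<close>
  by \<open>N / d\<close> costs at most \<open>\<psi> N\<close>, which is linear in \<open>N\<close>
  by Chebyshev's bound.\<close>

lemma mertens:
  assumes "N > 0"
  shows "\<bar>(\<Sum>d=1..N. \<Lambda> d / real d) - ln (real N)\<bar> \<le> 6"
proof -
  define M where "M = (\<Sum>d=1..N. \<Lambda> d / real d)"
  have N: "real N > 0" "ln (real N) \<ge> 0" using assms by auto
  have div: "real N / real d - 1 \<le> real (N div d)" "real (N div d) \<le> real N / real d" for d
    using real_div_bounds[of N d] by linarith+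
  have "ln (fact N) \<le> real N * M"
    unfolding sum_mangoldt_div[symmetric] M_def sum_distrib_left
  proof (rule sum_mono)
    fix d show "\<Lambda> d * real (N div d) \<le> real N * (\<Lambda> d / real d)"
      using mult_left_mono[OF div(2)[of d] mangoldt_nonneg[of d]] by (simp add: mult.commute)
  qed
  then have "real N * ln (real N) - real N \<le> real N * M" using ln_fact_bounds(1)[OF assms] by linarith
  then have "real N * (ln (real N) - 1) \<le> real N * M" by (simp add: algebra_simps)
  then have lower: "ln (real N) - 1 \<le> M" using N(1) mult_le_cancel_left_pos by blast
  have "real N * M - \<psi> N = (\<Sum>d=1..N. \<Lambda> d * (real N / real d - 1))"
    unfolding M_def chebyshev_psi_def by (simp add: sum_distrib_left sum_subtractf algebra_simps)
  also have "\<dots> \<le> ln (fact N)"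
    unfolding sum_mangoldt_div[symmetric] by (intro sum_mono mult_left_mono div mangoldt_nonneg)
  also have "\<dots> \<le> real N * ln (real N)"
  proof -
    have "fact N \<le> (real N) ^ N" using fact_le_power[of N, where ?'a = real] by simp
    then have "ln (fact N) \<le> ln (real N ^ N)" using N by (intro ln_mono) auto
    then show ?thesis using N by (simp add: ln_realpow)
  qed
  finally have "real N * M \<le> real N * (ln (real N) + 6)" using psi_le[of N] by (simp add: algebra_simps)
  then have "M \<le> ln (real N) + 6" using N(1) mult_le_cancel_left_pos by blast
  with lower show ?thesis unfolding M_def by linarith
qed

lemma harm_bounds:
  assumes "n > 0"
  shows "ln (real n) + euler_mascheroni \<le> (harm n :: real)"
    and "harm n \<le> ln (real n) + euler_mascheroni + 1 / real n"
proof -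
  have "ln (real (Suc n)) = ln (real n + 1)" by (simp add: add.commute)
  then have b: "harm n - ln (real n + 1) + inverse (real (2 * (n + 1))) \<le> euler_mascheroni"
    "euler_mascheroni \<le> harm n - ln (real n + 1) + inverse (real (2 * n))"
    using euler_mascheroni_bounds[of n] assms by (auto simp: add.commute)
  have "ln (real n + 1) \<le> ln (real n) + 1 / real n" using ln_Suc_diff_bounds(2)[OF assms] by linarith
  moreover have "inverse (real (2 * (n + 1))) \<ge> 0" by simp
  ultimately show "harm n \<le> ln (real n) + euler_mascheroni + 1 / real n" using b(1) by linarith
  have "inverse (real (2 * n)) \<le> 1 / (real n + 1)" using assms by (simp add: field_simps)
  then show "ln (real n) + euler_mascheroni \<le> (harm n :: real)"
    using b(2) ln_Suc_diff_bounds(1)[OF assms] by linarith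
qed

section \<open>Selberg's formula\<close>

lemma sum_inverse_sqrt_le: "(\<Sum>d=1..N. 1 / sqrt (real d)) \<le> 2 * sqrt (real N)"
proof (induction N)
  case (Suc N)
  define a b where "a = sqrt (real N)" and "b = sqrt (real (Suc N))"
  have ab: "b > 0" "a \<ge> 0" "a\<^sup>2 = real N" "b\<^sup>2 = real N + 1" by (auto simp: a_def b_def)
  have "2 * a * b \<le> a\<^sup>2 + b\<^sup>2" using sum_squares_bound[of a b] by simp
  then have "(2 * a + 1 / b) * b \<le> (2 * b) * b" using ab by (simp add: distrib_right power2_eq_square)
  then have "2 * a + 1 / b \<le> 2 * b" using ab(1) by (rule mult_right_le_imp_le)
  then show ?case using Suc by (simp add: a_def b_def)
qed simp

text \<open>Any power of \<open>y\<close> below 1 would serve: at \<open>y = N / d\<close> the sum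
  over \<open>d \<le> N\<close> must be linear in \<open>N\<close>, without a logarithm. The fourth
  root \<open>u\<close> bounds each logarithm by \<open>4 * u\<close>.\<close>

lemma ln_mult_le_sqrt:
  assumes "y \<ge> 1"
  shows "ln y * (4 + 2 * ln y) \<le> 48 * sqrt y"
proof -
  define u where "u = sqrt (sqrt y)"
  have u: "u \<ge> 1" "u\<^sup>2 = sqrt y" "u ^ 4 = y"
    using assms by (auto simp: u_def power4_eq_xxxx power2_eq_square[symmetric] mult.assoc)
  have "ln y = 4 * ln u" using u(1) by (subst u(3)[symmetric]) (simp add: ln_realpow)
  also have "\<dots> \<le> 4 * u" using u(1) ln_le_minus_one[of u] by simp
  finally have l: "ln y \<le> 4 * u" .
  have "ln y * (4 + 2 * ln y) \<le> (4 * u) * (4 + 2 * (4 * u))"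
    using l assms u by (intro mult_mono add_mono) auto
  also have "\<dots> \<le> (4 * u) * (12 * u)" using u by (intro mult_left_mono) auto
  also have "\<dots> = 48 * sqrt y" by (simp add: u(2)[symmetric] power2_eq_square)
  finally show ?thesis .
qed

text \<open>
  The identity of Tatuzawa and Iseki, applied to \<open>F(x) = \<psi>(x) - x + \<gamma> + 1\<close>: the constant is chosen
  so that \<open>F\<close> has summatory function \<open>O(log x)\<close> over the points \<open>x / n\<close>.
\<close>

lemma selberg_psi:
  assumes N: "N > 0"
  shows "\<bar>\<psi> N * ln (real N) + (\<Sum>k=1..N. \<Lambda> k * \<psi> (N div k)) - 2 * real N * ln (real N)\<bar> \<le> 120 * real N"
proof -
  define C0 where "C0 = (euler_mascheroni :: real) + 1"
  have C0: "0 \<le> C0" "C0 \<le> 2"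
    using euler_mascheroni_pos euler_mascheroni_less_13_over_22 by (auto simp: C0_def)
  define F where "F k = \<psi> (N div k) - real N / real k + C0" for k
  have G: "\<bar>\<Sum>e=1..N div d. F (d * e)\<bar> \<le> 4 + 2 * ln (real N / real d)" if d: "d \<in> {1..N}" for d
  proof -
    define M y where "M = N div d" and "y = real N / real d"
    have M: "M > 0" using d by (simp add: M_def div_greater_zero_iff)
    have My: "real M \<le> y" "y < real M + 1"
      unfolding M_def y_def using real_div_bounds[of N d] by auto
    \<comment> \<open>Remainders in Stirling's formula and in the harmonic sum. With
      \<open>C0\<close> the Euler constant plus 1, all terms of size \<open>M\<close> and
      \<open>M ln M\<close> cancel, apart from a multiple of \<open>y - M\<close>, which is less
      than 1.\<close>
    define r1 r2 where "r1 = ln (fact M) - (real M * ln (real M) - real M)"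
      and "r2 = harm M - (ln (real M) + euler_mascheroni)"
    have r1: "0 \<le> r1" "r1 \<le> 1 + ln (real M)" using ln_fact_bounds[OF M] by (auto simp: r1_def)
    have r2: "0 \<le> r2" "r2 \<le> 1 / real M" using harm_bounds[OF M] by (auto simp: r2_def)
    have "(\<Sum>e=1..M. F (d * e)) = (\<Sum>e=1..M. \<psi> (M div e)) - y * harm M + C0 * real M"
      unfolding F_def M_def y_def harm_def
      by (simp add: sum.distrib sum_subtractf sum_distrib_left div_mult2_eq divide_inverse mult.assoc mult.commute[of C0])
    also have "\<dots> = r1 - (y - real M) * (ln (real M) + euler_mascheroni) - y * r2"
      unfolding sum_psi_div r1_def r2_def C0_def by (simp add: algebra_simps)
    finally have eq: "(\<Sum>e=1..M. F (d * e)) = r1 - (y - real M) * (ln (real M) + euler_mascheroni) - y * r2" .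
    have lnM: "0 \<le> ln (real M)" "ln (real M) \<le> ln y" using M My by auto
    define A where "A = (y - real M) * (ln (real M) + euler_mascheroni)"
    define B where "B = y * r2"
    have "0 \<le> A" unfolding A_def using My lnM euler_mascheroni_pos by (intro mult_nonneg_nonneg) auto
    moreover have "A \<le> 1 * (ln (real M) + 1)"
      unfolding A_def using My lnM euler_mascheroni_pos euler_mascheroni_less_13_over_22
      by (intro mult_mono) auto
    moreover have "0 \<le> B" unfolding B_def using My r2 by (intro mult_nonneg_nonneg) auto
    moreover have "B \<le> 2"
    proof -
      have "B \<le> (2 * real M) * (1 / real M)" unfolding B_def using My r2 M by (intro mult_mono) auto
      then show ?thesis using M by simp
    qed
    ultimately have "r1 - A - B \<le> 4 + 2 * ln y" "- (r1 - A - B) \<le> 4 + 2 * ln y"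
      using r1 lnM by simp_all
    then have "\<bar>r1 - A - B\<bar> \<le> 4 + 2 * ln y" by (rule abs_leI)
    then have "\<bar>\<Sum>e=1..M. F (d * e)\<bar> \<le> 4 + 2 * ln y" unfolding eq A_def B_def .
    then show ?thesis by (simp add: M_def y_def)
  qed
  \<comment> \<open>Collecting by \<open>k = d * e\<close> and splitting
    \<open>ln (N / d) = ln (N / k) + ln (k / d)\<close>, the first part survives only at
    \<open>k = 1\<close> and the second produces \<open>\<Lambda> k\<close>.\<close>
  have "(\<Sum>d=1..N. \<Sum>e=1..N div d. moebius_mu d * ln (real N / real d) * F (d * e))
      = (\<Sum>k=1..N. \<Sum>d | d dvd k. moebius_mu d * ln (real N / real d) * F (d * (k div d)))"
    by (rule sum_dvd_eq_sum_sum[symmetric])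
  also have "\<dots> = (\<Sum>k=1..N. F k * ((if k = 1 then ln (real N) else 0) + \<Lambda> k))"
  proof (rule sum.cong[OF refl])
    fix k assume k: "k \<in> {1..N}"
    have "(\<Sum>d | d dvd k. moebius_mu d * ln (real N / real d) * F (d * (k div d)))
        = (\<Sum>d | d dvd k. F k * (moebius_mu d * ln (real N / real k) + moebius_mu d * ln (real k / real d)))"
    proof (rule sum.cong[OF refl])
      fix d assume "d \<in> {d. d dvd k}"
      then have d: "d dvd k" by simp
      then have "d > 0" using k by (auto intro: Nat.gr0I)
      then have "ln (real N / real d) = ln (real N / real k) + ln (real k / real d)"
        using k N by (simp add: ln_div)
      then show "moebius_mu d * ln (real N / real d) * F (d * (k div d))
        = F k * (moebius_mu d * ln (real N / real k) + moebius_mu d * ln (real k / real d))"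
        using d by (simp add: algebra_simps)
    qed
    also have "\<dots> = F k * ((\<Sum>d | d dvd k. moebius_mu d) * ln (real N / real k)
        + (\<Sum>d | d dvd k. moebius_mu d * ln (real k / real d)))"
      by (simp add: sum_distrib_left sum_distrib_right sum.distrib distrib_left)
    also have "\<dots> = F k * ((if k = 1 then ln (real N) else 0) + \<Lambda> k)"
      using k by (simp add: sum_moebius_dvd sum_moebius_ln)
    finally show "(\<Sum>d | d dvd k. moebius_mu d * ln (real N / real d) * F (d * (k div d)))
      = F k * ((if k = 1 then ln (real N) else 0) + \<Lambda> k)" .
  qed
  also have "\<dots> = F 1 * ln (real N) + (\<Sum>k=1..N. F k * \<Lambda> k)"
  proof -
    have "(\<Sum>k=1..N. F k * (if k = 1 then ln (real N) else 0)) = (\<Sum>k=1..N. if k = 1 then F 1 * ln (real N) else 0)"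
      by (rule sum.cong) auto
    also have "\<dots> = F 1 * ln (real N)" using N by (simp add: sum.delta)
    finally show ?thesis by (simp add: distrib_left sum.distrib)
  qed
  also have "F 1 * ln (real N) + (\<Sum>k=1..N. F k * \<Lambda> k)
      = (\<psi> N * ln (real N) + (\<Sum>k=1..N. \<Lambda> k * \<psi> (N div k))) - real N * ln (real N)
        - real N * (\<Sum>k=1..N. \<Lambda> k / real k) + C0 * ln (real N) + C0 * \<psi> N"
  proof -
    have "(\<Sum>k=1..N. F k * \<Lambda> k) = (\<Sum>k=1..N. \<Lambda> k * \<psi> (N div k)) - real N * (\<Sum>k=1..N. \<Lambda> k / real k) + C0 * \<psi> N"
      unfolding F_def chebyshev_psi_def[of N]
      by (simp add: algebra_simps sum.distrib sum_subtractf sum_distrib_left)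
    then show ?thesis unfolding F_def by (simp add: algebra_simps)
  qed
  finally have main: "(\<Sum>d=1..N. \<Sum>e=1..N div d. moebius_mu d * ln (real N / real d) * F (d * e)) = \<dots>" .
  \<comment> \<open>Since the summatory function of \<open>F\<close> is logarithmic, the trivial
    bound 1 for the Moebius function is enough; no cancellation in \<open>d\<close> is
    needed.\<close>
  have "\<bar>\<Sum>d=1..N. \<Sum>e=1..N div d. moebius_mu d * ln (real N / real d) * F (d * e)\<bar>
      \<le> (\<Sum>d=1..N. \<bar>\<Sum>e=1..N div d. moebius_mu d * ln (real N / real d) * F (d * e)\<bar>)"
    by (rule sum_abs)
  also have "\<dots> \<le> (\<Sum>d=1..N. 48 * sqrt (real N) * (1 / sqrt (real d)))"
  proof (rule sum_mono)
    fix d assume d: "d \<in> {1..N}"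
    then have y: "real N / real d \<ge> 1" by simp
    have "\<bar>\<Sum>e=1..N div d. moebius_mu d * ln (real N / real d) * F (d * e)\<bar>
        = \<bar>moebius_mu d\<bar> * (ln (real N / real d) * \<bar>\<Sum>e=1..N div d. F (d * e)\<bar>)"
      using y by (simp add: sum_distrib_left[symmetric] abs_mult)
    also have "\<dots> \<le> 1 * (ln (real N / real d) * (4 + 2 * ln (real N / real d)))"
      using y G[OF d] by (intro mult_mono abs_moebius_mu_le) auto
    also have "\<dots> \<le> 48 * sqrt (real N / real d)" using ln_mult_le_sqrt[OF y] by simp
    finally show "\<bar>\<Sum>e=1..N div d. moebius_mu d * ln (real N / real d) * F (d * e)\<bar>
      \<le> 48 * sqrt (real N) * (1 / sqrt (real d))" by (simp add: real_sqrt_divide)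
  qed
  also have "\<dots> = 48 * sqrt (real N) * (\<Sum>d=1..N. 1 / sqrt (real d))" by (simp add: sum_distrib_left)
  also have "\<dots> \<le> 48 * sqrt (real N) * (2 * sqrt (real N))" by (intro mult_left_mono sum_inverse_sqrt_le) auto
  also have "\<dots> = 96 * real N" by simp
  finally have bound: "\<bar>\<Sum>d=1..N. \<Sum>e=1..N div d. moebius_mu d * ln (real N / real d) * F (d * e)\<bar> \<le> 96 * real N" .
  have mert: "\<bar>real N * (\<Sum>k=1..N. \<Lambda> k / real k) - real N * ln (real N)\<bar> \<le> 6 * real N"
  proof -
    have "\<bar>real N * ((\<Sum>k=1..N. \<Lambda> k / real k) - ln (real N))\<bar> \<le> real N * 6"
      unfolding abs_mult using mertens[OF N] by (intro mult_mono) auto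
    then show ?thesis by (simp add: algebra_simps)
  qed
  have "0 \<le> C0 * ln (real N)" "C0 * ln (real N) \<le> 2 * real N"
    using C0 N ln_le_minus_one[of "real N"] by (auto intro!: mult_mono)
  moreover have "0 \<le> C0 * \<psi> N" using C0 psi_nonneg by simp
  moreover have "C0 * \<psi> N \<le> 2 * (6 * real N)"
    by (rule mult_mono) (use C0 psi_nonneg psi_le in auto)
  ultimately show ?thesis using bound mert unfolding main by linarith
qed

text \<open>This is the generalized von Mangoldt function of order 2, the Dirichlet convolution of
  the Moebius function with the square of the logarithm. Its summatory function has a main term with
  linear error, whereas \<open>\<psi>\<close> alone is so far known only up to constant
  factors.\<close>

definition selberg_lambda :: "nat \<Rightarrow> real" where
  "selberg_lambda n = \<Lambda> n * ln (real n) + (\<Sum>d | d dvd n. \<Lambda> d * \<Lambda> (n div d))"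

lemma sum_mangoldt_ln:
  assumes "N > 0"
  shows "\<bar>\<psi> N * ln (real N) - (\<Sum>n=1..N. \<Lambda> n * ln (real n))\<bar> \<le> 6 * real N"
proof -
  have "0 \<le> \<psi> N * ln (real N) - (\<Sum>n=1..N. \<Lambda> n * ln (real n)) \<and>
      \<psi> N * ln (real N) - (\<Sum>n=1..N. \<Lambda> n * ln (real n)) \<le> 6 * real N"
    using assms
  proof (induction N rule: nat_induct_non_zero)
    case (Suc N)
    have b: "0 \<le> ln (real N + 1) - ln (real N)" "ln (real N + 1) - ln (real N) \<le> 1 / real N"
      using ln_Suc_diff_bounds[OF Suc.hyps] Suc.hyps by (auto simp: ln_mono)
    have "\<psi> N * (ln (real N + 1) - ln (real N)) \<le> (6 * real N) * (1 / real N)"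
      using b psi_le psi_nonneg by (intro mult_mono) auto
    moreover have "0 \<le> \<psi> N * (ln (real N + 1) - ln (real N))" using b psi_nonneg by simp
    ultimately show ?case using Suc.IH Suc.hyps
      by (simp add: psi_Suc algebra_simps)
  qed (simp add: chebyshev_psi_def)
  then show ?thesis by linarith
qed

lemma sum_selberg_lambda:
  assumes "N > 0"
  shows "\<bar>(\<Sum>n=1..N. selberg_lambda n) - 2 * real N * ln (real N)\<bar> \<le> 126 * real N"
proof -
  have "(\<Sum>n=1..N. \<Sum>d | d dvd n. \<Lambda> d * \<Lambda> (n div d)) = (\<Sum>k=1..N. \<Lambda> k * \<psi> (N div k))"
    unfolding sum_dvd_eq_sum_sum[of "\<lambda>d e. \<Lambda> d * \<Lambda> e"] chebyshev_psi_def by (simp add: sum_distrib_left)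
  then have "(\<Sum>n=1..N. selberg_lambda n) = (\<Sum>n=1..N. \<Lambda> n * ln (real n)) + (\<Sum>k=1..N. \<Lambda> k * \<psi> (N div k))"
    by (simp add: selberg_lambda_def sum.distrib)
  then show ?thesis using selberg_psi[OF assms] sum_mangoldt_ln[OF assms] by linarith
qed

section \<open>Primes in short geometric intervals\<close>

abbreviation nat_window :: "real \<Rightarrow> real \<Rightarrow> nat set" where
  "nat_window y z \<equiv> {nat \<lfloor>y\<rfloor><..nat \<lfloor>z\<rfloor>}"

lemma mem_nat_window: "0 \<le> y \<Longrightarrow> n \<in> nat_window y z \<longleftrightarrow> y < real n \<and> real n \<le> z"
  by (cases "0 \<le> z") (auto simp: nat_less_iff floor_less_iff le_nat_iff le_floor_iff not_le)

lemma sum_nat_window_split: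
  assumes "y \<le> z" and "z \<le> w"
  shows "sum f (nat_window y w) = sum f (nat_window y z) + sum f (nat_window z w)"
proof -
  have "nat \<lfloor>y\<rfloor> \<le> nat \<lfloor>z\<rfloor>" "nat \<lfloor>z\<rfloor> \<le> nat \<lfloor>w\<rfloor>" using assms by (auto intro: nat_mono floor_mono)
  then show ?thesis by (subst sum.union_disjoint[symmetric]) (auto intro: sum.cong)
qed

text \<open>With weights \<open>1 / n\<close> the expected mass of \<open>(y, z]\<close> is
  \<open>ln (z / y)\<close>, invariant under scaling. All windows \<open>(q^i, q^(i+1)]\<close> then
  have expected mass \<open>ln q\<close>, and multiplication of integers corresponds to addition of
  indices up to neighbouring windows.\<close>

definition mangoldt_mass :: "real \<Rightarrow> real \<Rightarrow> real" where
  "mangoldt_mass y z = (\<Sum>n\<in>nat_window y z. \<Lambda> n / real n)"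

lemma mangoldt_mass_nonneg: "0 \<le> mangoldt_mass y z"
  unfolding mangoldt_mass_def by (intro sum_nonneg divide_nonneg_nonneg mangoldt_nonneg) auto

lemma mangoldt_mass_mono:
  "y' \<le> y \<Longrightarrow> z \<le> z' \<Longrightarrow> mangoldt_mass y z \<le> mangoldt_mass y' z'"
  unfolding mangoldt_mass_def
proof (intro sum_mono2 divide_nonneg_nonneg mangoldt_nonneg)
  assume "y' \<le> y" "z \<le> z'"
  then have "nat \<lfloor>y'\<rfloor> \<le> nat \<lfloor>y\<rfloor>" "nat \<lfloor>z\<rfloor> \<le> nat \<lfloor>z'\<rfloor>" by (auto intro: nat_mono floor_mono)
  then show "nat_window y z \<subseteq> nat_window y' z'" by auto
qed auto

lemma mangoldt_mass_split:
  "y \<le> z \<Longrightarrow> z \<le> w \<Longrightarrow> mangoldt_mass y w = mangoldt_mass y z + mangoldt_mass z w"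
  unfolding mangoldt_mass_def by (rule sum_nat_window_split)

lemma ln_nat_floor:
  assumes "y \<ge> 1"
  shows "nat \<lfloor>y\<rfloor> > 0" "ln (real (nat \<lfloor>y\<rfloor>)) \<le> ln y" "ln y \<le> ln (real (nat \<lfloor>y\<rfloor>) + 1)"
    "ln (real (nat \<lfloor>y\<rfloor>) + 1) \<le> ln (real (nat \<lfloor>y\<rfloor>)) + 2 / y"
proof -
  define X where "X = real (nat \<lfloor>y\<rfloor>)"
  have X: "X \<le> y" "y < X + 1" "1 \<le> X"
    using assms unfolding X_def by (auto simp: of_nat_nat le_floor_iff)
  show pos: "nat \<lfloor>y\<rfloor> > 0" using X(3) unfolding X_def by linarith
  show "ln (real (nat \<lfloor>y\<rfloor>)) \<le> ln y" "ln y \<le> ln (real (nat \<lfloor>y\<rfloor>) + 1)"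
    using X assms unfolding X_def[symmetric] by (auto intro: ln_mono)
  have "ln (X + 1) - ln X \<le> 1 / X" using ln_Suc_diff_bounds(2)[OF pos] by (simp add: X_def)
  also have "1 / X \<le> 2 / y" using X assms by (simp add: divide_simps)
  finally show "ln (real (nat \<lfloor>y\<rfloor>) + 1) \<le> ln (real (nat \<lfloor>y\<rfloor>)) + 2 / y" by (simp add: X_def)
qed

text \<open>A difference of two Mertens sums: 6 for each of them and 2 for rounding the
  endpoints.\<close>

lemma mangoldt_mass_mertens:
  assumes "1 \<le> y" and "y \<le> z"
  shows "\<bar>mangoldt_mass y z - ln (z / y)\<bar> \<le> 14"
proof -
  define X Z where "X = nat \<lfloor>y\<rfloor>" and "Z = nat \<lfloor>z\<rfloor>"
  have XZ: "X \<le> Z" unfolding X_def Z_def using assms by (auto intro: nat_mono floor_mono)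
  have fl: "ln u \<le> ln (real (nat \<lfloor>u\<rfloor>)) + 2" if "1 \<le> u" for u
  proof -
    have "2 / u \<le> 2" using that by (simp add: divide_le_eq)
    then show ?thesis using ln_nat_floor(3,4)[OF that] by linarith
  qed
  have z1: "1 \<le> z" using assms by simp
  have y: "X > 0" "ln (real X) \<le> ln y" "ln y \<le> ln (real X) + 2"
    using ln_nat_floor(1,2)[OF assms(1)] fl[OF assms(1)] unfolding X_def[symmetric] by blast+
  have z: "Z > 0" "ln (real Z) \<le> ln z" "ln z \<le> ln (real Z) + 2"
    using ln_nat_floor(1,2)[OF z1] fl[OF z1] unfolding Z_def[symmetric] by blast+
  have "(\<Sum>n=1..Z. \<Lambda> n / real n) = (\<Sum>n=1..X. \<Lambda> n / real n) + mangoldt_mass y z"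
    unfolding mangoldt_mass_def X_def[symmetric] Z_def[symmetric] using XZ
    by (subst sum.union_disjoint[symmetric]) (auto intro: sum.cong)
  moreover have "ln (z / y) = ln z - ln y" using assms by (simp add: ln_div)
  moreover note abs_le_D1[OF mertens[OF y(1)]] abs_le_D2[OF mertens[OF y(1)]]
    abs_le_D1[OF mertens[OF z(1)]] abs_le_D2[OF mertens[OF z(1)]]
  ultimately show ?thesis using y(2,3) z(2,3) by (intro abs_leI) linarith+
qed

section \<open>Selberg's formula in multiplicative windows\<close>

lemma sum_over_index_by_parts:
  fixes a :: "nat \<Rightarrow> real"
  assumes "X \<le> Y"
  defines "S \<equiv> \<lambda>N. \<Sum>n=1..N. a n"
  shows "(\<Sum>n\<in>{X<..Y}. a n / real n) = S Y / (real Y + 1) - S X / (real X + 1)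
    + (\<Sum>n\<in>{X<..Y}. S n * (1 / real n - 1 / (real n + 1)))"
  using assms(1)
proof (induction Y rule: dec_induct)
  case (step Y)
  have ins: "{X<..Suc Y} = insert (Suc Y) {X<..Y}" using step.hyps by auto
  have S: "S (Suc Y) = S Y + a (Suc Y)" by (simp add: S_def)
  show ?case unfolding ins using step.IH by (simp add: S add_divide_distrib algebra_simps)
qed simp

lemma sum_inverse_window_bounds:
  assumes "0 < X" and "X \<le> Y"
  shows "(\<Sum>n\<in>{X<..Y}. 1 / real n) \<le> ln (real Y) - ln (real X)"
    and "ln (real Y + 1) - ln (real X + 1) \<le> (\<Sum>n\<in>{X<..Y}. 1 / real n)"
proof -
  have "(\<Sum>n\<in>{X<..Y}. 1 / real n) \<le> ln (real Y) - ln (real X) \<and>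
      ln (real Y + 1) - ln (real X + 1) \<le> (\<Sum>n\<in>{X<..Y}. 1 / real n)"
    using assms(2)
  proof (induction Y rule: dec_induct)
    case (step Y)
    have ins: "{X<..Suc Y} = insert (Suc Y) {X<..Y}" using step.hyps by auto
    have "1 / (real Y + 1) \<le> ln (real Y + 1) - ln (real Y)"
      using ln_Suc_diff_bounds(1)[of Y] step.hyps assms(1) by auto
    moreover have "ln (real (Suc Y) + 1) - ln (real (Suc Y)) \<le> 1 / real (Suc Y)"
      using ln_Suc_diff_bounds(2)[of "Suc Y"] by auto
    ultimately show ?case unfolding ins using step.IH by (simp add: add.commute)
  qed simp
  then show "(\<Sum>n\<in>{X<..Y}. 1 / real n) \<le> ln (real Y) - ln (real X)"
    and "ln (real Y + 1) - ln (real X + 1) \<le> (\<Sum>n\<in>{X<..Y}. 1 / real n)" by auto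
qed

text \<open>Partial summation of \<open>selberg_lambda n - 2 ln n\<close>, whose partial sums are at
  most \<open>128 N\<close> in absolute value (126 from Selberg's formula, 2 from Stirling's). On a
  window of bounded ratio the error stays bounded while the main term grows like
  \<open>ln y\<close>.\<close>

lemma selberg_window:
  assumes "K \<ge> 1"
  shows "\<exists>C. \<forall>y z. 1 \<le> y \<longrightarrow> y \<le> z \<longrightarrow> z \<le> K * y \<longrightarrow>
    \<bar>(\<Sum>n\<in>nat_window y z. selberg_lambda n / real n) - 2 * ln (z / y) * ln y\<bar> \<le> C"
proof -
  define L where "L = ln K"
  have L: "0 \<le> L" using assms by (simp add: L_def)
  show ?thesis
  proof (intro exI[of _ "128 * 2 + 128 * (L + 2) + (2 * L * (L + 2) + 4) + (4 * (L + 2) + 4)"] allI impI)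
    fix y z :: real assume y1: "1 \<le> y" and yz: "y \<le> z" and zK: "z \<le> K * y"
    define X Y where "X = nat \<lfloor>y\<rfloor>" and "Y = nat \<lfloor>z\<rfloor>"
    have z1: "1 \<le> z" using y1 yz by simp
    have XY: "X \<le> Y" unfolding X_def Y_def using yz by (auto intro: nat_mono floor_mono)
    note X = ln_nat_floor[OF y1, folded X_def] and Y = ln_nat_floor[OF z1, folded Y_def]
    have two: "2 / y \<le> 2" "0 < 2 / y" using y1 by (auto simp: divide_le_eq)
    define l where "l = ln z - ln y"
    have l: "0 \<le> l" "l \<le> L" "ln (z / y) = l"
    proof -
      have "ln z \<le> ln (K * y)" using zK z1 by (intro ln_mono) auto
      then show "l \<le> L" using assms y1 by (simp add: l_def L_def ln_mult)
      show "0 \<le> l" using yz y1 by (simp add: l_def)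
      show "ln (z / y) = l" using y1 z1 by (simp add: l_def ln_div)
    qed
    define a where "a n = selberg_lambda n - 2 * ln (real n)" for n
    define S where "S N = (\<Sum>n=1..N. a n)" for N
    have S: "\<bar>S N\<bar> \<le> 128 * real N" for N
    proof (cases "N = 0")
      case False
      have "(\<Sum>n=1..N. 2 * ln (real n)) = 2 * ln (fact N)"
        unfolding fact_prod by (subst of_nat_prod, subst ln_prod) (auto simp: sum_distrib_left)
      then have eq: "S N = (\<Sum>n=1..N. selberg_lambda n) - 2 * ln (fact N)"
        by (simp add: S_def a_def sum_subtractf)
      have "ln (fact N) \<le> real N * ln (real N)"
      proof -
        have "fact N \<le> (real N) ^ N" using fact_le_power[of N, where ?'a = real] by simp
        then have "ln (fact N) \<le> ln (real N ^ N)" using False by (intro ln_mono) auto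
        then show ?thesis using False by (simp add: ln_realpow)
      qed
      then show ?thesis unfolding eq
        using sum_selberg_lambda[of N] ln_fact_bounds(1)[of N] False by simp
    qed (simp add: S_def)
    define s where "s = (\<Sum>n\<in>{X<..Y}. 1 / real n)"
    have s: "0 \<le> s" "s \<le> l + 2 / y" "l - 2 / y \<le> s"
    proof -
      show "0 \<le> s" unfolding s_def by (intro sum_nonneg) auto
      show "s \<le> l + 2 / y" "l - 2 / y \<le> s"
        using sum_inverse_window_bounds[OF X(1) XY] X Y unfolding s_def l_def by linarith+
    qed
    have a_sum: "\<bar>\<Sum>n\<in>{X<..Y}. a n / real n\<bar> \<le> 128 * 2 + 128 * (L + 2)"
    proof -
      have bnd: "\<bar>S N / (real N + 1)\<bar> \<le> 128" for N
        using S[of N] by (simp add: abs_divide divide_le_eq)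
      have "\<bar>\<Sum>n\<in>{X<..Y}. S n * (1 / real n - 1 / (real n + 1))\<bar> \<le> (\<Sum>n\<in>{X<..Y}. 128 * (1 / real n))"
      proof (rule order_trans[OF sum_abs sum_mono])
        fix n assume n: "n \<in> {X<..Y}"
        then have n0: "real n > 0" by auto
        have "1 / real n - 1 / (real n + 1) = 1 / (real n * (real n + 1))" using n0 by (simp add: field_simps)
        then have "\<bar>S n * (1 / real n - 1 / (real n + 1))\<bar> = \<bar>S n\<bar> * (1 / (real n * (real n + 1)))"
          using n0 by (simp add: abs_mult)
        also have "\<dots> \<le> (128 * real n) * (1 / (real n * (real n + 1)))"
          using S n0 by (intro mult_right_mono) auto
        also have "\<dots> \<le> 128 * (1 / real n)" using n0 by (simp add: divide_simps)
        finally show "\<bar>S n * (1 / real n - 1 / (real n + 1))\<bar> \<le> 128 * (1 / real n)" .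
      qed
      also have "\<dots> = 128 * s" by (simp add: s_def sum_distrib_left)
      also have "\<dots> \<le> 128 * (L + 2)" using s l two by simp
      finally show ?thesis
        unfolding sum_over_index_by_parts[OF XY, of a] S_def[symmetric]
        using bnd[of X] bnd[of Y] by linarith
    qed
    have lnX: "0 \<le> ln (real X)" "ln (real X) \<le> ln y" "ln y - 2 / y \<le> ln (real X)" using X by auto
    have lny: "ln y * (2 / y) \<le> 2" "0 \<le> ln y"
      using ln_le_minus_one[of y] y1 by (auto simp: divide_le_eq)
    have upper: "(\<Sum>n\<in>{X<..Y}. 2 * ln (real n) / real n) \<le> 2 * l * ln y + (2 * L * (L + 2) + 4)"
    proof -
      have "(\<Sum>n\<in>{X<..Y}. 2 * ln (real n) / real n) \<le> (\<Sum>n\<in>{X<..Y}. 2 * (ln y + L) * (1 / real n))"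
      proof (rule sum_mono)
        fix n assume n: "n \<in> {X<..Y}"
        then have "ln (real n) \<le> ln (real Y)" using X(1) by (intro ln_mono) auto
        then have "ln (real n) \<le> ln y + L" using Y(2) l unfolding l_def by linarith
        then show "2 * ln (real n) / real n \<le> 2 * (ln y + L) * (1 / real n)"
          by (simp add: divide_right_mono)
      qed
      also have "\<dots> = 2 * (ln y + L) * s" by (simp add: s_def sum_distrib_left)
      also have "\<dots> \<le> 2 * (ln y + L) * (l + 2 / y)" using s lny L by (intro mult_left_mono) auto
      also have "\<dots> = 2 * l * ln y + 2 * (ln y * (2 / y)) + 2 * L * (l + 2 / y)" by (simp add: algebra_simps)
      also have "\<dots> \<le> 2 * l * ln y + 2 * 2 + 2 * L * (L + 2)"
        using lny l L two by (intro add_mono mult_left_mono) auto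
      finally show ?thesis by simp
    qed
    have lower: "2 * l * ln y - (4 * (L + 2) + 4) \<le> (\<Sum>n\<in>{X<..Y}. 2 * ln (real n) / real n)"
    proof -
      have "2 * (l - 2 / y) * ln y = 2 * l * ln y - 2 * (ln y * (2 / y))" by (simp add: algebra_simps)
      then have "2 * l * ln y - 4 \<le> 2 * (l - 2 / y) * ln y" using lny(1) by linarith
      also have "\<dots> \<le> 2 * s * ln y" using s lny by (intro mult_right_mono) auto
      also have "\<dots> \<le> 2 * s * ln (real X) + 2 * s * 2"
      proof -
        have "2 * s * (ln y - ln (real X)) \<le> 2 * s * 2" using s lnX two by (intro mult_left_mono) auto
        then show ?thesis by (simp add: algebra_simps)
      qed
      also have "2 * s * 2 \<le> 4 * (L + 2)" using s l two by simp
      also have "2 * s * ln (real X) = 2 * ln (real X) * s" by simp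
      also have "\<dots> = (\<Sum>n\<in>{X<..Y}. 2 * ln (real X) * (1 / real n))"
        unfolding s_def by (rule sum_distrib_left)
      also have "\<dots> \<le> (\<Sum>n\<in>{X<..Y}. 2 * ln (real n) / real n)"
      proof (rule sum_mono)
        fix n assume n: "n \<in> {X<..Y}"
        then have "ln (real X) \<le> ln (real n)" using X(1) by (intro ln_mono) auto
        then show "2 * ln (real X) * (1 / real n) \<le> 2 * ln (real n) / real n"
          by (simp add: divide_right_mono)
      qed
      finally show ?thesis by simp
    qed
    have sum: "(\<Sum>n\<in>{X<..Y}. selberg_lambda n / real n)
        = (\<Sum>n\<in>{X<..Y}. a n / real n) + (\<Sum>n\<in>{X<..Y}. 2 * ln (real n) / real n)"
      by (simp add: a_def sum.distrib[symmetric] diff_divide_distrib)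
    have abs3: "\<bar>A + B - c\<bar> \<le> c1 + c2 + c3"
      if "\<bar>A\<bar> \<le> c1" "B \<le> c + c2" "c - c3 \<le> B" "0 \<le> c2" "0 \<le> c3" for A B c c1 c2 c3 :: real
      using that by linarith
    have "\<bar>(\<Sum>n\<in>{X<..Y}. selberg_lambda n / real n) - 2 * l * ln y\<bar>
      \<le> 128 * 2 + 128 * (L + 2) + (2 * L * (L + 2) + 4) + (4 * (L + 2) + 4)"
      unfolding sum by (rule abs3[OF a_sum upper lower]) (use L in simp_all)
    then show "\<bar>(\<Sum>n\<in>nat_window y z. selberg_lambda n / real n) - 2 * ln (z / y) * ln y\<bar>
      \<le> 128 * 2 + 128 * (L + 2) + (2 * L * (L + 2) + 4) + (4 * (L + 2) + 4)"
      by (simp only: l(3) X_def Y_def)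
  qed
qed

text \<open>Dropping the nonnegative convolution from Selberg's formula and using
  \<open>ln n \<ge> ln y\<close> bounds the mass by twice its expected value, up to a vanishing
  error. This factor 2 defines the extremal windows.\<close>

lemma mangoldt_mass_upper:
  assumes "K \<ge> 1"
  shows "\<exists>C\<ge>0. \<forall>y z. 1 < y \<longrightarrow> y \<le> z \<longrightarrow> z \<le> K * y \<longrightarrow> mangoldt_mass y z \<le> 2 * ln (z / y) + C / ln y"
proof -
  obtain C where C: "\<And>y z. 1 \<le> y \<Longrightarrow> y \<le> z \<Longrightarrow> z \<le> K * y \<Longrightarrow>
    \<bar>(\<Sum>n\<in>nat_window y z. selberg_lambda n / real n) - 2 * ln (z / y) * ln y\<bar> \<le> C"
    using selberg_window[OF assms] by blast
  have "\<bar>(\<Sum>n\<in>nat_window 1 1. selberg_lambda n / real n) - 2 * ln (1 / 1) * ln 1\<bar> \<le> C"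
    by (rule C) (use assms in auto)
  then have "C \<ge> 0" using abs_ge_zero order_trans by blast
  show ?thesis
  proof (intro exI[of _ C] conjI allI impI)
    fix y z :: real assume y: "1 < y" and yz: "y \<le> z" and zK: "z \<le> K * y"
    have "ln y * mangoldt_mass y z \<le> (\<Sum>n\<in>nat_window y z. selberg_lambda n / real n)"
      unfolding mangoldt_mass_def sum_distrib_left
    proof (rule sum_mono)
      fix n assume "n \<in> nat_window y z"
      then have n: "y < real n" using y mem_nat_window[of y n z] by simp
      then have "ln y \<le> ln (real n)" using y by (intro ln_mono) auto
      then have "ln y * \<Lambda> n \<le> ln (real n) * \<Lambda> n" by (intro mult_right_mono mangoldt_nonneg)
      also have "\<dots> \<le> selberg_lambda n"
        unfolding selberg_lambda_def
        by (simp add: mult.commute) (intro sum_nonneg mult_nonneg_nonneg mangoldt_nonneg)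
      finally show "ln y * (\<Lambda> n / real n) \<le> selberg_lambda n / real n"
        by (simp add: divide_right_mono)
    qed
    also have "\<dots> \<le> 2 * ln (z / y) * ln y + C"
    proof -
      have "\<bar>(\<Sum>n\<in>nat_window y z. selberg_lambda n / real n) - 2 * ln (z / y) * ln y\<bar> \<le> C"
        by (rule C) (use y yz zK in auto)
      from abs_le_D1[OF this] show ?thesis by simp
    qed
    finally have "mangoldt_mass y z * ln y \<le> (2 * ln (z / y) + C / ln y) * ln y"
      using y by (simp add: algebra_simps)
    then show "mangoldt_mass y z \<le> 2 * ln (z / y) + C / ln y"
      using y by (simp add: mult_le_cancel_right)
  qed fact
qed

lemma sum_mangoldt_convolution_window:
  assumes "0 \<le> x" and "x \<le> z"
  shows "(\<Sum>n\<in>nat_window x z. (\<Sum>d | d dvd n. \<Lambda> d * \<Lambda> (n div d)) / real n)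
    = (\<Sum>k\<in>{1..nat \<lfloor>z\<rfloor>}. \<Lambda> k / real k * mangoldt_mass (x / real k) (z / real k))"
proof -
  define N where "N = nat \<lfloor>z\<rfloor>"
  define f where "f d e = (if x < real (d * e) then \<Lambda> d * \<Lambda> e / real (d * e) else 0)" for d e
  have "(\<Sum>n\<in>nat_window x z. (\<Sum>d | d dvd n. \<Lambda> d * \<Lambda> (n div d)) / real n)
      = (\<Sum>n=1..N. \<Sum>d | d dvd n. f d (n div d))"
  proof (rule sum.mono_neutral_cong_left)
    show "nat_window x z \<subseteq> {1..N}" by (auto simp: N_def)
    show "\<forall>n\<in>{1..N} - nat_window x z. (\<Sum>d | d dvd n. f d (n div d)) = 0"
    proof
      fix n assume n: "n \<in> {1..N} - nat_window x z"
      then have "\<not> x < real n" using assms mem_nat_window[of x n z] by (auto simp: N_def le_nat_iff le_floor_iff)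
      then show "(\<Sum>d | d dvd n. f d (n div d)) = 0" by (intro sum.neutral) (auto simp: f_def)
    qed
    fix n assume "n \<in> nat_window x z"
    then have "x < real n" using assms mem_nat_window by blast
    then show "(\<Sum>d | d dvd n. \<Lambda> d * \<Lambda> (n div d)) / real n = (\<Sum>d | d dvd n. f d (n div d))"
      unfolding sum_divide_distrib by (intro sum.cong) (auto simp: f_def)
  qed simp
  also have "\<dots> = (\<Sum>k=1..N. \<Sum>e=1..N div k. f k e)" by (rule sum_dvd_eq_sum_sum)
  also have "\<dots> = (\<Sum>k=1..N. \<Lambda> k / real k * mangoldt_mass (x / real k) (z / real k))"
  proof (rule sum.cong[OF refl])
    fix k assume k: "k \<in> {1..N}"
    have mem: "e \<in> nat_window (x / real k) (z / real k) \<longleftrightarrow> e \<in> {1..N div k} \<and> x < real (k * e)" for e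
    proof -
      have "e \<in> nat_window (x / real k) (z / real k) \<longleftrightarrow> x / real k < real e \<and> real e \<le> z / real k"
        using assms by (intro mem_nat_window) auto
      also have "\<dots> \<longleftrightarrow> x < real (k * e) \<and> real (k * e) \<le> z"
        using k by (auto simp: divide_less_eq le_divide_eq mult.commute)
      also have "real (k * e) \<le> z \<longleftrightarrow> k * e \<le> N"
        using assms unfolding N_def by (auto simp: le_nat_iff le_floor_iff)
      also have "k * e \<le> N \<longleftrightarrow> e \<le> N div k" using k by (simp add: less_eq_div_iff_mult_less_eq mult.commute)
      finally show ?thesis using assms by (cases "e = 0") auto
    qed
    have "(\<Sum>e=1..N div k. f k e) = (\<Sum>e\<in>nat_window (x / real k) (z / real k). \<Lambda> k / real k * (\<Lambda> e / real e))"
    proof (rule sum.mono_neutral_cong_right)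
      show "nat_window (x / real k) (z / real k) \<subseteq> {1..N div k}" using mem by blast
      show "\<forall>e\<in>{1..N div k} - nat_window (x / real k) (z / real k). f k e = 0"
        using mem unfolding f_def by auto
      show "f k e = \<Lambda> k / real k * (\<Lambda> e / real e)" if "e \<in> nat_window (x / real k) (z / real k)" for e
        using mem[of e] that unfolding f_def by simp
    qed simp
    then show "(\<Sum>e=1..N div k. f k e) = \<Lambda> k / real k * mangoldt_mass (x / real k) (z / real k)"
      by (simp add: mangoldt_mass_def sum_distrib_left)
  qed
  finally show ?thesis by (simp add: N_def)
qed

text \<open>
  If \<open>b\<^sub>i\<close> is positive then \<open>b\<^sub>i\<^sub>+\<^sub>1\<close> must be close to \<open>2 h\<close>, unless \<open>b\<^sub>i (2 h - b\<^sub>i\<^sub>+\<^sub>1)\<close> is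
  large; hence a long window without large values of this product has either average less than \<open>h\<close>
  in its first half, or average greater than \<open>h\<close> in its second half. The product is controlled through
  the reflection \<open>i \<mapsto> T - i\<close>.
\<close>

lemma reflected_sum_lower_bound:
  fixes b :: "nat \<Rightarrow> real"
  assumes h: "h > 0" and C: "C \<ge> 0" and b0: "\<And>i. 0 \<le> b i"
    and upper: "\<And>i. i \<ge> 1 \<Longrightarrow> b i \<le> 2 * h + C / real i"
    and avg: "\<And>u v. u \<le> v \<Longrightarrow> \<bar>(\<Sum>i\<in>{u..<v}. b i) - real (v - u) * h\<bar> \<le> C"
  shows "\<exists>\<delta>>0. \<forall>\<^sub>F T in sequentially.
    \<delta> * real T \<le> (\<Sum>i\<le>T - 2. b i * (4 * h - b (T - i) - b (T - i + 1)))"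
proof -
  \<comment> \<open>With \<open>R h / 2 > C\<close>, no block of \<open>R\<close> consecutive
    indices can have all its values at most \<open>h / 2\<close>, nor all at least
    \<open>3 h / 2\<close>.\<close>
  define R where "R = nat \<lceil>2 * C / h\<rceil> + 1"
  have "2 * C / h < real R" unfolding R_def using C h by (simp add: add.commute) linarith
  then have Rh: "C < real R * h / 2" and R0: "R > 0" using h by (simp_all add: divide_less_eq R_def)
  \<comment> \<open>Deficiency with respect to the extremal value \<open>2 h\<close>, truncated at 0
    so that products can be bounded term by term.\<close>
  define e where "e j = max 0 (2 * h - b j)" for j
  have e: "0 \<le> e j" "e j \<le> 2 * h" "2 * h - b j \<le> e j" for j using b0[of j] h by (auto simp: e_def)
  define B where "B = 2 * h + C"
  have B: "b i \<le> B" for i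
  proof (cases "i = 0")
    case True
    have "\<bar>(\<Sum>i\<in>{0..<1}. b i) - real (1 - 0) * h\<bar> \<le> C" by (rule avg) simp
    then show ?thesis using True h unfolding B_def by simp
  next
    case False
    then have "C / real i \<le> C" using C by (simp add: divide_le_eq mult_le_cancel_left1)
    then show ?thesis using upper[of i] False unfolding B_def by simp
  qed
  have window: "h\<^sup>2 / 8 \<le> (\<Sum>i\<in>{u..<u + 2 * R}. b i * e (i + 1))" for u
  proof (rule ccontr)
    assume neg: "\<not> ?thesis"
    have small: "b i * e (i + 1) < h\<^sup>2 / 8" if "i \<in> {u..<u + 2 * R}" for i
    proof -
      have "b i * e (i + 1) \<le> (\<Sum>i\<in>{u..<u + 2 * R}. b i * e (i + 1))"
        using that b0 e by (intro member_le_sum) auto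
      then show ?thesis using neg by linarith
    qed
    have next_big: "b (i + 1) \<ge> 3 / 2 * h" if "i \<in> {u..<u + 2 * R}" "b i \<ge> h / 2" for i
    proof (rule ccontr)
      assume "\<not> ?thesis"
      then have "h / 2 \<le> e (i + 1)" using e(3)[of "i + 1"] by simp
      then have "h / 2 * (h / 2) \<le> b i * e (i + 1)" using that(2) h b0 by (intro mult_mono) auto
      moreover have "h / 2 * (h / 2) = h\<^sup>2 / 4" by (simp add: power2_eq_square)
      moreover have "0 < h\<^sup>2" using h by simp
      ultimately show False using small[OF that(1)] by linarith
    qed
    have "\<exists>i\<in>{u..<u + R}. b i \<ge> h / 2"
    proof (rule ccontr)
      assume "\<not> ?thesis"
      then have "b i \<le> h / 2" if "i \<in> {u..<u + R}" for i using that by (meson linear)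
      then have "(\<Sum>i\<in>{u..<u + R}. b i) \<le> (\<Sum>i\<in>{u..<u + R}. h / 2)" by (rule sum_mono)
      then have "(\<Sum>i\<in>{u..<u + R}. b i) \<le> real R * h / 2" by simp
      moreover have "\<bar>(\<Sum>i\<in>{u..<u + R}. b i) - real (u + R - u) * h\<bar> \<le> C" by (rule avg) simp
      ultimately show False using Rh by (simp add: abs_le_iff)
    qed
    then obtain i where i: "i \<in> {u..<u + R}" "b i \<ge> h / 2" by blast
    have big: "j < u + 2 * R \<longrightarrow> b j \<ge> 3 / 2 * h" if "Suc i \<le> j" for j
      using that
    proof (induction j rule: dec_induct)
      case base
      then show ?case using next_big[OF _ i(2)] i(1) by auto
    next
      case (step j)
      then show ?case using next_big[of j] i(1) h by auto
    qed
    have "(\<Sum>j\<in>{u + R..<u + 2 * R}. 3 / 2 * h) \<le> (\<Sum>j\<in>{u + R..<u + 2 * R}. b j)"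
      using big i(1) by (intro sum_mono) auto
    then have "real R * (3 / 2 * h) \<le> (\<Sum>j\<in>{u + R..<u + 2 * R}. b j)" by simp
    moreover have "\<bar>(\<Sum>j\<in>{u + R..<u + 2 * R}. b j) - real (u + 2 * R - (u + R)) * h\<bar> \<le> C"
      by (rule avg) simp
    ultimately show False using Rh by (simp add: abs_le_iff)
  qed
  have windows: "real w * (h\<^sup>2 / 8) \<le> (\<Sum>i\<in>{2..<2 + 2 * R * w}. b i * e (i + 1))" for w
  proof (induction w)
    case (Suc w)
    have split: "{2..<2 + 2 * R * Suc w} = {2..<2 + 2 * R * w} \<union> {2 + 2 * R * w..<2 + 2 * R * w + 2 * R}" by auto
    have "(\<Sum>i\<in>{2..<2 + 2 * R * Suc w}. b i * e (i + 1))
        = (\<Sum>i\<in>{2..<2 + 2 * R * w}. b i * e (i + 1)) + (\<Sum>i\<in>{2 + 2 * R * w..<2 + 2 * R * w + 2 * R}. b i * e (i + 1))"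
      unfolding split by (rule sum.union_disjoint) auto
    then show ?case using Suc window[of "2 + 2 * R * w"] by (simp add: algebra_simps)
  qed simp
  define D where "D = B / h + 2"
  have D: "D \<ge> 2" using h C by (simp add: D_def B_def)
  \<comment> \<open>This brings in the reflection, with \<open>j = T - i\<close> later. If
    \<open>b j \<le> h\<close>, then \<open>e j\<close> is at least half of
    \<open>e (i + 1)\<close>; otherwise \<open>b j\<close> exceeds \<open>b i\<close> up to the
    factor \<open>B / h\<close>. So a product over consecutive indices is dominated by products that
    involve \<open>j\<close>.\<close>
  have pair: "b i * e (i + 1) \<le> D * (b i * e j + b j * e (i + 1))" for i j
  proof (cases "b j \<le> h")
    case True
    then have "h \<le> e j" using e(3)[of j] by simp
    then have "e (i + 1) \<le> 2 * e j" using e(2)[of "i + 1"] by simp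
    then have "b i * e (i + 1) \<le> b i * (2 * e j)" using b0 by (intro mult_left_mono) auto
    also have "\<dots> \<le> D * (b i * e j)" using D b0[of i] e(1)[of j] mult_right_mono[of 2 D "b i * e j"] by simp
    also have "\<dots> \<le> D * (b i * e j + b j * e (i + 1))" using D b0 e(1) by (intro mult_left_mono) auto
    finally show ?thesis .
  next
    case False
    have "b i * e (i + 1) \<le> B * e (i + 1)" using B e(1) by (intro mult_right_mono) auto
    also have "\<dots> = B / h * (h * e (i + 1))" using h by simp
    also have "\<dots> \<le> B / h * (b j * e (i + 1))"
      using False e(1) h C by (intro mult_left_mono mult_right_mono) (auto simp: B_def)
    also have "\<dots> \<le> D * (b j * e (i + 1))"
      using b0[of j] e(1)[of "i + 1"] by (intro mult_right_mono) (auto simp: D_def)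
    also have "\<dots> \<le> D * (b i * e j + b j * e (i + 1))" using D b0 e(1) by (intro mult_left_mono) auto
    finally show ?thesis .
  qed
  define X where "X T = (\<Sum>i\<le>T - 2. b i * (4 * h - b (T - i) - b (T - i + 1)))" for T
  have main: "real ((T - 3) div (2 * R)) * (h\<^sup>2 / 8) \<le> D * (X T + 2 * C * B * (ln (real T) + 2))"
    if T: "T \<ge> 4" for T
  proof -
    define w where "w = (T - 3) div (2 * R)"
    have "2 * R * w \<le> T - 3" unfolding w_def using times_div_less_eq_dividend by blast
    then have sub: "{2..<2 + 2 * R * w} \<subseteq> {2..T - 2}" using T by auto
    have "real w * (h\<^sup>2 / 8) \<le> (\<Sum>i\<in>{2..<2 + 2 * R * w}. b i * e (i + 1))" by (rule windows)
    also have "\<dots> \<le> (\<Sum>i\<in>{2..T - 2}. b i * e (i + 1))"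
      using sub b0 e(1) by (intro sum_mono2) auto
    also have "\<dots> \<le> (\<Sum>i\<in>{2..T - 2}. D * (b i * e (T - i) + b (T - i) * e (i + 1)))"
      by (intro sum_mono pair)
    also have "\<dots> = D * ((\<Sum>i\<in>{2..T - 2}. b i * e (T - i)) + (\<Sum>i\<in>{2..T - 2}. b (T - i) * e (i + 1)))"
      by (simp only: sum_distrib_left[symmetric] sum.distrib)
    also have "(\<Sum>i\<in>{2..T - 2}. b (T - i) * e (i + 1)) = (\<Sum>i\<in>{2..T - 2}. b i * e (T - i + 1))"
      using T by (intro sum.reindex_bij_witness[of _ "\<lambda>i. T - i" "\<lambda>i. T - i"]) auto
    also have "(\<Sum>i\<in>{2..T - 2}. b i * e (T - i)) + (\<Sum>i\<in>{2..T - 2}. b i * e (T - i + 1))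
        = (\<Sum>i\<in>{2..T - 2}. b i * (e (T - i) + e (T - i + 1)))"
      by (simp add: sum.distrib distrib_left)
    also have "\<dots> \<le> (\<Sum>i\<le>T - 2. b i * (e (T - i) + e (T - i + 1)))"
      using b0 e(1) by (intro sum_mono2) (auto intro: add_nonneg_nonneg)
    also have "\<dots> \<le> (\<Sum>i\<le>T - 2. b i * (4 * h - b (T - i) - b (T - i + 1)) + 2 * C * B * (1 / real (T - i)))"
    proof (rule sum_mono)
      fix i assume i: "i \<in> {..T - 2}"
      \<comment> \<open>Removing the truncation costs at most \<open>C / j\<close>, since
        \<open>b j \<le> 2 h + C / j\<close>; summed over \<open>i\<close> this is logarithmic in
        \<open>T\<close>.\<close>
      have eup: "e j \<le> 2 * h - b j + C / real (T - i)" if "j \<ge> T - i" for j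
      proof -
        have "C / real j \<le> C / real (T - i)" using C that i T by (intro divide_left_mono) auto
        moreover have "0 \<le> C / real (T - i)" using C by simp
        moreover have "j \<ge> 1" using that i T by auto
        then have "0 \<le> 2 * h - b j + C / real j" using upper by fastforce
        ultimately show ?thesis unfolding e_def by auto
      qed
      have "b i * (e (T - i) + e (T - i + 1)) \<le> b i * (4 * h - b (T - i) - b (T - i + 1) + 2 * (C / real (T - i)))"
        using eup[of "T - i"] eup[of "T - i + 1"] b0 by (intro mult_left_mono) auto
      also have "\<dots> = b i * (4 * h - b (T - i) - b (T - i + 1)) + b i * (2 * (C / real (T - i)))"
        by (simp add: algebra_simps)
      also have "b i * (2 * (C / real (T - i))) \<le> B * (2 * (C / real (T - i)))"
        using B C by (intro mult_right_mono) auto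
      also have "\<dots> = 2 * C * B * (1 / real (T - i))" by simp
      finally show "b i * (e (T - i) + e (T - i + 1))
        \<le> b i * (4 * h - b (T - i) - b (T - i + 1)) + 2 * C * B * (1 / real (T - i))" by simp
    qed
    also have "\<dots> = X T + 2 * C * B * (\<Sum>i\<le>T - 2. 1 / real (T - i))"
      by (simp add: X_def sum.distrib sum_distrib_left)
    also have "(\<Sum>i\<le>T - 2. 1 / real (T - i)) \<le> ln (real T) + 2"
    proof -
      have "(\<Sum>i\<le>T - 2. 1 / real (T - i)) = (\<Sum>j\<in>{2..T}. 1 / real j)"
        using T by (intro sum.reindex_bij_witness[of _ "\<lambda>j. T - j" "\<lambda>i. T - i"]) auto
      also have "\<dots> \<le> (\<Sum>j\<in>{1..T}. 1 / real j)" by (intro sum_mono2) auto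
      also have "\<dots> = harm T" by (simp add: harm_def divide_inverse)
      also have "\<dots> \<le> ln (real T) + euler_mascheroni + 1 / real T" using harm_bounds(2)[of T] T by simp
      also have "\<dots> \<le> ln (real T) + 2"
      proof -
        have "1 / real T \<le> 1" using T by simp
        then show ?thesis using euler_mascheroni_less_13_over_22 by simp
      qed
      finally show ?thesis .
    qed
    finally show ?thesis using D B C h
      by (simp add: w_def B_def mult_left_mono)
  qed
  define \<delta> where "\<delta> = h\<^sup>2 / (64 * D * real R)"
  have \<delta>: "\<delta> > 0" using h D R0 by (simp add: \<delta>_def)
  have lim: "(\<lambda>T. h\<^sup>2 / (8 * D) * (real ((T - 3) div (2 * R)) / real T) - 2 * C * B * ((ln (real T) + 2) / real T))
    \<longlonglongrightarrow> h\<^sup>2 / (8 * D) * (1 / (2 * real R)) - 2 * C * B * 0"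
  proof (intro tendsto_diff tendsto_mult tendsto_const)
    show "(\<lambda>T. (ln (real T) + 2) / real T) \<longlonglongrightarrow> 0" by real_asymp
    show "(\<lambda>T. real ((T - 3) div (2 * R)) / real T) \<longlonglongrightarrow> 1 / (2 * real R)"
    proof (rule tendsto_sandwich)
      show "\<forall>\<^sub>F T in sequentially. ((real T - 3) / (2 * real R) - 1) / real T \<le> real ((T - 3) div (2 * R)) / real T"
        using eventually_ge_at_top[of 3]
      proof eventually_elim
        case (elim T)
        then show ?case using real_div_bounds(2)[of "T - 3" "2 * R"]
          by (intro divide_right_mono) (auto simp: of_nat_diff)
      qed
      show "\<forall>\<^sub>F T in sequentially. real ((T - 3) div (2 * R)) / real T \<le> (real T / (2 * real R)) / real T"
      proof (rule always_eventually, rule allI, rule divide_right_mono)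
        fix T
        have "real ((T - 3) div (2 * R)) \<le> real (T - 3) / real (2 * R)" by (rule real_div_bounds)
        also have "\<dots> \<le> real T / (2 * real R)" by (simp add: divide_right_mono)
        finally show "real ((T - 3) div (2 * R)) \<le> real T / (2 * real R)" .
      qed simp
      have L: "(\<lambda>T. (1 - 3 / real T) * (1 / (2 * real R)) - 1 / real T) \<longlonglongrightarrow> (1 - 0) * (1 / (2 * real R)) - 0"
        by (intro tendsto_intros; real_asymp)
      have ev: "\<forall>\<^sub>F T in sequentially. (1 - 3 / real T) * (1 / (2 * real R)) - 1 / real T
          = ((real T - 3) / (2 * real R) - 1) / real T"
        using eventually_gt_at_top[of 0] by eventually_elim (use R0 in \<open>simp add: field_simps\<close>)
      from Lim_transform_eventually[OF L ev]
      show "(\<lambda>T. ((real T - 3) / (2 * real R) - 1) / real T) \<longlonglongrightarrow> 1 / (2 * real R)" by simp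
      have "\<forall>\<^sub>F T in sequentially. 1 / (2 * real R) = (real T / (2 * real R)) / real T"
        using eventually_gt_at_top[of 0] by eventually_elim simp
      then show "(\<lambda>T. (real T / (2 * real R)) / real T) \<longlonglongrightarrow> 1 / (2 * real R)"
        by (rule Lim_transform_eventually[OF tendsto_const])
    qed
  qed
  have "\<delta> < h\<^sup>2 / (8 * D) * (1 / (2 * real R)) - 2 * C * B * 0"
    using h D R0 by (simp add: \<delta>_def field_simps)
  from order_tendstoD(1)[OF lim this]
  have "\<forall>\<^sub>F T in sequentially. \<delta> * real T \<le> X T"
    using eventually_ge_at_top[of 4]
  proof eventually_elim
    case (elim T)
    have T: "real T > 0" using elim by simp
    have "\<delta> * real T \<le> (h\<^sup>2 / (8 * D) * (real ((T - 3) div (2 * R)) / real T) - 2 * C * B * ((ln (real T) + 2) / real T)) * real T"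
      using elim T by (intro mult_right_mono) auto
    also have "\<dots> = real ((T - 3) div (2 * R)) * (h\<^sup>2 / 8) / D - 2 * C * B * (ln (real T) + 2)"
      using T D by (simp add: field_simps)
    also have "\<dots> \<le> X T"
    proof -
      have "real ((T - 3) div (2 * R)) * (h\<^sup>2 / 8) / D \<le> X T + 2 * C * B * (ln (real T) + 2)"
        using main[OF elim(2)] D by (simp add: divide_le_eq mult.commute)
      then show ?thesis by simp
    qed
    finally show ?case .
  qed
  then show ?thesis using \<delta> unfolding X_def by blast
qed

section \<open>The contradiction for windows without primes\<close>

lemma sum_geometric_windows:
  fixes f :: "nat \<Rightarrow> real"
  assumes q: "q \<ge> 1" and uv: "u \<le> v"
  shows "sum f (nat_window (q ^ u) (q ^ v)) = (\<Sum>i\<in>{u..<v}. sum f (nat_window (q ^ i) (q ^ (i + 1))))"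
  using uv
proof (induction v rule: dec_induct)
  case (step v)
  have "sum f (nat_window (q ^ u) (q ^ Suc v)) = sum f (nat_window (q ^ u) (q ^ v)) + sum f (nat_window (q ^ v) (q ^ Suc v))"
    using q step.hyps by (intro sum_nat_window_split power_increasing) auto
  then show ?case using step by simp
qed simp

text \<open>
  Subtracting the trivial upper bound \<open>2 h T\<close> from the convolution in Selberg's formula: if the
  mass of \<open>(q\<^sup>T, q\<^sup>T\<^sup>+\<^sup>3]\<close> is negligible, then the convolution must be almost as large as possible.
\<close>

lemma reflected_sum_upper_bound:
  assumes q: "q > 1"
  defines "b \<equiv> \<lambda>i. mangoldt_mass (q ^ i) (q ^ (i + 1))" and "h \<equiv> ln q"
  shows "\<exists>C. \<forall>T\<ge>2. (\<Sum>i\<le>T - 2. b i * (4 * h - b (T - i) - b (T - i + 1)))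
    \<le> C * (1 + ln (real T)) + mangoldt_mass (q ^ T) (q ^ (T + 3)) * ln (q ^ (T + 3))"
proof -
  have h: "h > 0" using q by (simp add: h_def)
  have b0: "0 \<le> b i" for i by (simp add: b_def mangoldt_mass_nonneg)
  have q3: "q ^ 3 \<ge> 1" using q by (simp add: one_le_power)
  obtain C1 where C1: "\<And>y z. 1 \<le> y \<Longrightarrow> y \<le> z \<Longrightarrow> z \<le> q ^ 3 * y \<Longrightarrow>
    \<bar>(\<Sum>n\<in>nat_window y z. selberg_lambda n / real n) - 2 * ln (z / y) * ln y\<bar> \<le> C1"
    using selberg_window[OF q3] by blast
  obtain C2 where C2: "C2 \<ge> 0" "\<And>y z. 1 < y \<Longrightarrow> y \<le> z \<Longrightarrow> z \<le> q ^ 3 * y \<Longrightarrow>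
    mangoldt_mass y z \<le> 2 * ln (z / y) + C2 / ln y"
    using mangoldt_mass_upper[OF q3] by blast
  define Bb where "Bb = h + 14"
  have b_le: "b i \<le> Bb" for i
  proof -
    have "\<bar>mangoldt_mass (q ^ i) (q ^ (i + 1)) - ln (q ^ (i + 1) / q ^ i)\<bar> \<le> 14"
      using q by (intro mangoldt_mass_mertens one_le_power power_increasing) auto
    from abs_le_D1[OF this] show ?thesis using q by (simp add: b_def Bb_def h_def)
  qed
  \<comment> \<open>For \<open>i \<ge> T - 1\<close> the scaled windows end below
    \<open>q ^ 4\<close>. Their mass is bounded crudely, because the estimate for the other
    \<open>i\<close> divides by the logarithm of the left endpoint.\<close>
  define W4 where "W4 = mangoldt_mass 0 (q ^ 4)"
  have W4: "W4 \<ge> 0" by (simp add: W4_def mangoldt_mass_nonneg)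
  define C where "C = 84 * h + \<bar>C1\<bar> + 4 * Bb * W4 + 4 * Bb * C2 / h"
  show ?thesis
  proof (intro exI[of _ C] allI impI)
    fix T :: nat assume T: "T \<ge> 2"
    define x z where "x = q ^ T" and "z = q ^ (T + 3)"
    have x: "x \<ge> 1" "x > 0" using q by (auto simp: x_def one_le_power)
    have zx: "z = q ^ 3 * x" by (simp add: x_def z_def power_add mult.commute)
    have xz: "x \<le> z" using q by (simp add: x_def z_def power_increasing)
    have lnx: "ln x = real T * h" using q by (simp add: x_def h_def ln_realpow)
    have lnzx: "ln (z / x) = 3 * h" using q x by (simp add: zx h_def ln_realpow)
    define E where "E = mangoldt_mass x z * ln z"
    define cv where "cv n = (\<Sum>d | d dvd n. \<Lambda> d * \<Lambda> (n div d))" for n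
    have "6 * h * (real T * h) - \<bar>C1\<bar> \<le> (\<Sum>n\<in>nat_window x z. selberg_lambda n / real n)"
    proof -
      have "\<bar>(\<Sum>n\<in>nat_window x z. selberg_lambda n / real n) - 2 * ln (z / x) * ln x\<bar> \<le> C1"
        using x xz zx by (intro C1) auto
      from abs_le_D2[OF this] show ?thesis unfolding lnx lnzx by simp
    qed
    also have "\<dots> = (\<Sum>n\<in>nat_window x z. \<Lambda> n / real n * ln (real n)) + (\<Sum>n\<in>nat_window x z. cv n / real n)"
      by (simp add: selberg_lambda_def cv_def sum.distrib[symmetric] add_divide_distrib)
    also have "(\<Sum>n\<in>nat_window x z. \<Lambda> n / real n * ln (real n)) \<le> (\<Sum>n\<in>nat_window x z. \<Lambda> n / real n * ln z)"
    proof (intro sum_mono mult_left_mono)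
      fix n assume "n \<in> nat_window x z"
      then have "x < real n" "real n \<le> z" using mem_nat_window[of x n z] x by auto
      then show "ln (real n) \<le> ln z" using x by (intro ln_mono) auto
    qed (simp add: mangoldt_nonneg)
    also have "(\<Sum>n\<in>nat_window x z. \<Lambda> n / real n * ln z) = E"
      by (simp add: E_def mangoldt_mass_def sum_distrib_right)
    also have "(\<Sum>n\<in>nat_window x z. cv n / real n)
        = (\<Sum>k\<in>{1..nat \<lfloor>z\<rfloor>}. \<Lambda> k / real k * mangoldt_mass (x / real k) (z / real k))"
      unfolding cv_def using x xz by (intro sum_mangoldt_convolution_window) auto
    also have "\<dots> = (\<Sum>k\<in>nat_window (q ^ 0) (q ^ (T + 3)). \<Lambda> k / real k * mangoldt_mass (x / real k) (z / real k))"
    proof (rule sum.mono_neutral_right)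
      show "nat_window (q ^ 0) (q ^ (T + 3)) \<subseteq> {1..nat \<lfloor>z\<rfloor>}" by (auto simp: z_def)
      show "\<forall>k\<in>{1..nat \<lfloor>z\<rfloor>} - nat_window (q ^ 0) (q ^ (T + 3)). \<Lambda> k / real k * mangoldt_mass (x / real k) (z / real k) = 0"
      proof
        fix k assume "k \<in> {1..nat \<lfloor>z\<rfloor>} - nat_window (q ^ 0) (q ^ (T + 3))"
        then have "k = Suc 0" by (auto simp: z_def)
        then show "\<Lambda> k / real k * mangoldt_mass (x / real k) (z / real k) = 0" by simp
      qed
    qed simp
    also have "\<dots> = (\<Sum>i\<in>{0..<T + 3}. \<Sum>k\<in>nat_window (q ^ i) (q ^ (i + 1)).
        \<Lambda> k / real k * mangoldt_mass (x / real k) (z / real k))"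
      using q by (intro sum_geometric_windows) auto
    also have "{0..<T + 3} = {..T - 2} \<union> {T - 1..<T + 3}" using T by auto
    also have "(\<Sum>i\<in>{..T - 2} \<union> {T - 1..<T + 3}. \<Sum>k\<in>nat_window (q ^ i) (q ^ (i + 1)).
        \<Lambda> k / real k * mangoldt_mass (x / real k) (z / real k))
      = (\<Sum>i\<le>T - 2. \<Sum>k\<in>nat_window (q ^ i) (q ^ (i + 1)). \<Lambda> k / real k * mangoldt_mass (x / real k) (z / real k))
      + (\<Sum>i\<in>{T - 1..<T + 3}. \<Sum>k\<in>nat_window (q ^ i) (q ^ (i + 1)). \<Lambda> k / real k * mangoldt_mass (x / real k) (z / real k))"
      using T by (intro sum.union_disjoint) auto
    also have "(\<Sum>i\<in>{T - 1..<T + 3}. \<Sum>k\<in>nat_window (q ^ i) (q ^ (i + 1)). \<Lambda> k / real k * mangoldt_mass (x / real k) (z / real k))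
      \<le> (\<Sum>i\<in>{T - 1..<T + 3}. Bb * W4)"
    proof (rule sum_mono)
      fix i assume i: "i \<in> {T - 1..<T + 3}"
      have "(\<Sum>k\<in>nat_window (q ^ i) (q ^ (i + 1)). \<Lambda> k / real k * mangoldt_mass (x / real k) (z / real k))
        \<le> (\<Sum>k\<in>nat_window (q ^ i) (q ^ (i + 1)). \<Lambda> k / real k * W4)"
      proof (intro sum_mono mult_left_mono)
        fix k assume "k \<in> nat_window (q ^ i) (q ^ (i + 1))"
        then have k: "q ^ i < real k" using mem_nat_window[of "q ^ i" k] q by auto
        have qi: "q ^ i > 0" using q by simp
        have "z / real k \<le> z / q ^ i" using k qi x xz by (intro divide_left_mono) auto
        also have "z / q ^ i = q ^ (T + 3 - i)" using i q by (simp add: z_def power_diff)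
        also have "\<dots> \<le> q ^ 4" using q i T by (intro power_increasing) auto
        finally show "mangoldt_mass (x / real k) (z / real k) \<le> W4"
          unfolding W4_def using x by (intro mangoldt_mass_mono) auto
      qed (simp add: mangoldt_nonneg)
      also have "\<dots> = b i * W4" by (simp add: b_def mangoldt_mass_def sum_distrib_right)
      also have "\<dots> \<le> Bb * W4" using b_le W4 by (intro mult_right_mono) auto
      finally show "(\<Sum>k\<in>nat_window (q ^ i) (q ^ (i + 1)). \<Lambda> k / real k * mangoldt_mass (x / real k) (z / real k)) \<le> Bb * W4" .
    qed
    also have "(\<Sum>i\<in>{T - 1..<T + 3}. Bb * W4) = 4 * Bb * W4" using T by simp
    also have "(\<Sum>i\<le>T - 2. \<Sum>k\<in>nat_window (q ^ i) (q ^ (i + 1)). \<Lambda> k / real k * mangoldt_mass (x / real k) (z / real k))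
      \<le> (\<Sum>i\<le>T - 2. b i * (b (T - i) + b (T - i + 1)) + 2 * h * b i + 2 * Bb * C2 / h * (1 / real (T - i - 1)))"
    proof (rule sum_mono)
      fix i assume i: "i \<in> {..T - 2}"
      define j where "j = T - i"
      have j: "j \<ge> 2" "T = j + i" using i T by (auto simp: j_def)
      \<comment> \<open>A scaled window has logarithmic length \<open>3 h\<close> and contains
        \<open>(q^j, q^(j+2)]\<close>, whose mass is \<open>b j + b (j + 1)\<close>. The two ends
        have total length \<open>h\<close> and are bounded by the factor 2, whence
        \<open>2 h\<close> and two errors. Three steps are taken so that two complete windows always
        fit inside.\<close>
      define G where "G = b j + b (j + 1) + 2 * h + 2 * (C2 / (real (j - 1) * h))"
      have "(\<Sum>k\<in>nat_window (q ^ i) (q ^ (i + 1)). \<Lambda> k / real k * mangoldt_mass (x / real k) (z / real k))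
        \<le> (\<Sum>k\<in>nat_window (q ^ i) (q ^ (i + 1)). \<Lambda> k / real k * G)"
      proof (intro sum_mono mult_left_mono)
        fix k assume "k \<in> nat_window (q ^ i) (q ^ (i + 1))"
        then have k: "q ^ i < real k" "real k \<le> q ^ (i + 1)" using mem_nat_window[of "q ^ i" k] q by auto
        have qi: "q ^ i > 0" using q by simp
        have k0: "real k > 0" using k(1) qi by linarith
        define y1 where "y1 = x / real k"
        have xq: "x = q ^ j * q ^ i" "x = q ^ (j - 1) * q ^ (i + 1)"
        proof -
          have "T = j - 1 + (i + 1)" using j by simp
          then show "x = q ^ (j - 1) * q ^ (i + 1)" unfolding x_def by (metis power_add)
          show "x = q ^ j * q ^ i" unfolding x_def j(2) by (rule power_add)
        qed
        have y1: "q ^ (j - 1) \<le> y1" "y1 \<le> q ^ j"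
        proof -
          have "q ^ (j - 1) * real k \<le> q ^ (j - 1) * q ^ (i + 1)" using k q by (intro mult_left_mono) auto
          then show "q ^ (j - 1) \<le> y1" using k0 unfolding y1_def xq(2) by (simp add: le_divide_eq)
          have "q ^ j * q ^ i \<le> q ^ j * real k" using k q by (intro mult_left_mono) auto
          then show "y1 \<le> q ^ j" using k0 unfolding y1_def xq(1) by (simp add: divide_le_eq)
        qed
        have qj: "q ^ (j - 1) > 1" using j q by (intro one_less_power) auto
        have y1_1: "y1 > 1" using y1 qj by simp
        have zk: "z / real k = q ^ 3 * y1" by (simp add: zx y1_def)
        have ly: "real (j - 1) * h \<le> ln y1" "0 < real (j - 1) * h"
        proof -
          have "ln (q ^ (j - 1)) \<le> ln y1" using y1 qj by (intro ln_mono) auto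
          then show "real (j - 1) * h \<le> ln y1" using q by (simp add: h_def ln_realpow)
          show "0 < real (j - 1) * h" using j h by simp
        qed
        have ly0: "0 < ln y1" using ly by linarith
        have qjj: "q ^ j \<le> q ^ (j + 2)" using q by (intro power_increasing) auto
        have lq: "ln (q ^ (j + 2)) = real (j + 2) * h" unfolding h_def by (rule ln_realpow)
        have qj3: "q ^ (j + 2) = q ^ 3 * q ^ (j - 1)" using j by (simp add: power_add[symmetric])
        have up1: "mangoldt_mass y1 (q ^ j) \<le> 2 * ln (q ^ j / y1) + C2 / (real (j - 1) * h)"
        proof -
          have "q ^ j \<le> q ^ (j + 2)" using q by (intro power_increasing) auto
          also have "\<dots> \<le> q ^ 3 * y1" unfolding qj3 using y1 q by (intro mult_left_mono) auto
          finally have "mangoldt_mass y1 (q ^ j) \<le> 2 * ln (q ^ j / y1) + C2 / ln y1"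
            using y1 y1_1 by (intro C2(2)) auto
          also have "C2 / ln y1 \<le> C2 / (real (j - 1) * h)"
            by (rule divide_left_mono[OF ly(1) C2(1) mult_pos_pos[OF ly0 ly(2)]])
          finally show ?thesis by simp
        qed
        have up2: "mangoldt_mass (q ^ (j + 2)) (q ^ 3 * y1) \<le> 2 * ln (q ^ 3 * y1 / q ^ (j + 2)) + C2 / (real (j - 1) * h)"
        proof -
          have le: "q ^ (j + 2) \<le> q ^ 3 * y1" unfolding qj3 using y1 q by (intro mult_left_mono) auto
          have "y1 \<le> q ^ (j + 2)" using y1(2) qjj by linarith
          then have "q ^ 3 * y1 \<le> q ^ 3 * q ^ (j + 2)" using q by (intro mult_left_mono) auto
          then have "mangoldt_mass (q ^ (j + 2)) (q ^ 3 * y1) \<le> 2 * ln (q ^ 3 * y1 / q ^ (j + 2)) + C2 / ln (q ^ (j + 2))"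
            using le q by (intro C2(2) one_less_power) auto
          also have "C2 / ln (q ^ (j + 2)) \<le> C2 / (real (j - 1) * h)"
          proof (rule divide_left_mono[OF _ C2(1)])
            have "real (j - 1) * h \<le> real (j + 2) * h" using h j by (intro mult_right_mono) auto
            then show le: "real (j - 1) * h \<le> ln (q ^ (j + 2))" unfolding lq .
            then have "0 < ln (q ^ (j + 2))" using ly(2) by linarith
            from mult_pos_pos[OF this ly(2)] show "0 < ln (q ^ (j + 2)) * (real (j - 1) * h)" .
          qed
          finally show ?thesis by simp
        qed
        have le2: "q ^ j \<le> q ^ (j + 2)" "q ^ (j + 2) \<le> q ^ 3 * y1"
        proof -
          show "q ^ j \<le> q ^ (j + 2)" by (rule qjj)
          show "q ^ (j + 2) \<le> q ^ 3 * y1" unfolding qj3 using y1 q by (intro mult_left_mono) auto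
        qed
        have arith: "m1 + B + m2 \<le> B + 2 * (l1 + l2) + 2 * r"
          if "m1 \<le> 2 * l1 + r" "m2 \<le> 2 * l2 + r" for m1 m2 l1 l2 r B :: real
          using add_mono[OF that] by (simp add: algebra_simps)
        have "mangoldt_mass y1 (q ^ 3 * y1) = mangoldt_mass y1 (q ^ j) + mangoldt_mass (q ^ j) (q ^ (j + 2))
            + mangoldt_mass (q ^ (j + 2)) (q ^ 3 * y1)"
          using mangoldt_mass_split[of y1 "q ^ j" "q ^ 3 * y1"] mangoldt_mass_split[OF le2] y1 le2 by simp
        also have "mangoldt_mass (q ^ j) (q ^ (j + 2)) = b j + b (j + 1)"
          unfolding b_def using q
          by (subst mangoldt_mass_split[of "q ^ j" "q ^ (j + 1)"]) (auto intro: power_increasing simp: add.assoc)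
        also have "mangoldt_mass y1 (q ^ j) + (b j + b (j + 1)) + mangoldt_mass (q ^ (j + 2)) (q ^ 3 * y1)
          \<le> b j + b (j + 1) + 2 * (ln (q ^ j / y1) + ln (q ^ 3 * y1 / q ^ (j + 2))) + 2 * (C2 / (real (j - 1) * h))"
          by (rule arith[OF up1 up2])
        also have "ln (q ^ j / y1) + ln (q ^ 3 * y1 / q ^ (j + 2)) = h"
        proof -
          have "ln (q ^ j / y1) + ln (q ^ 3 * y1 / q ^ (j + 2)) = ln (q ^ j / y1 * (q ^ 3 * y1 / q ^ (j + 2)))"
            using q y1_1 by (subst ln_mult) auto
          also have "q ^ j / y1 * (q ^ 3 * y1 / q ^ (j + 2)) = q"
            using q y1_1 by (simp add: field_simps power_add power3_eq_cube power2_eq_square)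
          finally show ?thesis by (simp add: h_def)
        qed
        finally show "mangoldt_mass (x / real k) (z / real k) \<le> G"
          unfolding zk y1_def[symmetric] G_def by simp
      qed (simp add: mangoldt_nonneg)
      also have "\<dots> = b i * G" by (simp add: b_def mangoldt_mass_def sum_distrib_right)
      also have "\<dots> = b i * (b j + b (j + 1)) + 2 * h * b i + b i * (2 * (C2 / (real (j - 1) * h)))"
        by (simp add: G_def algebra_simps)
      also have "b i * (2 * (C2 / (real (j - 1) * h))) \<le> Bb * (2 * (C2 / (real (j - 1) * h)))"
        using b_le C2(1) h by (intro mult_right_mono) auto
      also have "\<dots> = 2 * Bb * C2 / h * (1 / real (T - i - 1))" by (simp add: j_def mult_ac)
      finally show "(\<Sum>k\<in>nat_window (q ^ i) (q ^ (i + 1)). \<Lambda> k / real k * mangoldt_mass (x / real k) (z / real k))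
        \<le> b i * (b (T - i) + b (T - i + 1)) + 2 * h * b i + 2 * Bb * C2 / h * (1 / real (T - i - 1))"
        by (simp add: j_def)
    qed
    also have "\<dots> = (\<Sum>i\<le>T - 2. b i * (b (T - i) + b (T - i + 1))) + 2 * h * (\<Sum>i\<le>T - 2. b i)
        + 2 * Bb * C2 / h * (\<Sum>i\<le>T - 2. 1 / real (T - i - 1))"
      by (simp add: sum.distrib sum_distrib_left)
    also have "2 * Bb * C2 / h * (\<Sum>i\<le>T - 2. 1 / real (T - i - 1)) \<le> 2 * Bb * C2 / h * (ln (real T) + 2)"
    proof (rule mult_left_mono)
      have "(\<Sum>i\<le>T - 2. 1 / real (T - i - 1)) = (\<Sum>j\<in>{1..T - 1}. 1 / real j)"
        using T by (intro sum.reindex_bij_witness[of _ "\<lambda>j. T - 1 - j" "\<lambda>i. T - 1 - i"]) auto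
      also have "\<dots> \<le> (\<Sum>j\<in>{1..T}. 1 / real j)" by (intro sum_mono2) auto
      also have "\<dots> = harm T" by (simp add: harm_def divide_inverse)
      also have "\<dots> \<le> ln (real T) + euler_mascheroni + 1 / real T" using harm_bounds(2)[of T] T by simp
      also have "\<dots> \<le> ln (real T) + 2"
      proof -
        have "1 / real T \<le> 1" using T by simp
        then show ?thesis using euler_mascheroni_less_13_over_22 by simp
      qed
      finally show "(\<Sum>i\<le>T - 2. 1 / real (T - i - 1)) \<le> ln (real T) + 2" .
      show "0 \<le> 2 * Bb * C2 / h" using C2(1) h by (simp add: Bb_def)
    qed
    finally have main: "6 * h * (real T * h) - \<bar>C1\<bar> \<le> E + ((\<Sum>i\<le>T - 2. b i * (b (T - i) + b (T - i + 1)))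
        + 2 * h * (\<Sum>i\<le>T - 2. b i) + 2 * Bb * C2 / h * (ln (real T) + 2) + 4 * Bb * W4)"
      by (simp add: add.assoc)
    have sumb: "(\<Sum>i\<le>T - 2. b i) \<le> real T * h + 14"
    proof -
      have idx: "{..T - 2} = {0..<T - 1}" using T by auto
      have "(\<Sum>i\<le>T - 2. b i) = mangoldt_mass (q ^ 0) (q ^ (T - 1))"
        unfolding idx b_def mangoldt_mass_def by (rule sum_geometric_windows[symmetric]) (use q in auto)
      also have "\<dots> \<le> ln (q ^ (T - 1) / q ^ 0) + 14"
      proof -
        have "\<bar>mangoldt_mass (q ^ 0) (q ^ (T - 1)) - ln (q ^ (T - 1) / q ^ 0)\<bar> \<le> 14"
          using q by (intro mangoldt_mass_mertens power_increasing) auto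
        from abs_le_D1[OF this] show ?thesis by simp
      qed
      also have "ln (q ^ (T - 1) / q ^ 0) = real (T - 1) * h" using q by (simp add: h_def ln_realpow)
      also have "\<dots> \<le> real T * h" using h by (intro mult_right_mono) auto
      finally show ?thesis by simp
    qed
    have "(\<Sum>i\<le>T - 2. b i * (4 * h - b (T - i) - b (T - i + 1)))
        = 4 * h * (\<Sum>i\<le>T - 2. b i) - (\<Sum>i\<le>T - 2. b i * (b (T - i) + b (T - i + 1)))"
      by (simp add: sum_distrib_left sum_subtractf[symmetric] algebra_simps)
    \<comment> \<open>Here Selberg's formula enters through \<open>main\<close>. After the bound for
      the sum of \<open>b\<close> the terms of order \<open>T\<close> cancel, leaving
      \<open>6 * 14 = 84\<close> times \<open>h\<close> and logarithmic errors.\<close>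
    also have "\<dots> \<le> 6 * h * (\<Sum>i\<le>T - 2. b i) - 6 * h * (real T * h) + \<bar>C1\<bar> + E + 2 * Bb * C2 / h * (ln (real T) + 2) + 4 * Bb * W4"
      using main by simp
    also have "6 * h * (\<Sum>i\<le>T - 2. b i) \<le> 6 * h * (real T * h + 14)" using sumb h by (intro mult_left_mono) auto
    also have "6 * h * (real T * h + 14) - 6 * h * (real T * h) + \<bar>C1\<bar> + E + 2 * Bb * C2 / h * (ln (real T) + 2) + 4 * Bb * W4
      \<le> C * (1 + ln (real T)) + E"
    proof -
      have l: "0 \<le> ln (real T)" using T by simp
      define c0 where "c0 = 84 * h + \<bar>C1\<bar> + 4 * Bb * W4"
      define c1 where "c1 = 2 * Bb * C2 / h"
      have c: "0 \<le> c0" "0 \<le> c1" using h W4 C2(1) by (auto simp: c0_def c1_def Bb_def)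
      have C: "C = c0 + 2 * c1" by (simp add: C_def c0_def c1_def)
      have "c1 * (ln (real T) + 2) \<le> 2 * c1 * (1 + ln (real T))" using c l by (simp add: algebra_simps)
      moreover have "c0 \<le> c0 * (1 + ln (real T))" using c l by (simp add: algebra_simps)
      ultimately have "c0 + c1 * (ln (real T) + 2) \<le> C * (1 + ln (real T))"
        unfolding C by (simp add: algebra_simps)
      then show ?thesis unfolding c0_def c1_def by (simp add: algebra_simps)
    qed
    finally show "(\<Sum>i\<le>T - 2. b i * (4 * h - b (T - i) - b (T - i + 1)))
      \<le> C * (1 + ln (real T)) + mangoldt_mass (q ^ T) (q ^ (T + 3)) * ln (q ^ (T + 3))"
      by (simp add: E_def x_def z_def)
  qed
qed

text \<open>Only proper prime powers remain. Their bases are at most \<open>sqrt z\<close> and their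
  exponents at most \<open>log 2 z\<close>, so there are too few of them to carry noticeable
  mass.\<close>

lemma mangoldt_mass_no_primes_le:
  assumes x: "x \<ge> 1" and xz: "x \<le> z" and no: "\<And>p. prime p \<Longrightarrow> \<not> (x < real p \<and> real p \<le> z)"
  shows "mangoldt_mass x z \<le> (sqrt z + 1) * (log 2 z + 1) * (ln z / x)"
proof -
  define P where "P = {n \<in> nat_window x z. primepow n}"
  have z: "z \<ge> 1" using x xz by simp
  define U where "U = {..nat \<lfloor>sqrt z\<rfloor>} \<times> {..nat \<lfloor>log 2 z\<rfloor>}"
  have "P \<subseteq> (\<lambda>(p, k). p ^ k) ` U"
  proof
    fix n assume n: "n \<in> P"
    then obtain p k where pk: "prime p" "k > 0" "n = p ^ k" by (auto simp: P_def primepow_def)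
    have nz: "x < real n" "real n \<le> z" using n mem_nat_window[of x n z] x by (auto simp: P_def)
    have "k \<noteq> 1" using no[OF pk(1)] nz pk(3) by auto
    then have k2: "k \<ge> 2" using pk(2) by simp
    have p2: "2 \<le> real p" using prime_ge_2_nat[OF pk(1)] by simp
    have "real p ^ 2 \<le> real p ^ k" using p2 k2 by (intro power_increasing) auto
    then have "real p ^ 2 \<le> z" using nz pk(3) by simp
    then have "real p \<le> sqrt z" by (intro real_le_rsqrt)
    then have 1: "p \<le> nat \<lfloor>sqrt z\<rfloor>" by (simp add: le_nat_floor)
    have "2 ^ k \<le> real p ^ k" using p2 by (intro power_mono) auto
    then have "2 ^ k \<le> z" using nz pk(3) by simp
    then have "log 2 (2 ^ k) \<le> log 2 z" using z by (subst log_le_cancel_iff) auto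
    then have "real k \<le> log 2 z" by (simp add: log_nat_power)
    then have 2: "k \<le> nat \<lfloor>log 2 z\<rfloor>" by (simp add: le_nat_floor)
    show "n \<in> (\<lambda>(p, k). p ^ k) ` U" using 1 2 pk(3) by (auto simp: U_def)
  qed
  then have "card P \<le> card ((\<lambda>(p, k). p ^ k) ` U)" by (intro card_mono) (auto simp: U_def)
  also have "\<dots> \<le> card U" by (rule card_image_le) (simp add: U_def)
  also have "card U = (nat \<lfloor>sqrt z\<rfloor> + 1) * (nat \<lfloor>log 2 z\<rfloor> + 1)" by (simp add: U_def card_cartesian_product)
  finally have "real (card P) \<le> real ((nat \<lfloor>sqrt z\<rfloor> + 1) * (nat \<lfloor>log 2 z\<rfloor> + 1))"
    by (simp only: of_nat_le_iff)
  also have "\<dots> = (real (nat \<lfloor>sqrt z\<rfloor>) + 1) * (real (nat \<lfloor>log 2 z\<rfloor>) + 1)" by (simp add: algebra_simps)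
  also have "\<dots> \<le> (sqrt z + 1) * (log 2 z + 1)"
    using z by (intro mult_mono add_mono) (auto simp: of_nat_nat)
  finally have card: "real (card P) \<le> (sqrt z + 1) * (log 2 z + 1)" .
  have "mangoldt_mass x z = (\<Sum>n\<in>P. \<Lambda> n / real n)"
    unfolding mangoldt_mass_def P_def by (intro sum.mono_neutral_right) (auto simp: mangoldt_def)
  also have "\<dots> \<le> (\<Sum>n\<in>P. ln z / x)"
  proof (intro sum_mono frac_le)
    fix n assume n: "n \<in> P"
    then have nz: "x < real n" "real n \<le> z" using mem_nat_window[of x n z] x by (auto simp: P_def)
    then have "n > 0" using x by (intro Nat.gr0I) auto
    then have "\<Lambda> n \<le> ln (real n)" by (rule mangoldt_le)
    also have "\<dots> \<le> ln z" using nz \<open>n > 0\<close> by (intro ln_mono) auto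
    finally show "\<Lambda> n \<le> ln z" .
    show "x \<le> real n" using nz by simp
  qed (use x z in auto)
  also have "\<dots> = real (card P) * (ln z / x)" by simp
  also have "\<dots> \<le> (sqrt z + 1) * (log 2 z + 1) * (ln z / x)"
    using card x z by (intro mult_right_mono) auto
  finally show ?thesis .
qed

text \<open>Without primes the reflected sum would grow at most like \<open>ln T\<close>, against
  its linear lower bound.\<close>

lemma eventually_prime_in_geometric_window:
  assumes q: "q > (1 :: real)"
  shows "\<forall>\<^sub>F T in sequentially. \<exists>p. prime p \<and> q ^ T < real p \<and> real p \<le> q ^ (T + 3)"
proof -
  define b where "b i = mangoldt_mass (q ^ i) (q ^ (i + 1))" for i
  define h where "h = ln q"
  have h: "h > 0" using q by (simp add: h_def)
  have q1: "q \<ge> 1" using q by simp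
  obtain C1 where C1: "C1 \<ge> 0" "\<And>y z. 1 < y \<Longrightarrow> y \<le> z \<Longrightarrow> z \<le> q * y \<Longrightarrow>
    mangoldt_mass y z \<le> 2 * ln (z / y) + C1 / ln y"
    using mangoldt_mass_upper[OF q1] by blast
  define C where "C = C1 / h + 14"
  have "\<exists>\<delta>>0. \<forall>\<^sub>F T in sequentially. \<delta> * real T \<le> (\<Sum>i\<le>T - 2. b i * (4 * h - b (T - i) - b (T - i + 1)))"
  proof (rule reflected_sum_lower_bound[OF h])
    show "0 \<le> C" using C1(1) h by (simp add: C_def)
    show "0 \<le> b i" for i by (simp add: b_def mangoldt_mass_nonneg)
    show "b i \<le> 2 * h + C / real i" if i: "i \<ge> 1" for i
    proof -
      have "b i \<le> 2 * ln (q ^ (i + 1) / q ^ i) + C1 / ln (q ^ i)"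
        unfolding b_def using q i by (intro C1(2) one_less_power power_increasing) auto
      also have "\<dots> = 2 * h + (C1 / h) / real i" using q by (simp add: h_def ln_realpow)
      also have "(C1 / h) / real i \<le> C / real i" unfolding C_def by (rule divide_right_mono) simp_all
      finally show ?thesis by simp
    qed
    show "\<bar>(\<Sum>i\<in>{u..<v}. b i) - real (v - u) * h\<bar> \<le> C" if "u \<le> v" for u v
    proof -
      have "(\<Sum>i\<in>{u..<v}. b i) = mangoldt_mass (q ^ u) (q ^ v)"
        unfolding b_def mangoldt_mass_def by (rule sum_geometric_windows[symmetric]) (use q1 that in auto)
      moreover have "ln (q ^ v / q ^ u) = real (v - u) * h"
        using q that by (simp add: h_def ln_div ln_realpow of_nat_diff algebra_simps)
      moreover have "\<bar>mangoldt_mass (q ^ u) (q ^ v) - ln (q ^ v / q ^ u)\<bar> \<le> 14"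
        using q1 that by (intro mangoldt_mass_mertens one_le_power power_increasing) auto
      moreover have "0 \<le> C1 / h" using C1(1) h by simp
      ultimately show ?thesis by (simp add: C_def)
    qed
  qed
  then obtain \<delta> where \<delta>: "\<delta> > 0" and lower: "\<forall>\<^sub>F T in sequentially.
      \<delta> * real T \<le> (\<Sum>i\<le>T - 2. b i * (4 * h - b (T - i) - b (T - i + 1)))" by blast
  obtain C' where upper: "\<And>T. T \<ge> 2 \<Longrightarrow> (\<Sum>i\<le>T - 2. b i * (4 * h - b (T - i) - b (T - i + 1)))
    \<le> C' * (1 + ln (real T)) + mangoldt_mass (q ^ T) (q ^ (T + 3)) * ln (q ^ (T + 3))"
    using reflected_sum_upper_bound[OF q] unfolding b_def h_def by blast
  have "((\<lambda>z. (sqrt z + 1) * (ln z / ln 2 + 1) * (ln z)\<^sup>2 / z) \<longlongrightarrow> 0) at_top" by real_asymp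
  from tendsto_mult[OF tendsto_const this]
  have "((\<lambda>z. q ^ 3 * ((sqrt z + 1) * (log 2 z + 1) * (ln z)\<^sup>2 / z)) \<longlongrightarrow> q ^ 3 * 0) at_top"
    unfolding log_def .
  moreover have "filterlim (\<lambda>T. q ^ (T + 3)) at_top sequentially"
  proof -
    have "filterlim (\<lambda>T. q ^ T) at_infinity sequentially"
      using q by (intro filterlim_realpow_sequentially_gt1) simp
    then have "filterlim (\<lambda>T. q ^ T) at_top sequentially"
      by (rule filterlim_at_infinity_imp_filterlim_at_top) (use q in simp)
    from filterlim_compose[OF this filterlim_add_const_nat_at_top[of 3]] show ?thesis .
  qed
  ultimately have "(\<lambda>T. q ^ 3 * ((sqrt (q ^ (T + 3)) + 1) * (log 2 (q ^ (T + 3)) + 1) * (ln (q ^ (T + 3)))\<^sup>2 / q ^ (T + 3)))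
      \<longlonglongrightarrow> q ^ 3 * 0" by (rule filterlim_compose)
  then have small: "\<forall>\<^sub>F T in sequentially.
      q ^ 3 * ((sqrt (q ^ (T + 3)) + 1) * (log 2 (q ^ (T + 3)) + 1) * (ln (q ^ (T + 3)))\<^sup>2 / q ^ (T + 3)) < 1"
    by (rule order_tendstoD) simp
  have "(\<lambda>T. C' * ((1 + ln (real T)) / real T) + 1 / real T) \<longlonglongrightarrow> C' * 0 + 0"
    by (intro tendsto_add tendsto_mult tendsto_const) real_asymp+
  then have "\<forall>\<^sub>F T in sequentially. C' * ((1 + ln (real T)) / real T) + 1 / real T < \<delta>"
    by (rule order_tendstoD) (simp add: \<delta>)
  then show ?thesis using lower small eventually_ge_at_top[of 2]
  proof eventually_elim
    case (elim T)
    show ?case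
    proof (rule ccontr)
      assume neg: "\<not> ?thesis"
      define x z where "x = q ^ T" and "z = q ^ (T + 3)"
      have x: "x \<ge> 1" "x \<le> z" using q1 by (auto simp: x_def z_def one_le_power power_increasing)
      have zx: "z = q ^ 3 * x" by (simp add: x_def z_def power_add mult.commute)
      have T: "real T > 0" using elim by simp
      have "mangoldt_mass x z * ln z \<le> (sqrt z + 1) * (log 2 z + 1) * (ln z / x) * ln z"
        using neg x by (intro mult_right_mono mangoldt_mass_no_primes_le) (auto simp: x_def z_def)
      also have "\<dots> = q ^ 3 * ((sqrt z + 1) * (log 2 z + 1) * (ln z)\<^sup>2 / z)"
        using q x by (simp add: zx power2_eq_square)
      also have "\<dots> < 1" using elim(3) by (simp add: z_def)
      finally have "\<delta> * real T < C' * (1 + ln (real T)) + 1"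
        using elim(2) upper[OF elim(4)] unfolding x_def z_def by linarith
      also have "\<dots> = (C' * ((1 + ln (real T)) / real T) + 1 / real T) * real T"
        using T by (simp add: distrib_right)
      also have "\<dots> < \<delta> * real T" using elim(1) T by (intro mult_strict_right_mono) auto
      finally have "\<delta> * real T < \<delta> * real T" .
      then show False by (rule less_irrefl[THEN notE])
    qed
  qed
qed

text \<open>For \<open>q^k \<le> y \<le> q^(k+1)\<close> a prime is taken from
  \<open>(q^(k-3), q^k]\<close>. It is at most \<open>y\<close> and at least \<open>y / q^4\<close>,
  which explains the fourth root in \<open>q\<close>.\<close>

theorem eventually_prime_between:
  assumes \<eta>: "0 < \<eta>" "\<eta> < (1 :: real)"
  shows "\<forall>\<^sub>F y in at_top. \<exists>p. prime p \<and> (1 - \<eta>) * y \<le> real p \<and> real p \<le> y"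
proof -
  define q where "q = (1 / (1 - \<eta>)) powr (1 / 4)"
  have q: "q > 1" unfolding q_def using \<eta> by (intro gr_one_powr) auto
  have q4: "q ^ 4 = 1 / (1 - \<eta>)"
    unfolding q_def using \<eta> by (simp add: powr_realpow[symmetric] powr_powr)
  obtain T0 where T0: "\<And>T. T \<ge> T0 \<Longrightarrow> \<exists>p. prime p \<and> q ^ T < real p \<and> real p \<le> q ^ (T + 3)"
    using eventually_prime_in_geometric_window[OF q] unfolding eventually_sequentially by blast
  show ?thesis
    using eventually_ge_at_top[of "q ^ (T0 + 4)"]
  proof eventually_elim
    case (elim y)
    have "1 \<le> q ^ (T0 + 4)" by (rule one_le_power) (use q in simp)
    then have y1: "y \<ge> 1" using elim by linarith
    define k where "k = nat \<lfloor>log q y\<rfloor>"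
    have log0: "0 \<le> log q y" using q y1 by simp
    have k: "real k \<le> log q y" "log q y < real k + 1"
      using log0 unfolding k_def by (auto simp: of_nat_nat)
    have kl: "q ^ k \<le> y" "y \<le> q ^ (k + 1)"
    proof -
      have "q powr real k \<le> q powr (log q y)" using k q by (intro powr_mono) auto
      then show "q ^ k \<le> y" using q y1 by (simp add: powr_realpow)
      have "q powr (log q y) \<le> q powr (real (k + 1))" using k q by (intro powr_mono) auto
      then show "y \<le> q ^ (k + 1)" using q y1 by (simp only: powr_realpow powr_log_cancel)
    qed
    have "q ^ (T0 + 4) \<le> q ^ (k + 1)" using elim kl(2) by linarith
    from power_le_imp_le_exp[OF q this] have kT: "T0 + 3 \<le> k" by simp
    then have "T0 \<le> k - 3" by simp
    from T0[OF this] obtain p where p: "prime p" "q ^ (k - 3) < real p" "real p \<le> q ^ (k - 3 + 3)" by blast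
    have "y \<le> q ^ (k - 3) * q ^ 4" using kl(2) kT by (simp add: power_add[symmetric])
    then have "(1 - \<eta>) * y \<le> (1 - \<eta>) * (q ^ (k - 3) * q ^ 4)" using \<eta> by (intro mult_left_mono) auto
    also have "\<dots> = q ^ (k - 3)" using \<eta> by (simp add: q4)
    finally have "(1 - \<eta>) * y \<le> real p" using p(2) by simp
    moreover have "real p \<le> y" using p(3) kl(1) kT by simp
    ultimately show ?case using p(1) by blast
  qed
qed

section \<open>The coloring number\<close>

definition real_point :: "nat \<Rightarrow> (nat \<Rightarrow> int) \<Rightarrow> nat \<Rightarrow> real" where
  "real_point n x = (\<lambda>i\<in>{..<n}. real_of_int (x i))"

lemma real_point_in_Rn: "real_point n x \<in> Rn n"
  by (simp add: real_point_def Rn_def PiE_iff)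

lemma edist_real_point: "edist n (real_point n x) (real_point n y) = sqrt (real_of_int (sqdist n x y))"
proof -
  have "(\<Sum>i<n. (real_point n x i - real_point n y i)\<^sup>2) = (\<Sum>i<n. (real_of_int (x i) - real_of_int (y i))\<^sup>2)"
    by (rule sum.cong) (auto simp: real_point_def)
  then show ?thesis by (simp add: edist_def L2_set_def sqdist_def)
qed

lemma inj_on_real_point: "inj_on (real_point n) ({..<n} \<rightarrow>\<^sub>E UNIV)"
proof (rule inj_onI)
  fix x y :: "nat \<Rightarrow> int"
  assume xy: "x \<in> {..<n} \<rightarrow>\<^sub>E UNIV" "y \<in> {..<n} \<rightarrow>\<^sub>E UNIV" "real_point n x = real_point n y"
  have "x i = y i" if "i < n" for i
  proof -
    have "real_point n x i = real_point n y i" using xy(3) by simp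
    then show ?thesis using that by (simp add: real_point_def)
  qed
  then show "x = y" using xy(1,2) by (intro PiE_ext) auto
qed

lemma sqdist_eq_0_iff:
  assumes "x \<in> {..<n} \<rightarrow>\<^sub>E UNIV" and "y \<in> {..<n} \<rightarrow>\<^sub>E UNIV"
  shows "sqdist n x y = 0 \<longleftrightarrow> x = y"
proof
  assume "sqdist n x y = 0"
  then have "\<forall>i<n. x i = y i" unfolding sqdist_def by (subst (asm) sum_nonneg_eq_0_iff) auto
  then show "x = y" using assms by (intro PiE_ext) auto
qed (simp add: sqdist_def)

lemma sqdist_commute: "sqdist n x y = sqdist n y x"
  unfolding sqdist_def by (simp add: power2_commute)

text \<open>As \<open>chi_max\<close> is a maximum over distance sets, it may be tested on the one
  set adapted to \<open>p\<close>. The largest color class of \<open>V\<close> contains no copy of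
  \<open>H\<close>, so its size is bounded by the dimension of the polynomial space, up to a
  constant.\<close>

lemma card_le_chi_max:
  fixes H :: "'a pair_pre_digraph"
  assumes H: "pair_graph H" and arcs: "parcs H \<noteq> {}" and Xi: "Xi H > 0"
  shows "\<exists>C. \<forall>n m p V. prime p \<longrightarrow> odd p \<longrightarrow> C < p \<longrightarrow> V \<subseteq> ({..<n} \<rightarrow>\<^sub>E UNIV) \<longrightarrow> finite V \<longrightarrow>
    (\<forall>x\<in>V. \<forall>y\<in>V. sqdist n x y < 2 * (int m + 1) * int p \<and> even (sqdist n x y)) \<longrightarrow>
    card V \<le> chi_max H n m * (C * (card (monom_exps (Suc n) (Xi H * (p - 1))) + 1))"
proof -
  interpret pair_graph H by (rule H)
  have ne: "pverts H \<noteq> {}" using arcs in_arcsD1 by fastforce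
  obtain C where C: "\<forall>(p :: int) (near :: (nat \<Rightarrow> int) \<Rightarrow> (nat \<Rightarrow> int) \<Rightarrow> bool) I D. prime p \<longrightarrow> int C < p \<longrightarrow> finite I \<longrightarrow>
    (\<forall>x. near x x) \<longrightarrow> (\<forall>x y. near x y \<longrightarrow> near y x) \<longrightarrow> nbhd_rank_le p I near (Xi H) D \<longrightarrow>
    card I > C * (D + 1) \<longrightarrow> embeds_near near I H"
    by (rule exE[OF embeds_near_if_rank_le_Xi[OF H ne Xi]])
  show ?thesis
  proof (intro exI[of _ C] allI impI)
    fix n m p :: nat and V :: "(nat \<Rightarrow> int) set"
    assume p: "prime p" "odd p" "C < p" and V: "V \<subseteq> {..<n} \<rightarrow>\<^sub>E UNIV" and fin: "finite V"
      and dist: "\<forall>x\<in>V. \<forall>y\<in>V. sqdist n x y < 2 * (int m + 1) * int p \<and> even (sqdist n x y)"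
    define D where "D = card (monom_exps (Suc n) (Xi H * (p - 1)))"
    define A where "A = (\<lambda>j. sqrt (2 * real p * real j)) ` {1..m}"
    have p0: "p > 0" using p(1) prime_gt_0_nat by blast
    have A: "A \<subseteq> {0<..}" "finite A" "card A = m"
      using p0 unfolding A_def by (auto simp: card_image inj_on_def)
    define k where "k = chi_dist H n A"
    have k_le: "k \<le> chi_max H n m"
      unfolding chi_max_def k_def using A by (intro Max_ge chi_max_set[OF H arcs]) auto
    obtain c where c: "good_coloring n A H k c"
      using chi_dist_good_coloring[OF H arcs A(1,2)] unfolding k_def by blast
    have col: "c (real_point n x) < k" for x
      using c real_point_in_Rn unfolding good_coloring_def by blast
    then have "{..<k} \<noteq> {}" by blast
    then obtain i where i: "card V \<le> card {..<k} * card {x \<in> V. c (real_point n x) = i}"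
      using pigeonhole_fibre[OF fin, of "{..<k}" "\<lambda>x. c (real_point n x)"] col by blast
    define I where "I = {x \<in> V. c (real_point n x) = i}"
    have IV: "I \<subseteq> V" by (auto simp: I_def)
    have finI: "finite I" using fin IV finite_subset by blast
    define near where "near = (\<lambda>x y. int p dvd sqdist n x y)"
    have "card I \<le> C * (D + 1)"
    proof (rule ccontr)
      assume "\<not> ?thesis"
      then have large: "card I > C * (D + 1)" by simp
      have 1: "\<forall>x. near x x" by (simp add: near_def sqdist_def)
      have 2: "\<forall>x y. near x y \<longrightarrow> near y x" by (simp add: near_def sqdist_commute)
      have 3: "nbhd_rank_le (int p) I near (Xi H) D"
        unfolding near_def D_def by (rule nbhd_rank_le_sqdist[OF p(1) finI])
      have "prime (int p)" "int C < int p" using p by auto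
      then have "embeds_near near I H" using C finI 1 2 3 large by blast
      then have "\<exists>\<phi>. \<phi> \<in> pverts H \<rightarrow> I \<and> inj_on \<phi> (pverts H) \<and>
          (\<forall>(u, v)\<in>parcs H. near (\<phi> u) (\<phi> v))"
        unfolding embeds_near_def .
      then obtain \<phi> where "\<phi> \<in> pverts H \<rightarrow> I \<and> inj_on \<phi> (pverts H) \<and>
          (\<forall>(u, v)\<in>parcs H. near (\<phi> u) (\<phi> v))" ..
      then have \<phi>: "\<phi> \<in> pverts H \<rightarrow> I" "inj_on \<phi> (pverts H)"
        and hom: "\<forall>(u, v)\<in>parcs H. near (\<phi> u) (\<phi> v)" by simp_all
      have \<phi>V: "\<phi> v \<in> V" "\<phi> v \<in> I" if "v \<in> pverts H" for v using \<phi>(1) IV that by auto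
      have "graph_copy n A H (\<lambda>v. real_point n (\<phi> v))"
        unfolding graph_copy_def
      proof (intro conjI)
        show "(\<lambda>v. real_point n (\<phi> v)) \<in> pverts H \<rightarrow> Rn n" using real_point_in_Rn by blast
        show "inj_on (\<lambda>v. real_point n (\<phi> v)) (pverts H)"
        proof (rule inj_onI)
          fix u v assume uv: "u \<in> pverts H" "v \<in> pverts H" "real_point n (\<phi> u) = real_point n (\<phi> v)"
          then have "\<phi> u = \<phi> v" using inj_on_real_point[of n, THEN inj_onD, OF uv(3)] \<phi>V V by blast
          then show "u = v" using \<phi>(2) uv(1,2) by (auto dest: inj_onD)
        qed
        show "\<forall>(u, v)\<in>parcs H. edist n (real_point n (\<phi> u)) (real_point n (\<phi> v)) \<in> A"
        proof clarify
          fix u v assume uv: "(u, v) \<in> parcs H"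
          have uvV: "u \<in> pverts H" "v \<in> pverts H" using in_arcsD1[OF uv] in_arcsD2[OF uv] by auto
          have "u \<noteq> v" using no_loops' uv by auto
          then have "\<phi> u \<noteq> \<phi> v" using \<phi>(2) uvV by (auto dest: inj_onD)
          define d where "d = sqdist n (\<phi> u) (\<phi> v)"
          have "d \<noteq> 0" unfolding d_def using sqdist_eq_0_iff[of "\<phi> u" n "\<phi> v"] \<phi>V uvV V \<open>\<phi> u \<noteq> \<phi> v\<close> by blast
          moreover have "d \<ge> 0" unfolding d_def sqdist_def by (intro sum_nonneg) auto
          ultimately have d0: "d > 0" by simp
          \<comment> \<open>Divisibility by \<open>p\<close> and by 2 gives
            \<open>d = 2 p j\<close>, as \<open>p\<close> is odd. Distinctness of the points gives
            \<open>j \<ge> 1\<close>, and the strict diameter bound gives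
            \<open>j \<le> m\<close>.\<close>
          have "int p dvd d" using hom uv unfolding near_def d_def by blast
          moreover have "2 dvd d" using dist \<phi>V uvV unfolding d_def by blast
          moreover have "coprime 2 (int p)" using p(2) by simp
          ultimately have "2 * int p dvd d" by (intro divides_mult) auto
          then obtain j where j: "d = 2 * int p * j" by (elim dvdE)
          have "d < 2 * (int m + 1) * int p" using dist \<phi>V uvV unfolding d_def by blast
          then have lt: "2 * int p * j < 2 * int p * (int m + 1)" unfolding j by (simp add: ac_simps)
          have "0 < 2 * int p" using p0 by simp
          then have jm: "j < int m + 1" by (rule iffD1[OF mult_less_cancel_left_pos lt])
          have j0: "j > 0" using d0 p0 unfolding j by (simp add: zero_less_mult_iff)
          have "edist n (real_point n (\<phi> u)) (real_point n (\<phi> v)) = sqrt (real_of_int d)"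
            unfolding d_def by (rule edist_real_point)
          also have "real_of_int d = 2 * real p * real (nat j)" using j0 by (simp add: j)
          finally show "edist n (real_point n (\<phi> u)) (real_point n (\<phi> v)) \<in> A"
            unfolding A_def by (rule image_eqI) (use j0 jm in auto)
        qed
      qed
      moreover have "\<forall>v\<in>pverts H. c (real_point n (\<phi> v)) = i" using \<phi>V by (auto simp: I_def)
      ultimately show False using c unfolding good_coloring_def by blast
    qed
    then have "card V \<le> k * (C * (D + 1))" using i unfolding I_def by (simp add: mult_le_mono2 order_trans)
    also have "\<dots> \<le> chi_max H n m * (C * (D + 1))" using k_le by (rule mult_le_mono1)
    finally show "card V \<le> chi_max H n m * (C * (card (monom_exps (Suc n) (Xi H * (p - 1))) + 1))"
      by (simp only: D_def)
  qed
qed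

lemma Gamma_chi_pos_witness:
  "\<exists>x>0. Gamma_chi = sqrt (pi / 2) * ((1 - exp (- x)) / sqrt x)"
  using Gamma_chi_attained unfolding Gamma_chi_def by metis

text \<open>The number of lattice points grows like \<open>K ^ n\<close> and the dimension at most
  like \<open>G ^ n\<close>; the parameters are arranged so that \<open>K / G\<close> lies slightly
  below the claimed base but above \<open>\<kappa>\<close>.\<close>

lemma eventually_power_le_chi_max:
  fixes H :: "'a pair_pre_digraph" and m :: nat
  assumes H: "pair_graph H" and arcs: "parcs H \<noteq> {}" and Xi: "Xi H > 0"
    and \<kappa>: "0 < \<kappa>" "\<kappa> < Gamma_chi * sqrt ((real m + 1) / real (Xi H))"
  shows "\<forall>\<^sub>F n in sequentially. \<kappa> ^ n \<le> real (chi_max H n m)"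
proof -
  define l where "l = real (Xi H)"
  have l: "l > 0" using Xi by (simp add: l_def)
  define \<Gamma> where "\<Gamma> = Gamma_chi * sqrt ((real m + 1) / l)"
  obtain x0 where x0: "x0 > 0" and G: "Gamma_chi = sqrt (pi / 2) * ((1 - exp (- x0)) / sqrt x0)"
    using Gamma_chi_pos_witness by blast
  define t where "t = exp (- x0)"
  have t: "0 < t" "t < 1" using x0 by (auto simp: t_def)
  define \<alpha> where "\<alpha> = 1 / (2 * x0 * l)"
  have \<alpha>: "\<alpha> > 0" using x0 l by (simp add: \<alpha>_def)
  have \<Gamma>_eq: "\<Gamma> = sqrt (pi * (real m + 1) * \<alpha>) * (1 - t)"
  proof -
    have "\<Gamma> = (sqrt (pi / 2) * sqrt ((real m + 1) / l) / sqrt x0) * (1 - t)"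
      unfolding \<Gamma>_def G t_def by simp
    also have "sqrt (pi / 2) * sqrt ((real m + 1) / l) / sqrt x0 = sqrt (pi / 2 * ((real m + 1) / l) / x0)"
      by (simp only: real_sqrt_mult real_sqrt_divide)
    also have "pi / 2 * ((real m + 1) / l) / x0 = pi * (real m + 1) * \<alpha>"
      using x0 l by (simp add: \<alpha>_def field_simps)
    finally show ?thesis .
  qed
  have \<Gamma>0: "\<Gamma> > 0" unfolding \<Gamma>_eq using t \<alpha> by (intro mult_pos_pos) (auto intro!: mult_pos_pos)
  have \<kappa>\<Gamma>: "\<kappa> < \<Gamma>" using \<kappa>(2) by (simp add: \<Gamma>_def l_def)
  \<comment> \<open>Two losses of a factor \<open>1 - \<theta>\<close> in the base are tolerated,
    since \<open>(1 - \<theta>)^2 > 1 - 4 \<theta> = \<kappa> / \<Gamma>\<close>: one through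
    \<open>c\<close>, one through \<open>K\<close>.\<close>
  define \<theta> where "\<theta> = (1 - \<kappa> / \<Gamma>) / 4"
  have \<theta>: "0 < \<theta>" "\<theta> < 1" using \<kappa>\<Gamma> \<kappa>(1) \<Gamma>0 by (auto simp: \<theta>_def field_simps)
  define \<kappa>' where "\<kappa>' = (1 - \<theta>)\<^sup>2 * \<Gamma>"
  have \<kappa>': "\<kappa> < \<kappa>'"
  proof -
    have "4 * \<theta> = 1 - \<kappa> / \<Gamma>" by (simp add: \<theta>_def)
    then have "\<kappa> / \<Gamma> = 1 - 4 * \<theta>" by simp
    also have "\<dots> < 1 - 2 * \<theta> + \<theta>\<^sup>2" using \<theta> by (simp add: add_pos_pos)
    also have "\<dots> = (1 - \<theta>)\<^sup>2" by (simp add: power2_diff)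
    finally show ?thesis using \<Gamma>0 by (simp add: \<kappa>'_def divide_less_eq)
  qed
  \<comment> \<open>One factor \<open>1 - \<theta>\<close> allows for
    \<open>p \<ge> (1 - \<theta>) \<alpha> n\<close>, the other makes the inequality
    \<open>4 c n < 2 (m + 1) p\<close> strict. Under the square root in \<open>K\<close> they amount
    to a single factor.\<close>
  define c where "c = (real m + 1) * \<alpha> * (1 - \<theta>)\<^sup>2 / 2"
  have c: "c > 0" using \<alpha> \<theta> by (simp add: c_def)
  define K where "K = (1 - \<theta>) * sqrt (2 * pi * exp 1 * c)"
  have sq0: "sqrt (2 * pi * exp 1 * c) > 0" using c by simp
  have K: "0 < K" "K < sqrt (2 * pi * exp 1 * c)"
    using \<theta> sq0 by (auto simp: K_def mult_less_cancel_right2)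
  \<comment> \<open>For \<open>p \<le> \<alpha> n\<close> the choice of \<open>\<alpha>\<close>
    gives \<open>t^(- l (p - 1)) \<le> exp (n / 2)\<close>, which contributes the numerator.\<close>
  define G where "G = exp (1 / 2) / (1 - t)"
  have G0: "G \<ge> 1" "G > 0"
  proof -
    have "1 - t \<le> exp (1 / 2 :: real)" using t one_le_exp_iff[of "1 / 2 :: real"] by linarith
    then show "G \<ge> 1" using t by (simp add: G_def le_divide_eq)
    then show "G > 0" by linarith
  qed
  have KG: "K / G = \<kappa>'"
  proof -
    have "(exp (1 / 2 :: real))\<^sup>2 = exp 1" using exp_double[of "1 / 2 :: real"] by simp
    then have "2 * pi * exp 1 * c = (pi * (real m + 1) * \<alpha>) * ((1 - \<theta>) * exp (1 / 2))\<^sup>2"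
      by (simp add: c_def power_mult_distrib mult_ac)
    then have "sqrt (2 * pi * exp 1 * c) = sqrt (pi * (real m + 1) * \<alpha>) * ((1 - \<theta>) * exp (1 / 2))"
      using \<theta> by (simp only: real_sqrt_mult real_sqrt_abs) (simp add: abs_mult)
    then show ?thesis using t
      by (simp add: K_def G_def \<kappa>'_def \<Gamma>_eq power2_eq_square)
  qed
  obtain C where C: "\<forall>n m p V. prime p \<longrightarrow> odd p \<longrightarrow> C < p \<longrightarrow> V \<subseteq> ({..<n} \<rightarrow>\<^sub>E UNIV) \<longrightarrow> finite V \<longrightarrow>
    (\<forall>x\<in>V. \<forall>y\<in>V. sqdist n x y < 2 * (int m + 1) * int p \<and> even (sqdist n x y)) \<longrightarrow>
    card V \<le> chi_max H n m * (C * (card (monom_exps (Suc n) (Xi H * (p - 1))) + 1))"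
    by (rule exE[OF card_le_chi_max[OF H arcs Xi]])
  \<comment> \<open>Absorbs \<open>C\<close>, the factor \<open>1 / (1 - t)\<close> of the
    additional variable and the 1 in \<open>D + 1\<close>.\<close>
  define C' where "C' = (real C + 1) * (1 / (1 - t) + 1)"
  have C': "C' > 0" using t by (simp add: C'_def add_pos_pos)
  have "filterlim (\<lambda>n. \<alpha> * real n) at_top sequentially"
    by (rule filterlim_tendsto_pos_mult_at_top[OF tendsto_const \<alpha> filterlim_real_sequentially])
  then have primes: "\<forall>\<^sub>F n in sequentially. \<exists>p. prime p \<and> (1 - \<theta>) * (\<alpha> * real n) \<le> real p \<and> real p \<le> \<alpha> * real n"
    using eventually_prime_between[OF \<theta>] unfolding filterlim_iff by blast
  have "filterlim (\<lambda>n. (1 - \<theta>) * \<alpha> * real n) at_top sequentially"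
    using \<alpha> \<theta> by (intro filterlim_tendsto_pos_mult_at_top[OF tendsto_const _ filterlim_real_sequentially]) simp
  then have big: "\<forall>\<^sub>F n in sequentially. real C + 3 \<le> (1 - \<theta>) * \<alpha> * real n"
    unfolding filterlim_at_top by blast
  have "(\<lambda>n. (\<kappa> / \<kappa>') ^ n) \<longlonglongrightarrow> 0" using \<kappa> \<kappa>' by (intro LIMSEQ_realpow_zero) auto
  from order_tendstoD(2)[OF this, of "1 / C'"]
  have small: "\<forall>\<^sub>F n in sequentially. (\<kappa> / \<kappa>') ^ n < 1 / C'" using C' by simp
  show ?thesis
    using primes big small many_even_lattice_points[OF c K] eventually_gt_at_top[of 0]
  proof eventually_elim
    case (elim n)
    obtain p where p: "prime p" "(1 - \<theta>) * (\<alpha> * real n) \<le> real p" "real p \<le> \<alpha> * real n" using elim(1) by blast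
    obtain V where V: "finite V" "V \<subseteq> {..<n} \<rightarrow>\<^sub>E UNIV" "K ^ n \<le> real (card V)"
      and dist: "\<forall>x\<in>V. \<forall>y\<in>V. real_of_int (sqdist n x y) \<le> 4 * c * real n \<and> even (sqdist n x y)"
      using elim(4) by blast
    have "real C + 3 \<le> real p" using elim(2) p(2) by (simp add: mult.assoc)
    then have pC: "C + 3 \<le> p" by linarith
    have "odd p" using p(1) pC prime_odd_nat[of p] by simp
    have less: "4 * c * real n < 2 * (real m + 1) * real p"
    proof -
      have "4 * c * real n = 2 * (real m + 1) * ((1 - \<theta>) * ((1 - \<theta>) * (\<alpha> * real n)))"
        by (simp add: c_def power2_eq_square)
      also have "\<dots> < 2 * (real m + 1) * (1 * ((1 - \<theta>) * (\<alpha> * real n)))"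
        using \<theta> \<alpha> elim(5) by (intro mult_strict_left_mono mult_strict_right_mono) auto
      also have "\<dots> \<le> 2 * (real m + 1) * real p" using p(2) by (intro mult_left_mono) auto
      finally show ?thesis .
    qed
    have dist': "\<forall>x\<in>V. \<forall>y\<in>V. sqdist n x y < 2 * (int m + 1) * int p \<and> even (sqdist n x y)"
    proof (intro ballI conjI)
      fix x y assume xy: "x \<in> V" "y \<in> V"
      have "real_of_int (sqdist n x y) \<le> 4 * c * real n" using dist xy by blast
      then have "real_of_int (sqdist n x y) < real_of_int (2 * (int m + 1) * int p)" using less by simp
      then show "sqdist n x y < 2 * (int m + 1) * int p" by (simp only: of_int_less_iff)
      show "even (sqdist n x y)" using dist xy by blast
    qed
    define D where "D = card (monom_exps (Suc n) (Xi H * (p - 1)))"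
    have card: "card V \<le> chi_max H n m * (C * (D + 1))"
      unfolding D_def using C p(1) \<open>odd p\<close> pC V(1,2) dist' by simp
    have D: "real D \<le> G ^ n / (1 - t)"
    proof -
      have "real (Xi H * (p - 1)) \<le> l * (\<alpha> * real n)"
      proof -
        have "real (p - 1) \<le> \<alpha> * real n" using p(3) by linarith
        then show ?thesis using l by (simp add: l_def mult_left_mono)
      qed
      also have "l * (\<alpha> * real n) = real n / (2 * x0)" using l by (simp add: \<alpha>_def)
      finally have "real (Xi H * (p - 1)) * x0 \<le> real n / 2" using x0 by (simp add: field_simps)
      then have "exp (- (real n / 2)) \<le> exp (- (real (Xi H * (p - 1)) * x0))" by simp
      also have "\<dots> = t ^ (Xi H * (p - 1))" by (simp only: t_def exp_of_nat_mult[symmetric]) simp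
      finally have "real D * exp (- (real n / 2)) \<le> real D * t ^ (Xi H * (p - 1))" by (intro mult_left_mono) auto
      also have "\<dots> \<le> (1 / (1 - t)) ^ Suc n" unfolding D_def by (rule card_monom_exps_le[OF t])
      finally have le: "real D * exp (- (real n / 2)) \<le> (1 / (1 - t)) ^ Suc n" .
      have "real D = real D * exp (- (real n / 2)) * exp (real n / 2)" by (simp add: mult.assoc exp_add[symmetric])
      also have "\<dots> \<le> (1 / (1 - t)) ^ Suc n * exp (real n / 2)" using le by (intro mult_right_mono) auto
      also have "exp (real n / 2) = exp (1 / 2) ^ n" by (simp add: exp_of_nat_mult[symmetric])
      finally show ?thesis by (simp add: G_def power_divide mult.commute)
    qed
    have "real C * (real D + 1) \<le> C' * G ^ n"
    proof -
      have "1 \<le> G ^ n" using G0 by simp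
      then have "real D + 1 \<le> (1 / (1 - t) + 1) * G ^ n" using D by (simp add: distrib_right)
      then have "real C * (real D + 1) \<le> (real C + 1) * ((1 / (1 - t) + 1) * G ^ n)" by (intro mult_mono) auto
      then show ?thesis by (simp add: C'_def mult.assoc)
    qed
    then have "real (chi_max H n m) * (real C * (real D + 1)) \<le> real (chi_max H n m) * (C' * G ^ n)"
      by (intro mult_left_mono) auto
    moreover have "real (card V) \<le> real (chi_max H n m) * (real C * (real D + 1))"
    proof -
      have "real (card V) \<le> real (chi_max H n m * (C * (D + 1)))" using card by (simp only: of_nat_le_iff)
      also have "\<dots> = real (chi_max H n m) * (real C * (real D + 1))" by (simp only: of_nat_mult of_nat_add of_nat_1)
      finally show ?thesis .
    qed
    ultimately have "K ^ n \<le> real (chi_max H n m) * (C' * G ^ n)" using V(3) by linarith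
    then have "(K / G) ^ n \<le> real (chi_max H n m) * C'"
      using G0 by (simp add: power_divide divide_le_eq mult.assoc)
    then have up: "\<kappa>' ^ n / C' \<le> real (chi_max H n m)" using C' by (simp add: KG divide_le_eq)
    have "\<kappa> ^ n \<le> \<kappa>' ^ n / C'"
    proof -
      have "\<kappa>' ^ n > 0" using \<kappa> \<kappa>' by simp
      then show ?thesis using elim(3) by (simp add: power_divide divide_less_eq)
    qed
    then show ?case using up by linarith
  qed
qed

theorem theorem1:
  fixes H :: "'a pair_pre_digraph" and m :: nat
  assumes "pair_graph H" and "parcs H \<noteq> {}" and "m \<ge> 1"
  shows "\<exists>\<epsilon> \<in> o(\<lambda>_. 1 :: real). \<forall>\<^sub>F n in sequentially.
           real (chi_max H n m)
             \<ge> (Gamma_chi * sqrt ((real m + 1) / real (Xi H)) + \<epsilon> n) ^ n"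
proof (cases "Xi H = 0")
  \<comment> \<open>Division by 0 yields 0, so the base of the power is 0 and the bound is trivial
    for \<open>n > 0\<close>.\<close>
  case True
  have "\<forall>\<^sub>F n in sequentially. (Gamma_chi * sqrt ((real m + 1) / real (Xi H)) + 0) ^ n \<le> real (chi_max H n m)"
    using eventually_gt_at_top[of 0] by eventually_elim (simp add: True zero_power)
  then show ?thesis by (intro bexI[of _ "\<lambda>_. 0"]) auto
next
  case False
  define L where "L = Gamma_chi * sqrt ((real m + 1) / real (Xi H))"
  have lower: "\<forall>\<^sub>F n in sequentially. \<kappa> ^ n \<le> real (chi_max H n m)" if "0 < \<kappa>" "\<kappa> < L" for \<kappa>
    using eventually_power_le_chi_max[OF assms(1,2) _ that(1)] that(2) False by (simp add: L_def)
  have L0: "0 \<le> L"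
  proof -
    obtain x where x: "x > 0" "Gamma_chi = sqrt (pi / 2) * ((1 - exp (- x)) / sqrt x)"
      using Gamma_chi_pos_witness by blast
    have "0 \<le> Gamma_chi"
      unfolding x(2) using x(1) by (intro mult_nonneg_nonneg divide_nonneg_nonneg) auto
    then show ?thesis by (simp add: L_def)
  qed
  define \<rho> where "\<rho> n = root n (real (chi_max H n m))" for n
  \<comment> \<open>The \<open>n\<close>-th root may stay above \<open>L\<close>, so only its
    shortfall is recorded; the bounds for all \<open>\<kappa> < L\<close> make this tend to
    0.\<close>
  define \<epsilon> where "\<epsilon> n = min 0 (\<rho> n - L)" for n
  have \<rho>: "0 \<le> \<rho> n" for n by (simp add: \<rho>_def real_root_ge_zero)
  have "\<epsilon> \<longlonglongrightarrow> 0"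
  proof (rule tendstoI)
    fix r :: real assume r: "r > 0"
    show "\<forall>\<^sub>F n in sequentially. dist (\<epsilon> n) 0 < r"
    proof (cases "L < r")
      case True
      have "dist (\<epsilon> n) 0 < r" for n using True \<rho>[of n] r by (auto simp: \<epsilon>_def dist_real_def)
      then show ?thesis by simp
    next
      case False
      then have "0 < L - r / 2" "L - r / 2 < L" using r by auto
      from lower[OF this] show ?thesis using eventually_gt_at_top[of 0]
      proof eventually_elim
        case (elim n)
        have "L - r / 2 = root n ((L - r / 2) ^ n)"
          using elim(2) \<open>0 < L - r / 2\<close> by (simp add: real_root_power_cancel)
        also have "\<dots> \<le> \<rho> n" unfolding \<rho>_def using elim by (intro real_root_le_mono)
        finally show ?case using r by (auto simp: \<epsilon>_def dist_real_def)
      qed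
    qed
  qed
  then have "\<epsilon> \<in> o(\<lambda>_. 1)" by (intro smalloI_tendsto) auto
  moreover have "\<forall>\<^sub>F n in sequentially. (L + \<epsilon> n) ^ n \<le> real (chi_max H n m)"
    using eventually_gt_at_top[of 0]
  proof eventually_elim
    case (elim n)
    have "0 \<le> L + \<epsilon> n" "L + \<epsilon> n \<le> \<rho> n" using L0 \<rho>[of n] by (auto simp: \<epsilon>_def)
    then have "(L + \<epsilon> n) ^ n \<le> \<rho> n ^ n" by (rule power_mono[rotated])
    also have "\<dots> = real (chi_max H n m)" unfolding \<rho>_def using elim by (intro real_root_pow_pos2) auto
    finally show ?case .
  qed
  ultimately show ?thesis unfolding L_def by blast
qed

end
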